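(* Let $R$ be a commutative Noetherian ring with identity, $\mathfrak{a}$ an ideal of $R$, $X$ an arbitrary $R$-module, and $t$ a positive integer. Then the following statements are equivalent: (i) $H^{i}_{\mathfrak{a}}(X)$ is Artinian for all $0\le i<t$. (ii) $\operatorname{Ext}^{i}_{R}(R/\mathfrak{a},X)$ is Artinian for all $0\le i<t$.
   Context: $H^{i}_{\mathfrak{a}}(X)$ denotes the $i$-th ordinary local cohomology module of $X$ with respect to $\mathfrak{a}$ (the $i$-th right derived functor of the $\mathfrak{a}$-torsion functor $\Gamma_{\mathfrak{a}}$). *)

theory Defs
  imports "HOL-Algebra.Module" "HOL-Algebra.Ideal_Product" "HOL-Algebra.Ring_Divisibility"
begin

section \<open>Modules: homomorphisms, quotients, the Artinian condition\<close>

definition module_hom ::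
    "('a, 'r) ring_scheme \<Rightarrow> ('a, 'b) module \<Rightarrow> ('a, 'c) module \<Rightarrow> ('b \<Rightarrow> 'c) set" where
  "module_hom R M N =
     {f \<in> carrier M \<rightarrow> carrier N.
        (\<forall>x\<in>carrier M. \<forall>y\<in>carrier M. f (x \<oplus>\<^bsub>M\<^esub> y) = f x \<oplus>\<^bsub>N\<^esub> f y) \<and>
        (\<forall>r\<in>carrier R. \<forall>x\<in>carrier M. f (r \<odot>\<^bsub>M\<^esub> x) = r \<odot>\<^bsub>N\<^esub> f x)}"

text \<open>The record type of modules extends that of rings. The fields \<open>mult\<close> and \<open>one\<close> play no
  role in the locale \<^locale>\<open>module\<close> and are left unspecified where nothing natural is
  available.\<close>

definition regular_module :: "('a, 'r) ring_scheme \<Rightarrow> ('a, 'a) module" where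
  "regular_module R =
     \<lparr>carrier = carrier R, monoid.mult = (\<otimes>\<^bsub>R\<^esub>),
      monoid.one = \<one>\<^bsub>R\<^esub>, ring.zero = \<zero>\<^bsub>R\<^esub>, ring.add = (\<oplus>\<^bsub>R\<^esub>),
      smult = (\<otimes>\<^bsub>R\<^esub>)\<rparr>"

definition quotient_module :: "('a, 'b) module \<Rightarrow> 'b set \<Rightarrow> ('a, 'b set) module" where
  "quotient_module M N =
     \<lparr>carrier = a_rcosets\<^bsub>M\<^esub> N, monoid.mult = undefined, monoid.one = undefined, ring.zero = N,
      ring.add = (<+>\<^bsub>M\<^esub>), smult = (\<lambda>r C. \<Union>x\<in>C. N +>\<^bsub>M\<^esub> (r \<odot>\<^bsub>M\<^esub> x))\<rparr>"

text \<open>Homomorphisms are made extensional, so that each of them is a single element.\<close>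

definition hom_module ::
    "('a, 'r) ring_scheme \<Rightarrow> ('a, 'b) module \<Rightarrow> ('a, 'c) module \<Rightarrow> ('a, 'b \<Rightarrow> 'c) module" where
  "hom_module R M N =
     \<lparr>carrier = module_hom R M N \<inter> extensional (carrier M),
      monoid.mult = undefined, monoid.one = undefined,
      ring.zero = (\<lambda>x\<in>carrier M. \<zero>\<^bsub>N\<^esub>),
      ring.add = (\<lambda>f g. \<lambda>x\<in>carrier M. f x \<oplus>\<^bsub>N\<^esub> g x),
      smult = (\<lambda>r f. \<lambda>x\<in>carrier M. r \<odot>\<^bsub>N\<^esub> f x)\<rparr>"

definition artinian_module :: "('a, 'r) ring_scheme \<Rightarrow> ('a, 'b) module \<Rightarrow> bool" where
  "artinian_module R M \<longleftrightarrow>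
     module R M \<and>
     (\<forall>N :: nat \<Rightarrow> 'b set.
        (\<forall>n. submodule (N n) R M) \<and> (\<forall>n. N (Suc n) \<subseteq> N n) \<longrightarrow>
        (\<exists>m. \<forall>n\<ge>m. N n = N m))"


section \<open>Injective resolutions and right derived functors\<close>

text \<open>Injectivity is tested on modules whose elements come from the same type as those of \<open>E\<close>.
  By Baer's criterion this is injectivity against modules of every type as soon as this type
  is at least as large as \<^typ>\<open>'a\<close>, because then the inclusions of the ideals of \<open>R\<close> into \<open>R\<close>
  are, up to isomorphism, among the tests.\<close>

definition injective_module :: "('a, 'r) ring_scheme \<Rightarrow> ('a, 'u) module \<Rightarrow> bool" where
  "injective_module R E \<longleftrightarrow>
     module R E \<and>
     (\<forall>(A :: ('a, 'u) module) (B :: ('a, 'u) module) i f.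
        module R A \<and> module R B \<and> i \<in> module_hom R A B \<and> inj_on i (carrier A) \<and>
        f \<in> module_hom R A E \<longrightarrow>
        (\<exists>g \<in> module_hom R B E. \<forall>x\<in>carrier A. g (i x) = f x))"

definition injective_resolution ::
    "('a, 'r) ring_scheme \<Rightarrow> ('a, 'b) module \<Rightarrow> (nat \<Rightarrow> ('a, 'u) module) \<Rightarrow>
     (nat \<Rightarrow> 'u \<Rightarrow> 'u) \<Rightarrow> ('b \<Rightarrow> 'u) \<Rightarrow> bool" where
  "injective_resolution R X E d \<epsilon> \<longleftrightarrow>
     (\<forall>n. injective_module R (E n)) \<and>
     (\<forall>n. d n \<in> module_hom R (E n) (E (Suc n))) \<and>
     \<epsilon> \<in> module_hom R X (E 0) \<and> inj_on \<epsilon> (carrier X) \<and>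
     a_kernel (E 0) (E 1) (d 0) = \<epsilon> ` carrier X \<and>
     (\<forall>n. a_kernel (E (Suc n)) (E (Suc (Suc n))) (d (Suc n)) = d n ` carrier (E n))"

text \<open>A type that houses an injective resolution of every module over a ring with elements in
  \<^typ>\<open>'a\<close> whose own elements are in \<^typ>\<open>'b\<close>. Its cardinality is \<open>u = 2 ^ k\<close> with \<open>k\<close>
  infinite and at least the cardinalities of both types, so that \<open>u ^ k = u\<close>. A module \<open>M\<close> with at
  most \<open>u\<close> elements embeds, as an abelian group, into a divisible group \<open>D\<close> with at most \<open>u\<close>
  elements (a quotient of the finitely supported functions from \<open>M\<close> to the rationals); hence,
  as a module, into the injective module of additive maps from \<open>R\<close> to \<open>D\<close>, which has at most
  \<open>u ^ k = u\<close> elements, and so has the cokernel of this embedding.\<close>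

type_synonym ('a, 'b) universe = "('a + 'b) list set"

definition chosen_resolution ::
    "('a, 'r) ring_scheme \<Rightarrow> ('a, 'b) module \<Rightarrow>
     (nat \<Rightarrow> ('a, ('a, 'b) universe) module) \<times>
     (nat \<Rightarrow> ('a, 'b) universe \<Rightarrow> ('a, 'b) universe)" where
  "chosen_resolution R X = (SOME (E, d). \<exists>\<epsilon>. injective_resolution R X E d \<epsilon>)"

definition cohomology ::
    "(nat \<Rightarrow> ('a, 'c) module) \<Rightarrow> (nat \<Rightarrow> 'c \<Rightarrow> 'c) \<Rightarrow> nat \<Rightarrow> ('a, 'c set) module" where
  "cohomology C d i =
     quotient_module ((C i)\<lparr>carrier := a_kernel (C i) (C (Suc i)) (d i)\<rparr>)
       (case i of 0 \<Rightarrow> {\<zero>\<^bsub>C 0\<^esub>} | Suc j \<Rightarrow> d j ` carrier (C j))"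

text \<open>A functor is given by its action \<open>F\<close> on modules and its action \<open>T\<close> on homomorphisms,
  \<open>T M N\<close> being the action on the homomorphisms from \<open>M\<close> to \<open>N\<close>.\<close>

definition right_derived ::
    "(('a, ('a, 'b) universe) module \<Rightarrow> ('a, 'c) module) \<Rightarrow>
     (('a, ('a, 'b) universe) module \<Rightarrow> ('a, ('a, 'b) universe) module \<Rightarrow>
        (('a, 'b) universe \<Rightarrow> ('a, 'b) universe) \<Rightarrow> 'c \<Rightarrow> 'c) \<Rightarrow>
     ('a, 'r) ring_scheme \<Rightarrow> nat \<Rightarrow> ('a, 'b) module \<Rightarrow> ('a, 'c set) module" where
  "right_derived F T R i X =
     (let (E, d) = chosen_resolution R X
      in cohomology (\<lambda>n. F (E n)) (\<lambda>n. T (E n) (E (Suc n)) (d n)) i)"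


section \<open>Local cohomology and Ext\<close>

definition torsion_module ::
    "('a, 'r) ring_scheme \<Rightarrow> 'a set \<Rightarrow> ('a, 'b) module \<Rightarrow> ('a, 'b) module" where
  "torsion_module R \<aa> M =
     M\<lparr>carrier := {x \<in> carrier M.
       \<exists>n::nat. \<forall>r \<in> \<aa> [^]\<^bsub>ideals_set R\<^esub> n. r \<odot>\<^bsub>M\<^esub> x = \<zero>\<^bsub>M\<^esub>}\<rparr>"

text \<open>The torsion functor acts on homomorphisms by restriction, that is, by the same function on
  a smaller carrier.\<close>

definition local_cohomology ::
    "('a, 'r) ring_scheme \<Rightarrow> 'a set \<Rightarrow> nat \<Rightarrow> ('a, 'b) module \<Rightarrow>
     ('a, ('a, 'b) universe set) module" where
  "local_cohomology R \<aa> i X = right_derived (torsion_module R \<aa>) (\<lambda>M N f. f) R i X"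

definition Ext ::
    "('a, 'r) ring_scheme \<Rightarrow> nat \<Rightarrow> ('a, 'c) module \<Rightarrow> ('a, 'b) module \<Rightarrow>
     ('a, ('c \<Rightarrow> ('a, 'b) universe) set) module" where
  "Ext R i N X =
     right_derived (hom_module R N) (\<lambda>M M' f g. compose (carrier N) f g) R i X"

end

theory Submission
  imports Defs "HOL-Algebra.IntRing" "HOL-Library.Countable"
begin

text \<open>Let \<open>E\<close> be an injective resolution of \<open>X\<close>, let \<open>G\<close> be its \<open>\<aa>\<close>-torsion part, and let \<open>Z\<close> and \<open>B\<close>
  be the cocycles and coboundaries of \<open>G\<close>. Local cohomology is the cohomology of \<open>G\<close>, and
  \<open>Ext(R / \<aa>, X)\<close> is the cohomology of the part \<open>(0 : \<aa>)\<close> of \<open>G\<close> annihilated by \<open>\<aa>\<close>. As \<open>R\<close> is Noetherian,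
  the torsion part of an injective module extends homomorphisms from submodules of \<open>R\<^sup>p\<close>, so
  \<open>Ext\<^sup>1(L, G\<^sup>n) = 0\<close> for finitely generated \<open>L\<close>.

  If \<open>H\<^sup>i(G)\<close> is Artinian for \<open>i < n\<close>, then \<open>Ext\<^sup>1(L, B\<^sup>n)\<close> is Artinian for every finitely generated \<open>L\<close>:
  this property passes from \<open>B\<^sup>i\<close> to \<open>Z\<^sup>i\<close> because \<open>H\<^sup>i(G)\<close> is Artinian, and from \<open>Z\<^sup>i\<close> to the next
  coboundaries \<open>G\<^sup>i / Z\<^sup>i\<close> by dimension shifting. For \<open>L = R / \<aa>\<close> it shows that the cohomology of
  \<open>(0 : \<aa>)\<close> in degree \<open>n\<close> agrees with the part of \<open>H\<^sup>n(G)\<close> annihilated by \<open>\<aa>\<close> up to Artinian modules.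
  By Melkersson's criterion, an \<open>\<aa>\<close>-torsion module is Artinian as soon as the part annihilated by \<open>\<aa>\<close>
  is, and the equivalence follows by induction on the degree.

  An injective resolution exists inside the universe because a module \<open>M\<close> embeds additively
  into a divisible group \<open>D\<close>, hence into the injective module of additive maps from \<open>R\<close> to \<open>D\<close>.\<close>

text \<open>The cocycles and coboundaries of \<open>G\<close> need not be injective, so their
  extension groups have to be followed through the complex. A condition on
  \<open>Ext^1(R/I, -)\<close> alone would not survive this: passing from the kernel of
  \<open>d\<close> to its image trades \<open>Ext^1(L, -)\<close> for \<open>Ext^1(K, -)\<close>
  with \<open>K\<close> a first syzygy of \<open>L\<close>. Hence the inductive condition speaks of
  all finitely generated \<open>L\<close>, a class that is closed under syzygies over a Noetherian
  ring. The maps of the long exact sequences enter only as linear relations between submodules. A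
  relation can stand for a connecting map, whose construction involves a choice of lift, just as
  well as for an honest homomorphism or its inverse. A second obstacle is that injectivity is tested
  on modules whose elements come from one fixed type. Free modules of finite rank and all terms of
  the resolution have to be copied into that type, which is why cardinalities are tracked by
  explicit injections.\<close>

section \<open>Homomorphisms and submodules\<close>

lemma module_homI:
  assumes "\<And>x. x \<in> carrier M \<Longrightarrow> f x \<in> carrier N"
    and "\<And>x y. x \<in> carrier M \<Longrightarrow> y \<in> carrier M \<Longrightarrow> f (x \<oplus>\<^bsub>M\<^esub> y) = f x \<oplus>\<^bsub>N\<^esub> f y"
    and "\<And>r x. r \<in> carrier R \<Longrightarrow> x \<in> carrier M \<Longrightarrow> f (r \<odot>\<^bsub>M\<^esub> x) = r \<odot>\<^bsub>N\<^esub> f x"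
  shows "f \<in> module_hom R M N"
  using assms by (auto simp: module_hom_def)

lemma module_homD:
  assumes "f \<in> module_hom R M N"
  shows module_hom_closed: "x \<in> carrier M \<Longrightarrow> f x \<in> carrier N"
    and module_hom_add: "x \<in> carrier M \<Longrightarrow> y \<in> carrier M \<Longrightarrow> f (x \<oplus>\<^bsub>M\<^esub> y) = f x \<oplus>\<^bsub>N\<^esub> f y"
    and module_hom_smult: "r \<in> carrier R \<Longrightarrow> x \<in> carrier M \<Longrightarrow> f (r \<odot>\<^bsub>M\<^esub> x) = r \<odot>\<^bsub>N\<^esub> f x"
  using assms by (auto simp: module_hom_def)

lemma (in module) a_inv_eq_smult: "x \<in> carrier M \<Longrightarrow> \<ominus>\<^bsub>M\<^esub> x = (\<ominus> \<one>) \<odot>\<^bsub>M\<^esub> x"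
  by (simp add: smult_l_minus)

lemma module_hom_more:
  assumes "f \<in> module_hom R M N" "module R M" "module R N"
  shows module_hom_zero: "f \<zero>\<^bsub>M\<^esub> = \<zero>\<^bsub>N\<^esub>"
    and module_hom_a_inv: "x \<in> carrier M \<Longrightarrow> f (\<ominus>\<^bsub>M\<^esub> x) = \<ominus>\<^bsub>N\<^esub> f x"
    and module_hom_minus: "x \<in> carrier M \<Longrightarrow> y \<in> carrier M \<Longrightarrow> f (x \<ominus>\<^bsub>M\<^esub> y) = f x \<ominus>\<^bsub>N\<^esub> f y"
proof -
  interpret M: module R M by fact
  interpret N: module R N by fact
  note cl = module_hom_closed[OF assms(1)] and ad = module_hom_add[OF assms(1)]
    and sm = module_hom_smult[OF assms(1)]
  show z: "f \<zero>\<^bsub>M\<^esub> = \<zero>\<^bsub>N\<^esub>"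
    using sm[of "\<zero>\<^bsub>R\<^esub>" "\<zero>\<^bsub>M\<^esub>"] cl[of "\<zero>\<^bsub>M\<^esub>"] by simp
  show i: "f (\<ominus>\<^bsub>M\<^esub> x) = \<ominus>\<^bsub>N\<^esub> f x" if "x \<in> carrier M" for x
    using that by (simp add: M.a_inv_eq_smult N.a_inv_eq_smult sm cl)
  show "f (x \<ominus>\<^bsub>M\<^esub> y) = f x \<ominus>\<^bsub>N\<^esub> f y" if "x \<in> carrier M" "y \<in> carrier M"
    using that by (simp add: M.minus_eq N.minus_eq ad i)
qed

lemma submoduleD:
  assumes "submodule N R M"
  shows submodule_subset: "N \<subseteq> carrier M"
    and submodule_mem: "x \<in> N \<Longrightarrow> x \<in> carrier M"
    and submodule_zero: "\<zero>\<^bsub>M\<^esub> \<in> N"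
    and submodule_add: "x \<in> N \<Longrightarrow> y \<in> N \<Longrightarrow> x \<oplus>\<^bsub>M\<^esub> y \<in> N"
    and submodule_smult: "r \<in> carrier R \<Longrightarrow> x \<in> N \<Longrightarrow> r \<odot>\<^bsub>M\<^esub> x \<in> N"
    and submodule_a_inv: "x \<in> N \<Longrightarrow> \<ominus>\<^bsub>M\<^esub> x \<in> N"
proof -
  interpret submodule N R M by fact
  show "N \<subseteq> carrier M" "x \<in> N \<Longrightarrow> x \<in> carrier M" "\<zero>\<^bsub>M\<^esub> \<in> N"
    "x \<in> N \<Longrightarrow> y \<in> N \<Longrightarrow> x \<oplus>\<^bsub>M\<^esub> y \<in> N"
    "r \<in> carrier R \<Longrightarrow> x \<in> N \<Longrightarrow> r \<odot>\<^bsub>M\<^esub> x \<in> N"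
    using subset one_closed m_closed smult_closed by auto
  show "x \<in> N \<Longrightarrow> \<ominus>\<^bsub>M\<^esub> x \<in> N"
    using m_inv_closed unfolding a_inv_def by auto
qed

context module
begin

text \<open>Closure under additive inverses comes for free, as \<open>-x\<close> is the multiple of
  \<open>x\<close> by \<open>-1\<close>.\<close>

lemma submoduleI':
  assumes "N \<subseteq> carrier M" "\<zero>\<^bsub>M\<^esub> \<in> N"
    and "\<And>x y. x \<in> N \<Longrightarrow> y \<in> N \<Longrightarrow> x \<oplus>\<^bsub>M\<^esub> y \<in> N"
    and sm: "\<And>r x. r \<in> carrier R \<Longrightarrow> x \<in> N \<Longrightarrow> r \<odot>\<^bsub>M\<^esub> x \<in> N"
  shows "submodule N R M"
proof (rule submoduleI)
  fix x assume x: "x \<in> N"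
  have "(\<ominus> \<one>) \<odot>\<^bsub>M\<^esub> x \<in> N" using sm[of "\<ominus> \<one>" x] x by simp
  then show "\<ominus>\<^bsub>M\<^esub> x \<in> N" using x assms(1) by (auto simp: a_inv_eq_smult)
qed (use assms in auto)

lemma submodule_minus:
  assumes "submodule N R M" "x \<in> N" "y \<in> N"
  shows "x \<ominus>\<^bsub>M\<^esub> y \<in> N"
  using assms by (simp add: M.minus_eq submodule_add submodule_a_inv)

lemma module_submodule:
  assumes "submodule N R M"
  shows "module R (M\<lparr>carrier := N\<rparr>)"
  using submodule.submodule_is_module[OF assms module_axioms] .

lemma submodule_restrict_iff:
  assumes "submodule N R M"
  shows "submodule K R (M\<lparr>carrier := N\<rparr>) \<longleftrightarrow> submodule K R M \<and> K \<subseteq> N"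
proof -
  interpret N: module R "M\<lparr>carrier := N\<rparr>" by (rule module_submodule) fact
  have N: "N \<subseteq> carrier M" using assms by (rule submodule_subset)
  show ?thesis
  proof (intro iffI conjI)
    assume K: "submodule K R (M\<lparr>carrier := N\<rparr>)"
    show sub: "K \<subseteq> N" using submodule_subset[OF K] by simp
    show "submodule K R M"
      by (rule submoduleI')
        (use N sub submodule_zero[OF K] submodule_add[OF K] submodule_smult[OF K] in auto)
  next
    assume K: "submodule K R M \<and> K \<subseteq> N"
    show "submodule K R (M\<lparr>carrier := N\<rparr>)"
      by (rule N.submoduleI') (use K in \<open>auto simp: submodule_zero submodule_add submodule_smult\<close>)
  qed
qed

lemma submodule_zero_singleton: "submodule {\<zero>\<^bsub>M\<^esub>} R M"
  by (rule submoduleI') auto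

lemma submodule_Int:
  "submodule A R M \<Longrightarrow> submodule B R M \<Longrightarrow> submodule (A \<inter> B) R M"
  by (rule submoduleI') (auto simp: submodule_zero submodule_add submodule_smult submodule_mem)

lemma set_add_mem: "z \<in> A <+>\<^bsub>M\<^esub> B \<longleftrightarrow> (\<exists>x\<in>A. \<exists>y\<in>B. z = x \<oplus>\<^bsub>M\<^esub> y)"
  by (auto simp: set_add_def')

lemma submodule_set_add:
  assumes A: "submodule A R M" and B: "submodule B R M"
  shows "submodule (A <+>\<^bsub>M\<^esub> B) R M"
proof (rule submoduleI')
  note mem = submodule_mem[OF A] submodule_mem[OF B]
  show "A <+>\<^bsub>M\<^esub> B \<subseteq> carrier M" using mem by (auto simp: set_add_mem)
  show "\<zero>\<^bsub>M\<^esub> \<in> A <+>\<^bsub>M\<^esub> B"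
    using submodule_zero[OF A] submodule_zero[OF B] by (force simp: set_add_mem)
  show "x \<oplus>\<^bsub>M\<^esub> y \<in> A <+>\<^bsub>M\<^esub> B" if xy: "x \<in> A <+>\<^bsub>M\<^esub> B" "y \<in> A <+>\<^bsub>M\<^esub> B" for x y
  proof -
    obtain a b a' b' where *: "a \<in> A" "b \<in> B" "x = a \<oplus>\<^bsub>M\<^esub> b" "a' \<in> A" "b' \<in> B" "y = a' \<oplus>\<^bsub>M\<^esub> b'"
      using xy by (auto simp: set_add_mem)
    then have "x \<oplus>\<^bsub>M\<^esub> y = (a \<oplus>\<^bsub>M\<^esub> a') \<oplus>\<^bsub>M\<^esub> (b \<oplus>\<^bsub>M\<^esub> b')"
      using mem by (simp add: M.a_ac)
    then show ?thesis
      using * submodule_add[OF A] submodule_add[OF B] unfolding set_add_mem by blast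
  qed
  show "r \<odot>\<^bsub>M\<^esub> x \<in> A <+>\<^bsub>M\<^esub> B" if "r \<in> carrier R" "x \<in> A <+>\<^bsub>M\<^esub> B" for r x
    using that mem submodule_smult[OF A] submodule_smult[OF B]
    by (auto simp: set_add_mem) (metis smult_r_distr)
qed

lemma set_add_upper1:
  assumes "submodule A R M" "submodule B R M" shows "A \<subseteq> A <+>\<^bsub>M\<^esub> B"
proof
  fix x assume "x \<in> A"
  then show "x \<in> A <+>\<^bsub>M\<^esub> B"
    using submodule_zero[OF assms(2)] submodule_mem[OF assms(1)] unfolding set_add_mem
    by (metis M.r_zero)
qed

lemma set_add_upper2:
  assumes "submodule A R M" "submodule B R M" shows "B \<subseteq> A <+>\<^bsub>M\<^esub> B"
proof
  fix x assume "x \<in> B"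
  then show "x \<in> A <+>\<^bsub>M\<^esub> B"
    using submodule_zero[OF assms(1)] submodule_mem[OF assms(2)] unfolding set_add_mem
    by (metis M.l_zero)
qed

lemma set_add_least:
  assumes "submodule C R M" "A \<subseteq> C" "B \<subseteq> C" shows "A <+>\<^bsub>M\<^esub> B \<subseteq> C"
  using assms(2,3) by (auto simp: set_add_mem intro!: submodule_add[OF assms(1)])

lemma set_add_mono: "A \<subseteq> A' \<Longrightarrow> A <+>\<^bsub>M\<^esub> B \<subseteq> A' <+>\<^bsub>M\<^esub> B"
  unfolding set_add_mem subset_iff by blast

lemma minus_add_cancel: "x \<in> carrier M \<Longrightarrow> y \<in> carrier M \<Longrightarrow> y \<oplus>\<^bsub>M\<^esub> (x \<ominus>\<^bsub>M\<^esub> y) = x"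
  by (metis M.a_comm M.a_assoc M.a_inv_closed M.l_neg M.minus_closed M.minus_eq M.r_zero)

lemma add_minus_cancel: "x \<in> carrier M \<Longrightarrow> y \<in> carrier M \<Longrightarrow> (x \<oplus>\<^bsub>M\<^esub> y) \<ominus>\<^bsub>M\<^esub> y = x"
  by (simp add: M.a_assoc M.minus_eq M.r_neg)

lemma add_minus_cancel': "x \<in> carrier M \<Longrightarrow> y \<in> carrier M \<Longrightarrow> (x \<oplus>\<^bsub>M\<^esub> y) \<ominus>\<^bsub>M\<^esub> x = y"
  using add_minus_cancel[of y x] by (simp add: M.a_comm)

lemma minus_eq_zero_iff: "x \<in> carrier M \<Longrightarrow> y \<in> carrier M \<Longrightarrow> x \<ominus>\<^bsub>M\<^esub> y = \<zero>\<^bsub>M\<^esub> \<longleftrightarrow> x = y"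
  by (metis M.minus_eq M.r_neg M.r_zero minus_add_cancel)

lemma minus_self [simp]: "x \<in> carrier M \<Longrightarrow> x \<ominus>\<^bsub>M\<^esub> x = \<zero>\<^bsub>M\<^esub>"
  by (simp add: minus_eq_zero_iff)

lemma smult_minus: "r \<in> carrier R \<Longrightarrow> x \<in> carrier M \<Longrightarrow> y \<in> carrier M \<Longrightarrow>
    r \<odot>\<^bsub>M\<^esub> (x \<ominus>\<^bsub>M\<^esub> y) = r \<odot>\<^bsub>M\<^esub> x \<ominus>\<^bsub>M\<^esub> r \<odot>\<^bsub>M\<^esub> y"
  by (simp add: M.minus_eq smult_r_distr smult_r_minus)

lemma smult_comm: "r \<in> carrier R \<Longrightarrow> s \<in> carrier R \<Longrightarrow> x \<in> carrier M \<Longrightarrow>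
    r \<odot>\<^bsub>M\<^esub> (s \<odot>\<^bsub>M\<^esub> x) = s \<odot>\<^bsub>M\<^esub> (r \<odot>\<^bsub>M\<^esub> x)"
  by (metis smult_assoc1 R.m_comm)

end

lemma submodule_vimage:
  assumes "module R M" "module R N" "f \<in> module_hom R M N" "submodule B R N"
  shows "submodule {x \<in> carrier M. f x \<in> B} R M"
proof -
  interpret M: module R M by fact
  show ?thesis
    by (rule M.submoduleI')
      (auto simp: module_hom_zero[OF assms(3,1,2)] module_homD[OF assms(3)] submodule_zero[OF assms(4)]
        submodule_add[OF assms(4)] submodule_smult[OF assms(4)])
qed

lemma submodule_image:
  assumes "module R M" "module R N" "f \<in> module_hom R M N" "submodule A R M"
  shows "submodule (f ` A) R N"
proof -
  interpret N: module R N by fact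
  note mem = submodule_mem[OF assms(4)]
  show ?thesis
  proof (rule N.submoduleI')
    show "f ` A \<subseteq> carrier N" using mem module_hom_closed[OF assms(3)] by auto
    show "\<zero>\<^bsub>N\<^esub> \<in> f ` A"
      using module_hom_zero[OF assms(3,1,2)] submodule_zero[OF assms(4)] by (metis imageI)
    show "x \<oplus>\<^bsub>N\<^esub> y \<in> f ` A" if "x \<in> f ` A" "y \<in> f ` A" for x y
      using that mem module_hom_add[OF assms(3)] submodule_add[OF assms(4)] by (auto simp: image_iff) metis
    show "r \<odot>\<^bsub>N\<^esub> x \<in> f ` A" if "r \<in> carrier R" "x \<in> f ` A" for r x
      using that mem module_hom_smult[OF assms(3)] submodule_smult[OF assms(4)] by (auto simp: image_iff) metis
  qed
qed

lemma module_hom_restrict_carrier: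
  "f \<in> module_hom R M N \<Longrightarrow> A \<subseteq> carrier M \<Longrightarrow> f \<in> module_hom R (M\<lparr>carrier := A\<rparr>) N"
  by (auto simp: module_hom_def Pi_iff subset_iff)

lemma module_hom_cong:
  assumes "module R M" "f \<in> module_hom R M N" "\<And>x. x \<in> carrier M \<Longrightarrow> g x = f x"
  shows "g \<in> module_hom R M N"
proof -
  interpret module R M by fact
  show ?thesis using assms(2,3) by (auto simp: module_hom_def)
qed

lemma module_hom_compose:
  "f \<in> module_hom R M N \<Longrightarrow> g \<in> module_hom R N P \<Longrightarrow> (\<lambda>x. g (f x)) \<in> module_hom R M P"
  by (auto simp: module_hom_def Pi_iff)

text \<open>\<open>artinian_between R M A B\<close> says that the subquotient \<open>A / B\<close> of \<open>M\<close> is Artinian. Speaking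
  about submodules between \<open>B\<close> and \<open>A\<close> avoids all quotient modules.\<close>

definition artinian_between ::
    "('a, 'r) ring_scheme \<Rightarrow> ('a, 'b, 'm) module_scheme \<Rightarrow> 'b set \<Rightarrow> 'b set \<Rightarrow> bool" where
  "artinian_between R M A B \<longleftrightarrow>
     (\<forall>N :: nat \<Rightarrow> 'b set.
        (\<forall>n. submodule (N n) R M \<and> B \<subseteq> N n \<and> N n \<subseteq> A) \<and> (\<forall>n. N (Suc n) \<subseteq> N n) \<longrightarrow>
        (\<exists>m. \<forall>n\<ge>m. N n = N m))"

lemma artinian_betweenI:
  assumes "\<And>N :: nat \<Rightarrow> _. (\<And>n. submodule (N n) R M) \<Longrightarrow> (\<And>n. B \<subseteq> N n) \<Longrightarrow> (\<And>n. N n \<subseteq> A) \<Longrightarrow> antimono N \<Longrightarrow>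
    \<exists>m. \<forall>n\<ge>m. N n = N m"
  shows "artinian_between R M A B"
  unfolding artinian_between_def decseq_Suc_iff[symmetric]
  by (intro allI impI, rule assms) auto

lemma artinian_betweenD:
  fixes N :: "nat \<Rightarrow> _"
  assumes "artinian_between R M A B"
    and "\<And>n. submodule (N n) R M" "\<And>n. B \<subseteq> N n" "\<And>n. N n \<subseteq> A" "antimono N"
  shows "\<exists>m. \<forall>n\<ge>m. N n = N m"
  by (rule mp[OF spec[OF assms(1)[unfolded artinian_between_def decseq_Suc_iff[symmetric]], of N]])
    (use assms(2-) in auto)

lemma artinian_between_mono:
  assumes "artinian_between R M A B" "B \<subseteq> B'" "A' \<subseteq> A"
  shows "artinian_between R M A' B'"
  by (rule artinian_betweenI, rule artinian_betweenD[OF assms(1)]) (use assms(2,3) in blast)+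

lemma artinian_between_refl: "artinian_between R M A A"
  by (rule artinian_betweenI) (metis subset_antisym)

text \<open>When \<open>A\<close> is a submodule, elements of \<open>A\<close> related to the same
  \<open>y\<close> differ by an element related to zero, hence by an element of \<open>B\<close>. So
  \<open>\<rho>\<close>, read from right to left, maps a part of \<open>A'\<close> onto
  \<open>A / B\<close> and sends what lies in \<open>B'\<close> to zero: \<open>A / B\<close> is a
  subquotient of \<open>A' / B'\<close>. As \<open>\<rho>\<close> may be the graph of a map, its
  converse, or a map given only up to a choice, this one lemma replaces all comparison maps between
  quotients.\<close>

lemma artinian_between_rel:
  assumes M: "module R M" and M': "module R M'"
    and A': "submodule A' R M'" and B': "submodule B' R M'" "B' \<subseteq> A'"
    and B: "submodule B R M"
    and car: "\<And>x y. \<rho> x y \<Longrightarrow> x \<in> carrier M \<and> y \<in> carrier M'"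
    and add: "\<And>x y x' y'. \<rho> x y \<Longrightarrow> \<rho> x' y' \<Longrightarrow> \<rho> (x \<oplus>\<^bsub>M\<^esub> x') (y \<oplus>\<^bsub>M'\<^esub> y')"
    and smult: "\<And>r x y. r \<in> carrier R \<Longrightarrow> \<rho> x y \<Longrightarrow> \<rho> (r \<odot>\<^bsub>M\<^esub> x) (r \<odot>\<^bsub>M'\<^esub> y)"
    and total: "\<And>x. x \<in> A \<Longrightarrow> \<exists>y\<in>A'. \<rho> x y"
    and inj: "\<And>x y. \<rho> x y \<Longrightarrow> x \<in> A \<Longrightarrow> y \<in> B' \<Longrightarrow> x \<in> B"
    and art: "artinian_between R M' A' B'"
  shows "artinian_between R M A B"
proof (rule artinian_betweenI)
  interpret M: module R M by fact
  interpret M': module R M' by fact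
  fix N :: "nat \<Rightarrow> _"
  assume N: "\<And>n. submodule (N n) R M" "\<And>n. B \<subseteq> N n" "\<And>n. N n \<subseteq> A" "antimono N"
  have minus: "\<rho> (x \<ominus>\<^bsub>M\<^esub> x') (y \<ominus>\<^bsub>M'\<^esub> y')" if "\<rho> x y" "\<rho> x' y'" for x y x' y'
    using add[OF that(1) smult[OF _ that(2), of "\<ominus>\<^bsub>R\<^esub> \<one>\<^bsub>R\<^esub>"]] car[OF that(2)]
    by (simp add: M.M.minus_eq M'.M.minus_eq M.a_inv_eq_smult M'.a_inv_eq_smult)
  define T where "T n = {y \<in> A'. \<exists>x\<in>N n. \<rho> x y}" for n
  define Q where "Q n = T n <+>\<^bsub>M'\<^esub> B'" for n
  have z: "\<rho> \<zero>\<^bsub>M\<^esub> \<zero>\<^bsub>M'\<^esub>"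
  proof -
    obtain y where "\<rho> \<zero>\<^bsub>M\<^esub> y"
      using total[of "\<zero>\<^bsub>M\<^esub>"] N(3)[of 0] submodule_zero[OF N(1)[of 0]] by auto
    from smult[OF _ this, of "\<zero>\<^bsub>R\<^esub>"] car[OF this] show ?thesis by simp
  qed
  have T: "submodule (T n) R M'" for n
  proof (rule M'.submoduleI')
    show "T n \<subseteq> carrier M'" using submodule_mem[OF A'] by (auto simp: T_def)
    show "\<zero>\<^bsub>M'\<^esub> \<in> T n"
      using z submodule_zero[OF A'] submodule_zero[OF N(1)] by (auto simp: T_def)
    show "x \<oplus>\<^bsub>M'\<^esub> y \<in> T n" if "x \<in> T n" "y \<in> T n" for x y
      using that add submodule_add[OF A'] submodule_add[OF N(1)] unfolding T_def by blast
    show "r \<odot>\<^bsub>M'\<^esub> x \<in> T n" if "r \<in> carrier R" "x \<in> T n" for r x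
      using that smult submodule_smult[OF A'] submodule_smult[OF N(1)] unfolding T_def by blast
  qed
  have Q: "submodule (Q n) R M'" for n
    unfolding Q_def by (rule M'.submodule_set_add[OF T B'(1)])
  have "antimono Q"
    unfolding Q_def T_def
    by (intro antimonoI M'.set_add_mono) (auto dest: subsetD[OF antimonoD[OF N(4)]])
  moreover have "Q n \<subseteq> A'" for n
    unfolding Q_def by (rule M'.set_add_least[OF A' _ B'(2)]) (auto simp: T_def)
  moreover have "B' \<subseteq> Q n" for n
    unfolding Q_def by (rule M'.set_add_upper2[OF T B'(1)])
  ultimately obtain m where m: "\<And>n. n \<ge> m \<Longrightarrow> Q n = Q m"
    using artinian_betweenD[OF art, of Q] Q by blast
  \<comment> \<open>An element \<open>x\<close> of \<open>N m\<close> has a partner \<open>y\<close>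
    in \<open>Q m = Q n\<close>, so \<open>y\<close> is the sum of a partner of some
    \<open>x'\<close> in \<open>N n\<close> and an element of \<open>B'\<close>. Then
    \<open>x - x'\<close> is related to an element of \<open>B'\<close>, hence lies in
    \<open>B\<close>, and \<open>B\<close> is part of \<open>N n\<close>.\<close>
  have "N m \<subseteq> N n" if "n \<ge> m" for n
  proof
    fix x assume x: "x \<in> N m"
    then obtain y where y: "y \<in> A'" "\<rho> x y" using total N(3) by blast
    then have "y \<in> Q m"
      using x M'.set_add_upper1[OF T B'(1), of m] by (auto simp: Q_def T_def)
    then have "y \<in> Q n" using m[OF that] by simp
    then obtain t b x' where t: "t \<in> A'" "x' \<in> N n" "\<rho> x' t" "b \<in> B'" "y = t \<oplus>\<^bsub>M'\<^esub> b"
      by (auto simp: Q_def T_def M'.set_add_mem)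
    have "y \<ominus>\<^bsub>M'\<^esub> t = b"
      using t submodule_mem[OF A'] submodule_mem[OF B'(1)] by (simp add: M'.add_minus_cancel')
    then have "\<rho> (x \<ominus>\<^bsub>M\<^esub> x') b" using minus[OF y(2) t(3)] by simp
    moreover have x': "x' \<in> N m" using t(2) antimonoD[OF N(4) that] by blast
    ultimately have "x \<ominus>\<^bsub>M\<^esub> x' \<in> B"
      using inj t(4) M.submodule_minus[OF N(1) x x'] N(3) by blast
    then have "x' \<oplus>\<^bsub>M\<^esub> (x \<ominus>\<^bsub>M\<^esub> x') \<in> N n"
      using submodule_add[OF N(1) t(2)] N(2) by blast
    then show "x \<in> N n"
      using x t(2) submodule_mem[OF N(1)] by (simp add: M.minus_add_cancel)
  qed
  then show "\<exists>m. \<forall>n\<ge>m. N n = N m"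
    using antimonoD[OF N(4)] by blast
qed

context module
begin

text \<open>By the modular law, two comparable submodules with the same sum and the same
  intersection with \<open>C\<close> are equal. Along a descending chain both the sums and the
  intersections stabilise.\<close>

lemma artinian_between_trans:
  assumes C: "submodule C R M" "B \<subseteq> C" "C \<subseteq> A"
    and A: "submodule A R M"
    and art: "artinian_between R M A C" "artinian_between R M C B"
  shows "artinian_between R M A B"
proof (rule artinian_betweenI)
  fix N :: "nat \<Rightarrow> _"
  assume N: "\<And>n. submodule (N n) R M" "\<And>n. B \<subseteq> N n" "\<And>n. N n \<subseteq> A" "antimono N"
  have "\<exists>m. \<forall>n\<ge>m. N n <+>\<^bsub>M\<^esub> C = N m <+>\<^bsub>M\<^esub> C"
  proof (rule artinian_betweenD[OF art(1)])
    show "antimono (\<lambda>n. N n <+>\<^bsub>M\<^esub> C)"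
      by (rule antimonoI) (rule set_add_mono[OF antimonoD[OF N(4)]])
    show "N n <+>\<^bsub>M\<^esub> C \<subseteq> A" for n using set_add_least[OF A N(3) C(3)] .
  qed (use N C set_add_upper2 in \<open>auto intro!: submodule_set_add\<close>)
  then obtain m1 where m1: "\<And>n. n \<ge> m1 \<Longrightarrow> N n <+>\<^bsub>M\<^esub> C = N m1 <+>\<^bsub>M\<^esub> C" by blast
  have "\<exists>m. \<forall>n\<ge>m. N n \<inter> C = N m \<inter> C"
  proof (rule artinian_betweenD[OF art(2)])
    show "antimono (\<lambda>n. N n \<inter> C)"
      by (rule antimonoI) (auto dest: subsetD[OF antimonoD[OF N(4)]])
  qed (use N C in \<open>auto intro!: submodule_Int\<close>)
  then obtain m2 where m2: "\<And>n. n \<ge> m2 \<Longrightarrow> N n \<inter> C = N m2 \<inter> C" by blast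
  define m where "m = max m1 m2"
  have "N m \<subseteq> N n" if n: "n \<ge> m" for n
  proof
    fix x assume x: "x \<in> N m"
    have "x \<in> N m <+>\<^bsub>M\<^esub> C" using set_add_upper1[OF N(1) C(1)] x by blast
    then have "x \<in> N n <+>\<^bsub>M\<^esub> C" using m1[of n] m1[of m] n by (auto simp: m_def)
    then obtain y c where yc: "y \<in> N n" "c \<in> C" "x = y \<oplus>\<^bsub>M\<^esub> c" by (auto simp: set_add_mem)
    have y: "y \<in> N m" using yc(1) antimonoD[OF N(4) n] by blast
    have "x \<ominus>\<^bsub>M\<^esub> y = c"
      using yc submodule_mem[OF N(1)] submodule_mem[OF C(1)] by (simp add: add_minus_cancel')
    then have "c \<in> N m \<inter> C" using submodule_minus[OF N(1) x y] yc(2) by simp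
    then have "c \<in> N n" using m2[of n] m2[of m] n by (auto simp: m_def)
    then show "x \<in> N n" using yc submodule_add[OF N(1)] by blast
  qed
  then show "\<exists>m. \<forall>n\<ge>m. N n = N m"
    using antimonoD[OF N(4)] by blast
qed

text \<open>By the second isomorphism theorem \<open>(A + C) / C\<close> is
  \<open>A / (A \<inter> C)\<close>, a quotient of \<open>A / D\<close>. The relation pairs a sum
  with its possible components in \<open>A\<close>.\<close>

lemma artinian_between_set_add:
  assumes A: "submodule A R M" and D: "submodule D R M" "D \<subseteq> A" "D \<subseteq> C" and C: "submodule C R M"
    and art: "artinian_between R M A D"
  shows "artinian_between R M (A <+>\<^bsub>M\<^esub> C) C"
proof (rule artinian_between_rel[OF module_axioms module_axioms A D(1,2) C _ _ _ _ _ art,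
      where \<rho> = "\<lambda>x a. a \<in> A \<and> (\<exists>c\<in>C. x = a \<oplus>\<^bsub>M\<^esub> c)"])
  note mem = submodule_mem[OF A] submodule_mem[OF C]
  fix x y x' y' r
  show "x \<in> carrier M \<and> y \<in> carrier M" if "y \<in> A \<and> (\<exists>c\<in>C. x = y \<oplus>\<^bsub>M\<^esub> c)"
    using that mem by auto
  show "\<exists>y\<in>A. y \<in> A \<and> (\<exists>c\<in>C. x = y \<oplus>\<^bsub>M\<^esub> c)" if "x \<in> A <+>\<^bsub>M\<^esub> C"
    using that by (auto simp: set_add_mem)
  show "x \<in> C" if "y \<in> A \<and> (\<exists>c\<in>C. x = y \<oplus>\<^bsub>M\<^esub> c)" "y \<in> D"
    using that D submodule_add[OF C] by auto
  show "r \<odot>\<^bsub>M\<^esub> y \<in> A \<and> (\<exists>c\<in>C. r \<odot>\<^bsub>M\<^esub> x = r \<odot>\<^bsub>M\<^esub> y \<oplus>\<^bsub>M\<^esub> c)"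
    if "r \<in> carrier R" "y \<in> A \<and> (\<exists>c\<in>C. x = y \<oplus>\<^bsub>M\<^esub> c)"
    using that mem submodule_smult[OF A] submodule_smult[OF C] by (auto simp: smult_r_distr)
  show "y \<oplus>\<^bsub>M\<^esub> y' \<in> A \<and> (\<exists>c\<in>C. x \<oplus>\<^bsub>M\<^esub> x' = y \<oplus>\<^bsub>M\<^esub> y' \<oplus>\<^bsub>M\<^esub> c)"
    if h: "y \<in> A \<and> (\<exists>c\<in>C. x = y \<oplus>\<^bsub>M\<^esub> c)" "y' \<in> A \<and> (\<exists>c\<in>C. x' = y' \<oplus>\<^bsub>M\<^esub> c)"
  proof -
    obtain c c' where c: "c \<in> C" "c' \<in> C" "x = y \<oplus>\<^bsub>M\<^esub> c" "x' = y' \<oplus>\<^bsub>M\<^esub> c'" using h by blast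
    then have "x \<oplus>\<^bsub>M\<^esub> x' = y \<oplus>\<^bsub>M\<^esub> y' \<oplus>\<^bsub>M\<^esub> (c \<oplus>\<^bsub>M\<^esub> c')"
      using h mem by (simp add: M.a_ac)
    then show ?thesis using h c submodule_add[OF A] submodule_add[OF C] by blast
  qed
qed

end

lemma (in cring) ideal_of_subset:
  assumes "I \<subseteq> carrier R" "\<zero> \<in> I" "\<And>x y. x \<in> I \<Longrightarrow> y \<in> I \<Longrightarrow> x \<oplus> y \<in> I"
    and sm: "\<And>r x. r \<in> carrier R \<Longrightarrow> x \<in> I \<Longrightarrow> r \<otimes> x \<in> I"
  shows "ideal I R"
proof (rule idealI)
  show "subgroup I (add_monoid R)"
  proof (rule add.subgroupI)
    fix x assume x: "x \<in> I"
    have "(\<ominus> \<one>) \<otimes> x \<in> I" using sm x by simp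
    then show "\<ominus> x \<in> I" using x assms(1) by (auto simp: l_minus)
  qed (use assms in auto)
  fix a x assume "a \<in> I" "x \<in> carrier R"
  then show "x \<otimes> a \<in> I" "a \<otimes> x \<in> I" using sm assms(1) m_comm[of a x] by auto
qed (rule ring_axioms)

lemma (in module) ideal_transporter:
  assumes "submodule B R M" "z \<in> carrier M"
  shows "ideal {r \<in> carrier R. r \<odot>\<^bsub>M\<^esub> z \<in> B} R"
  by (rule R.ideal_of_subset)
    (use assms in \<open>auto simp: submodule_zero submodule_add submodule_smult smult_l_distr smult_assoc1\<close>)

text \<open>Testing generators suffices because the scalars that move \<open>z\<close> into
  \<open>B\<close> form an ideal.\<close>

lemma (in module) genideal_transporter:
  assumes B: "submodule B R M" and z: "z \<in> carrier M" and X: "X \<subseteq> carrier R"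
    and *: "\<And>x. x \<in> X \<Longrightarrow> x \<odot>\<^bsub>M\<^esub> z \<in> B" and r: "r \<in> Idl X"
  shows "r \<odot>\<^bsub>M\<^esub> z \<in> B"
  using R.genideal_minimal[OF ideal_transporter[OF B z], of X] X * r by auto

lemma smult_module_hom:
  assumes "module R M" "r \<in> carrier R"
  shows "(\<lambda>x. r \<odot>\<^bsub>M\<^esub> x) \<in> module_hom R M M"
proof -
  interpret module R M by fact
  show ?thesis using assms(2) by (auto intro!: module_homI simp: smult_r_distr smult_comm)
qed

section \<open>Artinian modules and torsion\<close>

text \<open>For a descending chain \<open>N\<close>, the submodules \<open>x\<^sup>k N\<^sub>n \<inter> (B : x)\<close> decrease in both indices, so
  finitely many steps make them independent of \<open>n\<close> for all \<open>k\<close> at once.\<close>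

lemma artinian_between_torsion:
  fixes M :: "('a, 'b) module"
  assumes M: "module R M" and B: "submodule B R M" "B \<subseteq> Z" and Z: "submodule Z R M"
    and x: "x \<in> carrier R"
    and tors: "\<And>z. z \<in> Z \<Longrightarrow> \<exists>n::nat. (x [^]\<^bsub>R\<^esub> n) \<odot>\<^bsub>M\<^esub> z \<in> B"
    and art: "artinian_between R M {z \<in> Z. x \<odot>\<^bsub>M\<^esub> z \<in> B} B"
  shows "artinian_between R M Z B"
proof (rule artinian_betweenI)
  interpret module R M by fact
  fix N :: "nat \<Rightarrow> _"
  assume N: "\<And>n. submodule (N n) R M" "\<And>n. B \<subseteq> N n" "\<And>n. N n \<subseteq> Z" "antimono N"
  note Nmem = submodule_mem[OF N(1)] and Bmem = submodule_mem[OF B(1)]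
  define p where "p k y = (x [^]\<^bsub>R\<^esub> k) \<odot>\<^bsub>M\<^esub> y" for k :: nat and y
  have pcar: "x [^]\<^bsub>R\<^esub> k \<in> carrier R" for k :: nat using x by simp
  have phom: "p k \<in> module_hom R M M" for k
    unfolding p_def by (rule smult_module_hom[OF M pcar])
  have p_Suc: "p (Suc k) y = p k (x \<odot>\<^bsub>M\<^esub> y)" "p (Suc k) y = x \<odot>\<^bsub>M\<^esub> p k y"
    if "y \<in> carrier M" for k y
    using that x by (simp_all add: p_def smult_assoc1[symmetric] R.m_comm)
  have p_cl: "p k y \<in> carrier M" if "y \<in> carrier M" for k y
    using module_hom_closed[OF phom that] .
  \<comment> \<open>\<open>V k n\<close> is \<open>x^k N n \<inter> (B : x)\<close> up to
    \<open>B\<close>: the exponent \<open>Suc k\<close> in \<open>S\<close> says that one more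
    factor \<open>x\<close> moves \<open>x^k y\<close> into \<open>B\<close>.\<close>
  define S where "S k n = N n \<inter> {y \<in> carrier M. p (Suc k) y \<in> B}" for k n
  define V where "V k n = (p k ` S k n) <+>\<^bsub>M\<^esub> B" for k n
  have S: "submodule (S k n) R M" for k n
    unfolding S_def by (intro submodule_Int N(1) submodule_vimage[OF M M phom] B)
  have pS: "submodule (p k ` S k n) R M" for k n
    by (rule submodule_image[OF M M phom S])
  have V: "submodule (V k n) R M" for k n
    unfolding V_def by (rule submodule_set_add[OF pS B(1)])
  have BV: "B \<subseteq> V k n" for k n
    unfolding V_def by (rule set_add_upper2[OF pS B(1)])
  have pN: "p k y \<in> N n" if "y \<in> N n" for k y n
    unfolding p_def by (rule submodule_smult[OF N(1) pcar that])
  have sub: "submodule {z \<in> Z. x \<odot>\<^bsub>M\<^esub> z \<in> B} R M"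
    using submodule_Int[OF Z submodule_vimage[OF M M smult_module_hom[OF M x] B(1)]]
    by (rule back_subst[of "\<lambda>Q. submodule Q R M"]) (use submodule_subset[OF Z] in auto)
  have VA: "V k n \<subseteq> {z \<in> Z. x \<odot>\<^bsub>M\<^esub> z \<in> B}" for k n
    unfolding V_def
  proof (rule set_add_least[OF sub])
    show "p k ` S k n \<subseteq> {z \<in> Z. x \<odot>\<^bsub>M\<^esub> z \<in> B}"
      using subsetD[OF N(3) pN] p_Suc(2) by (auto simp: S_def)
    show "B \<subseteq> {z \<in> Z. x \<odot>\<^bsub>M\<^esub> z \<in> B}"
      using B(2) submodule_smult[OF B(1) x] by auto
  qed
  have V_anti_n: "V k n' \<subseteq> V k n" if "n \<le> n'" for k n n'
    unfolding V_def S_def by (rule set_add_mono) (use antimonoD[OF N(4) that] in blast)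
  have "V (Suc k) n \<subseteq> V k n" for k n
    unfolding V_def
  proof (intro set_add_mono subsetI)
    fix v assume "v \<in> p (Suc k) ` S (Suc k) n"
    then obtain y where y: "y \<in> S (Suc k) n" "v = p (Suc k) y" by blast
    then have ym: "y \<in> carrier M" "y \<in> N n" by (auto simp: S_def)
    have "x \<odot>\<^bsub>M\<^esub> y \<in> S k n"
      using y ym p_Suc(1)[OF ym(1), of "Suc k"] submodule_smult[OF N(1) x ym(2)] x by (auto simp: S_def)
    then show "v \<in> p k ` S k n" using y p_Suc(1)[OF ym(1)] by auto
  qed
  then have "antimono (\<lambda>k. V k n)" for n by (simp add: decseq_Suc_iff)
  then have V_anti_k: "V k' n \<subseteq> V k n" if "k \<le> k'" for k k' n
    using that by (rule antimonoD)
  \<comment> \<open>The diagonal settles all \<open>k\<close> above its stabilisation index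
    \<open>m0\<close> at once; the finitely many \<open>k\<close> up to \<open>m0\<close> are
    settled one by one through \<open>s\<close>.\<close>
  have "\<exists>m. \<forall>n\<ge>m. V n n = V m m"
    by (rule artinian_betweenD[OF art V BV VA])
      (intro antimonoI, rule order_trans[OF V_anti_n V_anti_k])
  then obtain m0 where m0: "\<And>n. n \<ge> m0 \<Longrightarrow> V n n = V m0 m0" by blast
  have "\<exists>m. \<forall>n\<ge>m. V k n = V k m" for k
    by (rule artinian_betweenD[OF art V BV VA]) (intro antimonoI, rule V_anti_n)
  then obtain s where s: "\<And>k n. n \<ge> s k \<Longrightarrow> V k n = V k (s k)" by metis
  define m where "m = Max (insert m0 (s ` {..m0}))"
  have m: "m \<ge> m0" "\<And>k. k \<le> m0 \<Longrightarrow> m \<ge> s k"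
    unfolding m_def by (rule Max_ge; simp)+
  have Vm: "V k m \<subseteq> V k n" if n: "n \<ge> m" for k n
  proof (cases "k \<le> m0")
    case True
    then show ?thesis using s[of k n] s[of k m] m n by (metis order_refl order_trans)
  next
    case False
    have "V k m \<subseteq> V m0 m0" using False V_anti_n[OF m(1), of k] V_anti_k[of m0 k m0] by auto
    also have "\<dots> = V (max k n) (max k n)" using m0[of "max k n"] m n by auto
    also have "\<dots> \<subseteq> V k n" using V_anti_n[of n "max k n" "max k n"] V_anti_k[of k "max k n" n] by auto
    finally show ?thesis .
  qed
  have "N m \<subseteq> N n" if n: "n \<ge> m" for n
  proof -
    \<comment> \<open>If \<open>x^(k+1) y\<close> lies in \<open>B\<close>, then
      \<open>x^k y\<close> lies in \<open>V k m\<close>, hence in \<open>V k n\<close>. So some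
      \<open>z\<close> in \<open>N n\<close> has \<open>x^k (y - z)\<close> in \<open>B\<close>, and
      the exponent has dropped by one.\<close>
    have *: "y \<in> N n" if "y \<in> N m" "p k y \<in> B" for k y
      using that
    proof (induction k arbitrary: y)
      case 0
      then show ?case using N(2) Nmem by (auto simp: p_def)
    next
      case (Suc k)
      note yc = Nmem[OF Suc.prems(1)]
      have "p k y \<in> p k ` S k m" using Suc.prems yc by (auto simp: S_def)
      then have "p k y \<in> V k m" unfolding V_def using set_add_upper1[OF pS B(1)] by blast
      then have "p k y \<in> V k n" using Vm[OF n] by blast
      then obtain z b where z: "z \<in> N n" "b \<in> B" "p k y = p k z \<oplus>\<^bsub>M\<^esub> b"
        by (auto simp: V_def S_def set_add_mem)
      note zc = Nmem[OF z(1)]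
      have "p k (y \<ominus>\<^bsub>M\<^esub> z) = b"
        using module_hom_minus[OF phom M M yc zc] z(3) add_minus_cancel' p_cl[OF zc] Bmem[OF z(2)] by simp
      moreover have "y \<ominus>\<^bsub>M\<^esub> z \<in> N m"
        using submodule_minus[OF N(1) Suc.prems(1)] z(1) antimonoD[OF N(4) n] by blast
      ultimately have "y \<ominus>\<^bsub>M\<^esub> z \<in> N n" using Suc.IH z(2) by blast
      then show ?case using minus_add_cancel[OF yc zc] submodule_add[OF N(1) z(1)] by metis
    qed
    show ?thesis using * tors N(3) unfolding p_def by blast
  qed
  then show "\<exists>m. \<forall>n\<ge>m. N n = N m"
    using antimonoD[OF N(4)] by blast
qed

lemma submodule_transporter:
  fixes M :: "('a, 'b) module"
  assumes M: "module R M" and Z: "submodule Z R M" and B: "submodule B R M" and X: "X \<subseteq> carrier R"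
  shows "submodule {z \<in> Z. \<forall>x\<in>X. x \<odot>\<^bsub>M\<^esub> z \<in> B} R M"
proof -
  interpret module R M by fact
  note mem = submodule_mem[OF Z]
  show ?thesis
    by (rule submoduleI')
      (use X mem submodule_zero[OF Z] submodule_add[OF Z] submodule_smult[OF Z] submodule_zero[OF B]
        submodule_add[OF B] submodule_smult[OF B] in \<open>auto simp: smult_r_distr smult_comm subset_iff\<close>)
qed

text \<open>Melkersson's criterion modulo \<open>B\<close>, one generator at a time: the one-element
  case, applied to the elements that the other generators move into \<open>B\<close>, supplies the
  hypothesis for those generators.\<close>

theorem artinian_between_torsion_finite:
  fixes M :: "('a, 'b) module"
  assumes M: "module R M" and B: "submodule B R M" "B \<subseteq> Z" and Z: "submodule Z R M"
    and X: "finite X" "X \<subseteq> carrier R"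
    and tors: "\<And>x z. x \<in> X \<Longrightarrow> z \<in> Z \<Longrightarrow> \<exists>n::nat. (x [^]\<^bsub>R\<^esub> n) \<odot>\<^bsub>M\<^esub> z \<in> B"
    and art: "artinian_between R M {z \<in> Z. \<forall>x\<in>X. x \<odot>\<^bsub>M\<^esub> z \<in> B} B"
  shows "artinian_between R M Z B"
  using X tors art
proof (induction X)
  case empty
  then show ?case by simp
next
  case (insert x X)
  let ?Z = "{z \<in> Z. \<forall>x\<in>X. x \<odot>\<^bsub>M\<^esub> z \<in> B}"
  have "artinian_between R M ?Z B"
  proof (rule artinian_between_torsion[OF M B(1)])
    show "submodule ?Z R M" using submodule_transporter[OF M Z B(1)] insert.prems by blast
    show "B \<subseteq> ?Z" using B(2) submodule_smult[OF B(1)] insert.prems(1) by blast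
    show "x \<in> carrier R" using insert.prems by blast
    show "artinian_between R M {z \<in> ?Z. x \<odot>\<^bsub>M\<^esub> z \<in> B} B"
      by (rule back_subst[of "\<lambda>Q. artinian_between R M Q B", OF insert.prems(3)]) auto
  qed (use insert.prems(2) in auto)
  then show ?case using insert by auto
qed

section \<open>Powers of an ideal\<close>

lemma ideals_pow_0: "I [^]\<^bsub>ideals_set R\<^esub> (0::nat) = carrier R"
  by (simp add: nat_pow_def ideals_set_def)

lemma ideals_pow_Suc: "I [^]\<^bsub>ideals_set R\<^esub> Suc n = ideal_prod R (I [^]\<^bsub>ideals_set R\<^esub> n) I"
  by (simp add: nat_pow_def ideals_set_def)

lemma (in ring) ideals_pow_ideal:
  "ideal I R \<Longrightarrow> ideal (I [^]\<^bsub>ideals_set R\<^esub> (n::nat)) R"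
proof (induction n)
  case 0
  then show ?case unfolding ideals_pow_0 by (simp add: oneideal)
next
  case (Suc n)
  then show ?case unfolding ideals_pow_Suc by (simp add: ideal_prod_is_ideal)
qed

lemma (in cring) pow_mem_ideals_pow:
  "x \<in> I \<Longrightarrow> ideal I R \<Longrightarrow> x [^] n \<in> I [^]\<^bsub>ideals_set R\<^esub> (n::nat)"
proof (induction n)
  case 0
  then show ?case unfolding ideals_pow_0 by simp
next
  case (Suc n)
  then show ?case unfolding ideals_pow_Suc by (simp add: ideal_prod.prod)
qed

lemma (in module) ideals_pow_Suc_kills:
  assumes I: "ideal I R" and y: "y \<in> carrier M"
    and *: "\<And>i j. i \<in> I [^]\<^bsub>ideals_set R\<^esub> (n::nat) \<Longrightarrow> j \<in> I \<Longrightarrow> i \<odot>\<^bsub>M\<^esub> (j \<odot>\<^bsub>M\<^esub> y) = \<zero>\<^bsub>M\<^esub>"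
    and r: "r \<in> I [^]\<^bsub>ideals_set R\<^esub> Suc n"
  shows "r \<odot>\<^bsub>M\<^esub> y = \<zero>\<^bsub>M\<^esub>"
proof -
  note car = ideal.Icarr[OF R.ideals_pow_ideal[OF I]] ideal.Icarr[OF I]
  have "r \<in> carrier R \<and> r \<odot>\<^bsub>M\<^esub> y = \<zero>\<^bsub>M\<^esub>"
    using r unfolding ideals_pow_Suc
  proof (induction r rule: ideal_prod.induct)
    case (prod i j)
    then show ?case using car * y by (simp add: smult_assoc1)
  next
    case (sum s1 s2)
    then show ?case using y by (simp add: smult_l_distr)
  qed
  then show ?thesis ..
qed

lemma (in module) ideals_pow_kills_mono:
  assumes I: "ideal I R" and y: "y \<in> carrier M"
    and *: "\<And>r. r \<in> I [^]\<^bsub>ideals_set R\<^esub> (n::nat) \<Longrightarrow> r \<odot>\<^bsub>M\<^esub> y = \<zero>\<^bsub>M\<^esub>"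
    and "n \<le> m" and r: "r \<in> I [^]\<^bsub>ideals_set R\<^esub> m"
  shows "r \<odot>\<^bsub>M\<^esub> y = \<zero>\<^bsub>M\<^esub>"
  using \<open>n \<le> m\<close> r
proof (induction m arbitrary: r rule: dec_induct)
  case (step m)
  show ?case
  proof (rule ideals_pow_Suc_kills[OF I y _ step.prems])
    fix i j assume "i \<in> I [^]\<^bsub>ideals_set R\<^esub> m" "j \<in> I"
    moreover from this have "i \<in> carrier R" "j \<in> carrier R"
      using ideal.Icarr[OF R.ideals_pow_ideal[OF I]] ideal.Icarr[OF I] by blast+
    ultimately show "i \<odot>\<^bsub>M\<^esub> (j \<odot>\<^bsub>M\<^esub> y) = \<zero>\<^bsub>M\<^esub>"
      using step.IH[of i] y smult_comm[of i j y] by simp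
  qed
qed (use * in auto)

text \<open>Induction on the sum of the exponents: multiplying \<open>y\<close> by a generator
  lowers the exponent of that generator by one, and an exponent zero forces \<open>y\<close> to
  vanish.\<close>

lemma (in module) genideal_pow_kills:
  fixes f :: "_ \<Rightarrow> nat"
  assumes X: "finite X" "X \<subseteq> carrier R" and y: "y \<in> carrier M"
    and *: "\<And>x. x \<in> X \<Longrightarrow> (x [^] f x) \<odot>\<^bsub>M\<^esub> y = \<zero>\<^bsub>M\<^esub>"
  shows "\<exists>n::nat. \<forall>r \<in> (Idl X) [^]\<^bsub>ideals_set R\<^esub> n. r \<odot>\<^bsub>M\<^esub> y = \<zero>\<^bsub>M\<^esub>"
  using y *
proof (induction "sum f X" arbitrary: f y rule: less_induct)
  case less
  have I: "ideal (Idl X) R" using X by (simp add: R.genideal_ideal)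
  note car = ideal.Icarr[OF R.ideals_pow_ideal[OF I]]
  show ?case
  proof (cases "\<exists>x\<in>X. f x = 0")
    case True
    then have "y = \<zero>\<^bsub>M\<^esub>" using less.prems X by (metis R.nat_pow_0 smult_one)
    then show ?thesis using car by auto
  next
    case False
    have "\<exists>n::nat. \<forall>r \<in> (Idl X) [^]\<^bsub>ideals_set R\<^esub> n. r \<odot>\<^bsub>M\<^esub> (x \<odot>\<^bsub>M\<^esub> y) = \<zero>\<^bsub>M\<^esub>" if x: "x \<in> X" for x
    proof (rule less.hyps[of "f(x := f x - 1)"])
      have xc: "x \<in> carrier R" using x X by blast
      show "sum (f(x := f x - 1)) X < sum f X"
        by (rule sum_strict_mono_ex1) (use X x False in auto)
      show "x \<odot>\<^bsub>M\<^esub> y \<in> carrier M" using xc less.prems by simp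
      fix x' assume x': "x' \<in> X"
      then have xc': "x' \<in> carrier R" using X by blast
      show "(x' [^] (f(x := f x - 1)) x') \<odot>\<^bsub>M\<^esub> (x \<odot>\<^bsub>M\<^esub> y) = \<zero>\<^bsub>M\<^esub>"
      proof (cases "x' = x")
        case True
        obtain k where k: "f x = Suc k" using False x by (cases "f x") auto
        show ?thesis using True k less.prems(2)[OF x] xc less.prems(1) by (simp add: smult_assoc1)
      next
        case False
        have "(x' [^] f x') \<odot>\<^bsub>M\<^esub> (x \<odot>\<^bsub>M\<^esub> y) = x \<odot>\<^bsub>M\<^esub> ((x' [^] f x') \<odot>\<^bsub>M\<^esub> y)"
          using xc xc' less.prems(1) by (intro smult_comm) auto
        then show ?thesis using False less.prems(2)[OF x'] xc by simp
      qed
    qed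
    then obtain N where N: "\<And>x r. x \<in> X \<Longrightarrow> r \<in> (Idl X) [^]\<^bsub>ideals_set R\<^esub> (N x :: nat) \<Longrightarrow>
        r \<odot>\<^bsub>M\<^esub> (x \<odot>\<^bsub>M\<^esub> y) = \<zero>\<^bsub>M\<^esub>" by metis
    \<comment> \<open>A common exponent for all generators: the \<open>n\<close>-th power of the
      ideal kills \<open>x y\<close> for every generator \<open>x\<close>, hence all multiples of
      \<open>y\<close> by elements of the ideal, and so the next power kills
      \<open>y\<close>.\<close>
    define n where "n = Max (insert 0 (N ` X))"
    have n: "N x \<le> n" if "x \<in> X" for x using that X by (auto simp: n_def)
    have "r \<odot>\<^bsub>M\<^esub> y = \<zero>\<^bsub>M\<^esub>" if r: "r \<in> (Idl X) [^]\<^bsub>ideals_set R\<^esub> Suc n" for r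
    proof (rule ideals_pow_Suc_kills[OF I less.prems(1) _ r])
      fix i j assume i: "i \<in> (Idl X) [^]\<^bsub>ideals_set R\<^esub> n" and j: "j \<in> Idl X"
      have ic: "i \<in> carrier R" using car i .
      have "j \<odot>\<^bsub>M\<^esub> (i \<odot>\<^bsub>M\<^esub> y) \<in> {\<zero>\<^bsub>M\<^esub>}"
      proof (rule genideal_transporter[OF submodule_zero_singleton _ X(2) _ j])
        show "i \<odot>\<^bsub>M\<^esub> y \<in> carrier M" using ic less.prems by simp
        fix x assume x: "x \<in> X"
        have xc: "x \<in> carrier R" using x X by blast
        have "i \<odot>\<^bsub>M\<^esub> (x \<odot>\<^bsub>M\<^esub> y) = \<zero>\<^bsub>M\<^esub>"
          by (rule ideals_pow_kills_mono[OF I _ N[OF x] n[OF x] i]) (use xc less.prems in auto)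
        then show "x \<odot>\<^bsub>M\<^esub> (i \<odot>\<^bsub>M\<^esub> y) \<in> {\<zero>\<^bsub>M\<^esub>}" using xc ic less.prems by (simp add: smult_comm)
      qed
      then show "i \<odot>\<^bsub>M\<^esub> (j \<odot>\<^bsub>M\<^esub> y) = \<zero>\<^bsub>M\<^esub>"
        using ic less.prems ideal.Icarr[OF I j] by (simp add: smult_comm)
    qed
    then show ?thesis by blast
  qed
qed

text \<open>This turns torsion with respect to powers of the ideal into the condition on single
  generators that \<open>artinian_between_torsion_finite\<close> asks for.\<close>

lemma (in module) torsion_iff:
  assumes X: "finite X" "X \<subseteq> carrier R" and y: "y \<in> carrier M"
  shows "(\<exists>n::nat. \<forall>r \<in> (Idl X) [^]\<^bsub>ideals_set R\<^esub> n. r \<odot>\<^bsub>M\<^esub> y = \<zero>\<^bsub>M\<^esub>) \<longleftrightarrow>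
    (\<forall>x\<in>X. \<exists>n::nat. (x [^] n) \<odot>\<^bsub>M\<^esub> y = \<zero>\<^bsub>M\<^esub>)"
proof
  have I: "ideal (Idl X) R" using X by (simp add: R.genideal_ideal)
  assume "\<exists>n::nat. \<forall>r \<in> (Idl X) [^]\<^bsub>ideals_set R\<^esub> n. r \<odot>\<^bsub>M\<^esub> y = \<zero>\<^bsub>M\<^esub>"
  then show "\<forall>x\<in>X. \<exists>n::nat. (x [^] n) \<odot>\<^bsub>M\<^esub> y = \<zero>\<^bsub>M\<^esub>"
    using R.pow_mem_ideals_pow[OF _ I] R.genideal_self[OF X(2)] by (meson subsetD)
next
  assume "\<forall>x\<in>X. \<exists>n::nat. (x [^] n) \<odot>\<^bsub>M\<^esub> y = \<zero>\<^bsub>M\<^esub>"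
  then obtain f :: "_ \<Rightarrow> nat" where "\<And>x. x \<in> X \<Longrightarrow> (x [^] f x) \<odot>\<^bsub>M\<^esub> y = \<zero>\<^bsub>M\<^esub>" by metis
  then show "\<exists>n::nat. \<forall>r \<in> (Idl X) [^]\<^bsub>ideals_set R\<^esub> n. r \<odot>\<^bsub>M\<^esub> y = \<zero>\<^bsub>M\<^esub>"
    by (rule genideal_pow_kills[OF X y])
qed

lemma submodule_equalizer:
  assumes M: "module R M" and N: "module R N" and f: "f \<in> module_hom R M N" and g: "g \<in> module_hom R M N"
  shows "submodule {x \<in> carrier M. f x = g x} R M"
proof -
  interpret M: module R M by fact
  show ?thesis
    by (rule M.submoduleI')
      (auto simp: module_hom_zero[OF f M N] module_hom_zero[OF g M N] module_homD[OF f] module_homD[OF g])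
qed

section \<open>Free modules of finite rank\<close>

text \<open>Vectors are padded by zeros, so that all ranks share one type: statements can quantify
  over the rank, and rank \<open>p\<close> is literally the part of rank \<open>Suc p\<close> where
  coordinate \<open>p\<close> is zero.\<close>

definition free_module :: "('a, 'r) ring_scheme \<Rightarrow> nat \<Rightarrow> ('a, nat \<Rightarrow> 'a) module" where
  "free_module R p =
     \<lparr>carrier = {f. (\<forall>i<p. f i \<in> carrier R) \<and> (\<forall>i\<ge>p. f i = \<zero>\<^bsub>R\<^esub>)},
      monoid.mult = undefined, monoid.one = undefined, ring.zero = (\<lambda>_. \<zero>\<^bsub>R\<^esub>),
      ring.add = (\<lambda>f g i. f i \<oplus>\<^bsub>R\<^esub> g i), smult = (\<lambda>r f i. r \<otimes>\<^bsub>R\<^esub> f i)\<rparr>"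

lemma free_module_sel [simp]:
  "\<zero>\<^bsub>free_module R p\<^esub> = (\<lambda>_. \<zero>\<^bsub>R\<^esub>)"
  "f \<oplus>\<^bsub>free_module R p\<^esub> g = (\<lambda>i. f i \<oplus>\<^bsub>R\<^esub> g i)"
  "r \<odot>\<^bsub>free_module R p\<^esub> f = (\<lambda>i. r \<otimes>\<^bsub>R\<^esub> f i)"
  by (simp_all add: free_module_def)

lemma free_module_carrier:
  "f \<in> carrier (free_module R p) \<longleftrightarrow> (\<forall>i<p. f i \<in> carrier R) \<and> (\<forall>i\<ge>p. f i = \<zero>\<^bsub>R\<^esub>)"
  by (simp add: free_module_def)

definition unit_vector :: "('a, 'r) ring_scheme \<Rightarrow> nat \<Rightarrow> nat \<Rightarrow> 'a" where
  "unit_vector R i = (\<lambda>j. if j = i then \<one>\<^bsub>R\<^esub> else \<zero>\<^bsub>R\<^esub>)"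

context cring
begin

lemma free_module_coord: "f \<in> carrier (free_module R p) \<Longrightarrow> f i \<in> carrier R"
  by (cases "i < p") (auto simp: free_module_carrier)

lemma free_module_closed:
  assumes "f \<in> carrier (free_module R p)"
  shows "g \<in> carrier (free_module R p) \<Longrightarrow> f \<oplus>\<^bsub>free_module R p\<^esub> g \<in> carrier (free_module R p)"
    and "r \<in> carrier R \<Longrightarrow> r \<odot>\<^bsub>free_module R p\<^esub> f \<in> carrier (free_module R p)"
    and "(\<lambda>i. \<ominus> f i) \<in> carrier (free_module R p)"
  using assms by (auto simp: free_module_carrier)

lemma module_free_module: "module R (free_module R p)"
proof (rule moduleI)
  note co = free_module_coord[of _ p]
  show "abelian_group (free_module R p)"
  proof (rule abelian_groupI)
    fix x assume x: "x \<in> carrier (free_module R p)"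
    have "(\<lambda>i. \<ominus> x i) \<oplus>\<^bsub>free_module R p\<^esub> x = \<zero>\<^bsub>free_module R p\<^esub>"
      using co[OF x] by (auto simp: l_neg)
    then show "\<exists>y\<in>carrier (free_module R p). y \<oplus>\<^bsub>free_module R p\<^esub> x = \<zero>\<^bsub>free_module R p\<^esub>"
      using free_module_closed(3)[OF x] by blast
    show "\<zero>\<^bsub>free_module R p\<^esub> \<oplus>\<^bsub>free_module R p\<^esub> x = x" using co[OF x] by simp
    fix y assume y: "y \<in> carrier (free_module R p)"
    show "x \<oplus>\<^bsub>free_module R p\<^esub> y \<in> carrier (free_module R p)"
      using x y by (rule free_module_closed)
    show "x \<oplus>\<^bsub>free_module R p\<^esub> y = y \<oplus>\<^bsub>free_module R p\<^esub> x"
      using co[OF x] co[OF y] by (simp add: a_comm)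
    fix z assume z: "z \<in> carrier (free_module R p)"
    show "x \<oplus>\<^bsub>free_module R p\<^esub> y \<oplus>\<^bsub>free_module R p\<^esub> z =
        x \<oplus>\<^bsub>free_module R p\<^esub> (y \<oplus>\<^bsub>free_module R p\<^esub> z)"
      using co[OF x] co[OF y] co[OF z] by (simp add: a_assoc)
  qed (simp add: free_module_carrier)
  fix r s x assume r: "r \<in> carrier R" and s: "s \<in> carrier R" and x: "x \<in> carrier (free_module R p)"
  show "(r \<oplus> s) \<odot>\<^bsub>free_module R p\<^esub> x = r \<odot>\<^bsub>free_module R p\<^esub> x \<oplus>\<^bsub>free_module R p\<^esub> s \<odot>\<^bsub>free_module R p\<^esub> x"
    using co[OF x] r s by (simp add: l_distr)
  show "r \<otimes> s \<odot>\<^bsub>free_module R p\<^esub> x = r \<odot>\<^bsub>free_module R p\<^esub> (s \<odot>\<^bsub>free_module R p\<^esub> x)"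
    using co[OF x] r s by (simp add: m_assoc)
next
  fix r x assume r: "r \<in> carrier R" and x: "x \<in> carrier (free_module R p)"
  show "r \<odot>\<^bsub>free_module R p\<^esub> x \<in> carrier (free_module R p)"
    using x r by (rule free_module_closed)
  fix y assume y: "y \<in> carrier (free_module R p)"
  show "r \<odot>\<^bsub>free_module R p\<^esub> (x \<oplus>\<^bsub>free_module R p\<^esub> y) =
      r \<odot>\<^bsub>free_module R p\<^esub> x \<oplus>\<^bsub>free_module R p\<^esub> r \<odot>\<^bsub>free_module R p\<^esub> y"
    using free_module_coord[OF x] free_module_coord[OF y] r by (simp add: r_distr)
next
  fix x assume x: "x \<in> carrier (free_module R p)"
  show "\<one> \<odot>\<^bsub>free_module R p\<^esub> x = x" using free_module_coord[OF x] by simp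
qed (rule is_cring)

lemma unit_vector_in_free_module: "i < p \<Longrightarrow> unit_vector R i \<in> carrier (free_module R p)"
  by (auto simp: unit_vector_def free_module_carrier)

lemma free_module_generated:
  assumes N: "submodule N R (free_module R p)" and e: "\<And>i. i < p \<Longrightarrow> unit_vector R i \<in> N"
  shows "carrier (free_module R p) \<subseteq> N"
proof
  fix f assume f: "f \<in> carrier (free_module R p)"
  \<comment> \<open>Truncations of \<open>f\<close> to its first \<open>k\<close> coordinates, built
    up by one multiple of a unit vector at a time.\<close>
  have "(\<lambda>i. if i < k then f i else \<zero>) \<in> N" if "k \<le> p" for k
    using that
  proof (induction k)
    case 0
    then show ?case using submodule_zero[OF N] by simp
  next
    case (Suc k)
    have "f k \<odot>\<^bsub>free_module R p\<^esub> unit_vector R k \<in> N"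
      using Suc.prems e free_module_coord[OF f] by (intro submodule_smult[OF N]) auto
    then have "(\<lambda>i. if i < k then f i else \<zero>) \<oplus>\<^bsub>free_module R p\<^esub>
        (f k \<odot>\<^bsub>free_module R p\<^esub> unit_vector R k) \<in> N"
      using Suc by (intro submodule_add[OF N]) auto
    also have "(\<lambda>i. if i < k then f i else \<zero>) \<oplus>\<^bsub>free_module R p\<^esub>
        (f k \<odot>\<^bsub>free_module R p\<^esub> unit_vector R k) = (\<lambda>i. if i < Suc k then f i else \<zero>)"
      using free_module_coord[OF f] by (auto simp: unit_vector_def less_Suc_eq)
    finally show ?case .
  qed
  from this[of p] have "(\<lambda>i. if i < p then f i else \<zero>) \<in> N" by simp
  also have "(\<lambda>i. if i < p then f i else \<zero>) = f"
    using f by (auto simp: free_module_carrier)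
  finally show "f \<in> N" .
qed

lemma free_module_lift:
  fixes M :: "('a, 'c) module"
  assumes M: "module R M" and m: "\<And>i. i < p \<Longrightarrow> m i \<in> carrier M"
  obtains h where "h \<in> module_hom R (free_module R p) M" "\<And>i. i < p \<Longrightarrow> h (unit_vector R i) = m i"
proof
  interpret M: module R M by fact
  let ?h = "\<lambda>f. finsum M (\<lambda>i. f i \<odot>\<^bsub>M\<^esub> m i) {..<p}"
  have cl: "f i \<odot>\<^bsub>M\<^esub> m i \<in> carrier M" if "f \<in> carrier (free_module R p)" "i < p" for f i
    using m free_module_coord[OF that(1)] that(2) by auto
  show "?h \<in> module_hom R (free_module R p) M"
  proof (rule module_homI)
    fix x y r
    assume x: "x \<in> carrier (free_module R p)"
    show "?h x \<in> carrier M" using cl[OF x] by (auto intro!: M.M.finsum_closed)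
    show "?h (x \<oplus>\<^bsub>free_module R p\<^esub> y) = ?h x \<oplus>\<^bsub>M\<^esub> ?h y" if y: "y \<in> carrier (free_module R p)"
    proof -
      have "?h (x \<oplus>\<^bsub>free_module R p\<^esub> y) = finsum M (\<lambda>i. x i \<odot>\<^bsub>M\<^esub> m i \<oplus>\<^bsub>M\<^esub> y i \<odot>\<^bsub>M\<^esub> m i) {..<p}"
        using m cl[OF x] cl[OF y] free_module_coord[OF x] free_module_coord[OF y]
        by (intro M.M.finsum_cong') (auto simp: M.smult_l_distr)
      then show ?thesis using cl[OF x] cl[OF y] by (simp add: M.M.finsum_addf Pi_iff)
    qed
    show "?h (r \<odot>\<^bsub>free_module R p\<^esub> x) = r \<odot>\<^bsub>M\<^esub> ?h x" if r: "r \<in> carrier R"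
    proof -
      have "?h (r \<odot>\<^bsub>free_module R p\<^esub> x) = finsum M (\<lambda>i. r \<odot>\<^bsub>M\<^esub> (x i \<odot>\<^bsub>M\<^esub> m i)) {..<p}"
        using m cl[OF x] free_module_coord[OF x] r
        by (intro M.M.finsum_cong') (auto simp: M.smult_assoc1)
      then show ?thesis using cl[OF x] r by (simp add: M.finsum_smult_ldistr Pi_iff)
    qed
  qed
  show "?h (unit_vector R i) = m i" if i: "i < p" for i
  proof -
    have "?h (unit_vector R i) = finsum M (\<lambda>j. if i = j then m j else \<zero>\<^bsub>M\<^esub>) {..<p}"
      using m i by (intro M.M.finsum_cong') (auto simp: unit_vector_def)
    also have "\<dots> = m i" using m i by (intro M.M.finsum_singleton) auto
    finally show ?thesis .
  qed
qed

text \<open>Only the images of the unit vectors have to be lifted; the two homomorphisms to compare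
  agree on a submodule containing these vectors, hence everywhere.\<close>

lemma free_module_projective:
  fixes G :: "('a, 'c) module" and G' :: "('a, 'd) module"
  assumes G: "module R G" and G': "module R G'" and d: "d \<in> module_hom R G G'"
    and h: "h \<in> module_hom R (free_module R p) G'"
    and im: "h ` carrier (free_module R p) \<subseteq> d ` carrier G"
  obtains g where "g \<in> module_hom R (free_module R p) G"
    "\<And>v. v \<in> carrier (free_module R p) \<Longrightarrow> d (g v) = h v"
proof -
  let ?F = "free_module R p"
  interpret F: module R ?F by (rule module_free_module)
  interpret G': module R G' by fact
  have "\<exists>y\<in>carrier G. d y = h (unit_vector R i)" if "i < p" for i
    using im unit_vector_in_free_module[OF that] by (metis imageE imageI subsetD)
  then obtain m where m: "\<And>i. i < p \<Longrightarrow> m i \<in> carrier G" "\<And>i. i < p \<Longrightarrow> d (m i) = h (unit_vector R i)"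
    by metis
  obtain g where g: "g \<in> module_hom R ?F G" "\<And>i. i < p \<Longrightarrow> g (unit_vector R i) = m i"
    by (rule free_module_lift[OF G m(1)]) (assumption, rule that)
  have "carrier ?F \<subseteq> {v \<in> carrier ?F. d (g v) = h v}"
  proof (rule free_module_generated)
    show "submodule {v \<in> carrier ?F. d (g v) = h v} R ?F"
      by (rule submodule_equalizer[OF F.module_axioms G' module_hom_compose[OF g(1) d] h])
  qed (use g m unit_vector_in_free_module in auto)
  then show ?thesis using that g(1) by blast
qed

text \<open>Finite generation of \<open>K\<close> is expressed by \<open>gen\<close>: a submodule
  containing \<open>A\<close> contains \<open>K\<close>. The image of the map that sends the unit
  vectors to the elements of \<open>A\<close> is such a submodule.\<close>

lemma free_module_presentation:
  assumes K: "submodule K R (free_module R p)" and A: "finite A" "A \<subseteq> K"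
    and gen: "\<And>N. submodule N R (free_module R p) \<Longrightarrow> A \<subseteq> N \<Longrightarrow> K \<subseteq> N"
  obtains q \<pi> where "\<pi> \<in> module_hom R (free_module R q) (free_module R p)"
    "\<pi> ` carrier (free_module R q) = K"
proof -
  let ?F = "free_module R p"
  interpret F: module R ?F by (rule module_free_module)
  obtain m :: "nat \<Rightarrow> _" where m: "m ` {..<card A} = A"
    using ex_bij_betw_nat_finite[OF A(1)] by (auto simp: bij_betw_def atLeast0LessThan)
  let ?Q = "free_module R (card A)"
  note KM = F.module_submodule[OF K]
  have "m i \<in> carrier (?F\<lparr>carrier := K\<rparr>)" if "i < card A" for i
    using that m A by auto
  then obtain h where h: "h \<in> module_hom R ?Q (?F\<lparr>carrier := K\<rparr>)"
    "\<And>i. i < card A \<Longrightarrow> h (unit_vector R i) = m i"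
    by (rule free_module_lift[OF KM]) (assumption, rule that)
  have sub: "h ` carrier ?Q \<subseteq> K" using module_hom_closed[OF h(1)] by auto
  have hF: "h \<in> module_hom R ?Q ?F"
    using h(1) submodule_subset[OF K] unfolding module_hom_def by auto
  have "K \<subseteq> h ` carrier ?Q"
  proof (rule gen)
    show "submodule (h ` carrier ?Q) R ?F"
      by (rule submodule_image[OF module_free_module module_free_module hF])
        (rule module.carrier_is_submodule[OF module_free_module])
    show "A \<subseteq> h ` carrier ?Q"
    proof
      fix a assume "a \<in> A"
      then obtain i where "i < card A" "a = m i" using m by blast
      then show "a \<in> h ` carrier ?Q" using h(2) unit_vector_in_free_module by (intro image_eqI) auto
    qed
  qed
  then show ?thesis using that hF sub by blast
qed

end

text \<open>The ideal of last coordinates of \<open>K\<close> and the part of \<open>K\<close> with last coordinate zero are both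
  finitely generated.\<close>

lemma free_module_noetherian:
  assumes "cring R" "noetherian_ring R" and K: "submodule K R (free_module R p)"
  shows "\<exists>A. finite A \<and> A \<subseteq> K \<and>
    (\<forall>N. submodule N R (free_module R p) \<longrightarrow> A \<subseteq> N \<longrightarrow> K \<subseteq> N)"
  using K
proof (induction p arbitrary: K)
  interpret cring R by fact
  case 0
  have "K \<subseteq> {\<lambda>_. \<zero>\<^bsub>R\<^esub>}" using submodule_subset[OF 0] by (auto simp: subset_iff free_module_carrier)
  then show ?case using submodule_zero by (intro exI[of _ "{}"]) fastforce
next
  case (Suc p)
  interpret cring R by fact
  let ?F = "free_module R (Suc p)" and ?F' = "free_module R p"
  interpret F: module R ?F by (rule module_free_module)
  interpret F': module R ?F' by (rule module_free_module)
  have F'F: "f \<in> carrier ?F' \<longleftrightarrow> f \<in> carrier ?F \<and> f p = \<zero>\<^bsub>R\<^esub>" for f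
  proof -
    have "(\<forall>i\<ge>p. f i = \<zero>\<^bsub>R\<^esub>) \<longleftrightarrow> f p = \<zero>\<^bsub>R\<^esub> \<and> (\<forall>i\<ge>Suc p. f i = \<zero>\<^bsub>R\<^esub>)"
      by (metis Suc_leD Suc_leI le_eq_less_or_eq order_refl)
    then show ?thesis by (auto simp: free_module_carrier less_Suc_eq)
  qed
  have F'I: "submodule (N \<inter> {f. f p = \<zero>\<^bsub>R\<^esub>}) R ?F'" if N: "submodule N R ?F" for N
  proof (rule F'.submoduleI')
    show "N \<inter> {f. f p = \<zero>\<^bsub>R\<^esub>} \<subseteq> carrier ?F'" using submodule_mem[OF N] F'F by blast
    show "\<zero>\<^bsub>?F'\<^esub> \<in> N \<inter> {f. f p = \<zero>\<^bsub>R\<^esub>}" using submodule_zero[OF N] by simp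
    show "f \<oplus>\<^bsub>?F'\<^esub> g \<in> N \<inter> {f. f p = \<zero>\<^bsub>R\<^esub>}"
      if "f \<in> N \<inter> {f. f p = \<zero>\<^bsub>R\<^esub>}" "g \<in> N \<inter> {f. f p = \<zero>\<^bsub>R\<^esub>}" for f g
      using that submodule_add[OF N, of f g] by simp
    show "r \<odot>\<^bsub>?F'\<^esub> f \<in> N \<inter> {f. f p = \<zero>\<^bsub>R\<^esub>}"
      if "r \<in> carrier R" "f \<in> N \<inter> {f. f p = \<zero>\<^bsub>R\<^esub>}" for r f
      using that submodule_smult[OF N, of r f] by simp
  qed
  have lead: "ideal ((\<lambda>f. f p) ` N) R" if N: "submodule N R ?F" for N
  proof (rule ideal_of_subset)
    show "(\<lambda>f. f p) ` N \<subseteq> carrier R" using submodule_mem[OF N] free_module_coord by blast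
    show "\<zero>\<^bsub>R\<^esub> \<in> (\<lambda>f. f p) ` N" by (rule image_eqI[OF _ submodule_zero[OF N]]) simp
    show "x \<oplus>\<^bsub>R\<^esub> y \<in> (\<lambda>f. f p) ` N" if xy: "x \<in> (\<lambda>f. f p) ` N" "y \<in> (\<lambda>f. f p) ` N" for x y
    proof -
      obtain f g where "f \<in> N" "x = f p" "g \<in> N" "y = g p" using xy by blast
      then show ?thesis by (intro image_eqI[OF _ submodule_add[OF N, of f g]]) simp_all
    qed
    show "r \<otimes>\<^bsub>R\<^esub> x \<in> (\<lambda>f. f p) ` N" if rx: "r \<in> carrier R" "x \<in> (\<lambda>f. f p) ` N" for r x
    proof -
      obtain f where "f \<in> N" "x = f p" using rx by blast
      then show ?thesis using rx(1) by (intro image_eqI[OF _ submodule_smult[OF N, of r f]]) simp_all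
    qed
  qed
  obtain L where L: "finite L" "L \<subseteq> carrier R" "(\<lambda>f. f p) ` K = Idl\<^bsub>R\<^esub> L"
    using noetherian_ring.finetely_gen[OF assms(2) lead[OF Suc.prems]] by blast
  then have "L \<subseteq> (\<lambda>f. f p) ` K" using genideal_self by blast
  then obtain A1 where A1: "finite A1" "A1 \<subseteq> K" "L = (\<lambda>f. f p) ` A1"
    using L(1) by (meson finite_subset_image)
  obtain A2 where A2: "finite A2" "A2 \<subseteq> K \<inter> {f. f p = \<zero>\<^bsub>R\<^esub>}"
    "\<And>N. submodule N R ?F' \<Longrightarrow> A2 \<subseteq> N \<Longrightarrow> K \<inter> {f. f p = \<zero>\<^bsub>R\<^esub>} \<subseteq> N"
    using Suc.IH[OF F'I[OF Suc.prems]] by blast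
  have "K \<subseteq> N" if N: "submodule N R ?F" "A1 \<union> A2 \<subseteq> N" for N
  proof
    fix f assume f: "f \<in> K"
    have NK: "submodule (N \<inter> K) R ?F" by (rule F.submodule_Int[OF N(1) Suc.prems])
    \<comment> \<open>The submodule is \<open>N \<inter> K\<close> instead of \<open>N\<close>, so
      that the element \<open>g\<close> with the same last coordinate as \<open>f\<close> stays in
      \<open>K\<close> and the difference falls under \<open>A2\<close>.\<close>
    have "Idl\<^bsub>R\<^esub> L \<subseteq> (\<lambda>f. f p) ` (N \<inter> K)"
      using A1 N(2) by (intro genideal_minimal lead[OF NK]) auto
    then obtain g where g: "g \<in> N" "g \<in> K" "f p = g p" using f L(3) by blast
    have fg: "f \<ominus>\<^bsub>?F\<^esub> g \<in> K" by (rule F.submodule_minus[OF Suc.prems f g(2)])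
    have car: "f \<in> carrier ?F" "g \<in> carrier ?F" using f g submodule_mem[OF Suc.prems] by auto
    \<comment> \<open>The coordinates of a difference are not pointwise by definition; the last one
      is read off from \<open>g + (f - g) = f\<close>.\<close>
    have "(g \<oplus>\<^bsub>?F\<^esub> (f \<ominus>\<^bsub>?F\<^esub> g)) p = f p" using F.minus_add_cancel[OF car] by simp
    then have "(f \<ominus>\<^bsub>?F\<^esub> g) p = \<zero>\<^bsub>R\<^esub>"
      using g(3) free_module_coord[OF car(2), of p] free_module_coord[OF F.M.minus_closed[OF car], of p]
      by simp
    then have "f \<ominus>\<^bsub>?F\<^esub> g \<in> N"
      using A2(3)[OF F'I[OF N(1)]] A2(2) N(2) fg by auto
    then have "g \<oplus>\<^bsub>?F\<^esub> (f \<ominus>\<^bsub>?F\<^esub> g) \<in> N" by (rule submodule_add[OF N(1) g(1)])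
    then show "f \<in> N" using F.minus_add_cancel[OF car] by simp
  qed
  then show ?case using A1(1,2) A2(1,2) by (intro exI[of _ "A1 \<union> A2"] conjI allI impI) auto
qed

section \<open>Modules of homomorphisms\<close>

lemma hom_module_sel [simp]:
  "\<zero>\<^bsub>hom_module R N M\<^esub> = (\<lambda>x\<in>carrier N. \<zero>\<^bsub>M\<^esub>)"
  "f \<oplus>\<^bsub>hom_module R N M\<^esub> g = (\<lambda>x\<in>carrier N. f x \<oplus>\<^bsub>M\<^esub> g x)"
  "r \<odot>\<^bsub>hom_module R N M\<^esub> f = (\<lambda>x\<in>carrier N. r \<odot>\<^bsub>M\<^esub> f x)"
  "carrier (hom_module R N M) = module_hom R N M \<inter> extensional (carrier N)"
  by (simp_all add: hom_module_def)

lemma restrict_module_hom: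
  assumes "module R N"
  shows "restrict f (carrier N) \<in> module_hom R N M \<longleftrightarrow> f \<in> module_hom R N M"
proof -
  interpret N: module R N by fact
  show ?thesis by (auto simp: module_hom_def Pi_iff)
qed

lemma module_hom_pointwise:
  assumes N: "module R N" and M: "module R M" and f: "f \<in> module_hom R N M"
  shows module_hom_pointwise_add: "g \<in> module_hom R N M \<Longrightarrow> (\<lambda>x. f x \<oplus>\<^bsub>M\<^esub> g x) \<in> module_hom R N M"
    and module_hom_pointwise_smult: "r \<in> carrier R \<Longrightarrow> (\<lambda>x. r \<odot>\<^bsub>M\<^esub> f x) \<in> module_hom R N M"
proof -
  interpret M: module R M by fact
  note fh = module_homD[OF f]
  show "(\<lambda>x. f x \<oplus>\<^bsub>M\<^esub> g x) \<in> module_hom R N M" if "g \<in> module_hom R N M"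
    using fh module_homD[OF that] by (intro module_homI) (simp_all add: M.smult_r_distr M.M.a_ac)
  show "(\<lambda>x. r \<odot>\<^bsub>M\<^esub> f x) \<in> module_hom R N M" if "r \<in> carrier R"
    using fh that M.smult_comm by (intro module_homI) (simp_all add: M.smult_r_distr)
qed

lemma module_hom_diff:
  assumes N: "module R N" and M: "module R M" and f: "f \<in> module_hom R N M" and g: "g \<in> module_hom R N M"
  shows "(\<lambda>x. f x \<ominus>\<^bsub>M\<^esub> g x) \<in> module_hom R N M"
proof -
  interpret M: module R M by fact
  have "(\<lambda>x. f x \<oplus>\<^bsub>M\<^esub> (\<ominus>\<^bsub>R\<^esub> \<one>\<^bsub>R\<^esub>) \<odot>\<^bsub>M\<^esub> g x) \<in> module_hom R N M"
    by (intro module_hom_pointwise[OF N M] f g) simp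
  then show ?thesis
    by (rule module_hom_cong[OF N]) (simp add: M.M.minus_eq M.a_inv_eq_smult module_hom_closed[OF g])
qed

lemma module_hom_module:
  assumes N: "module R N" and M: "module R M"
  shows "module R (hom_module R N M)"
proof -
  interpret M: module R M by fact
  let ?H = "hom_module R N M"
  have cl: "f x \<in> carrier M" if "f \<in> carrier ?H" "x \<in> carrier N" for f x
    using that module_hom_closed by auto
  have memI: "restrict f (carrier N) \<in> carrier ?H" if "f \<in> module_hom R N M" for f
    using that restrict_module_hom[OF N] by auto
  have h: "f \<in> module_hom R N M" if "f \<in> carrier ?H" for f using that by simp
  have re: "f = restrict g (carrier N)" if "f \<in> carrier ?H" "\<And>x. x \<in> carrier N \<Longrightarrow> f x = g x" for f g
    using that by (auto intro: extensionalityI[of _ "carrier N"])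
  show ?thesis
  proof (rule moduleI)
    show "abelian_group ?H"
    proof (rule abelian_groupI)
      fix f assume f: "f \<in> carrier ?H"
      have "(\<lambda>x\<in>carrier N. (\<ominus>\<^bsub>R\<^esub> \<one>\<^bsub>R\<^esub>) \<odot>\<^bsub>M\<^esub> f x) \<in> carrier ?H"
        by (rule memI) (rule module_hom_pointwise_smult[OF N M h[OF f]], simp)
      moreover have "(\<lambda>x\<in>carrier N. (\<ominus>\<^bsub>R\<^esub> \<one>\<^bsub>R\<^esub>) \<odot>\<^bsub>M\<^esub> f x) \<oplus>\<^bsub>?H\<^esub> f = \<zero>\<^bsub>?H\<^esub>"
        using cl[OF f] by (auto simp: M.a_inv_eq_smult[symmetric] M.M.l_neg intro: restrict_ext)
      ultimately show "\<exists>y\<in>carrier ?H. y \<oplus>\<^bsub>?H\<^esub> f = \<zero>\<^bsub>?H\<^esub>" by blast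
      show "\<zero>\<^bsub>?H\<^esub> \<oplus>\<^bsub>?H\<^esub> f = f"
        unfolding hom_module_sel by (rule sym, rule re[OF f]) (use cl[OF f] in simp)
      fix g assume g: "g \<in> carrier ?H"
      show "f \<oplus>\<^bsub>?H\<^esub> g \<in> carrier ?H"
        unfolding hom_module_sel(2)
        by (rule memI) (rule module_hom_pointwise_add[OF N M h[OF f] h[OF g]])
      show "f \<oplus>\<^bsub>?H\<^esub> g = g \<oplus>\<^bsub>?H\<^esub> f"
        unfolding hom_module_sel(2) by (rule restrict_ext) (use cl[OF f] cl[OF g] in \<open>simp add: M.M.a_comm\<close>)
      fix k assume k: "k \<in> carrier ?H"
      show "f \<oplus>\<^bsub>?H\<^esub> g \<oplus>\<^bsub>?H\<^esub> k = f \<oplus>\<^bsub>?H\<^esub> (g \<oplus>\<^bsub>?H\<^esub> k)"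
        unfolding hom_module_sel(2)
        by (rule restrict_ext) (use cl[OF f] cl[OF g] cl[OF k] in \<open>simp add: M.M.a_assoc\<close>)
    next
      have "(\<lambda>x. \<zero>\<^bsub>M\<^esub>) \<in> module_hom R N M" by (intro module_homI) simp_all
      then show "\<zero>\<^bsub>?H\<^esub> \<in> carrier ?H" unfolding hom_module_sel(1) by (rule memI)
    qed
  next
    fix r f assume r: "r \<in> carrier R" and f: "f \<in> carrier ?H"
    show "r \<odot>\<^bsub>?H\<^esub> f \<in> carrier ?H"
      unfolding hom_module_sel(3) by (rule memI) (rule module_hom_pointwise_smult[OF N M h[OF f] r])
  next
    fix r s f assume r: "r \<in> carrier R" and s: "s \<in> carrier R" and f: "f \<in> carrier ?H"
    show "(r \<oplus>\<^bsub>R\<^esub> s) \<odot>\<^bsub>?H\<^esub> f = r \<odot>\<^bsub>?H\<^esub> f \<oplus>\<^bsub>?H\<^esub> s \<odot>\<^bsub>?H\<^esub> f"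
      unfolding hom_module_sel by (rule restrict_ext) (use r s cl[OF f] in \<open>simp add: M.smult_l_distr\<close>)
    show "(r \<otimes>\<^bsub>R\<^esub> s) \<odot>\<^bsub>?H\<^esub> f = r \<odot>\<^bsub>?H\<^esub> (s \<odot>\<^bsub>?H\<^esub> f)"
      unfolding hom_module_sel by (rule restrict_ext) (use r s cl[OF f] in \<open>simp add: M.smult_assoc1\<close>)
  next
    fix r f g assume r: "r \<in> carrier R" and f: "f \<in> carrier ?H" and g: "g \<in> carrier ?H"
    show "r \<odot>\<^bsub>?H\<^esub> (f \<oplus>\<^bsub>?H\<^esub> g) = r \<odot>\<^bsub>?H\<^esub> f \<oplus>\<^bsub>?H\<^esub> r \<odot>\<^bsub>?H\<^esub> g"
      unfolding hom_module_sel
      by (rule restrict_ext) (use r cl[OF f] cl[OF g] in \<open>simp add: M.smult_r_distr\<close>)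
  next
    fix f assume f: "f \<in> carrier ?H"
    show "\<one>\<^bsub>R\<^esub> \<odot>\<^bsub>?H\<^esub> f = f"
      unfolding hom_module_sel by (rule sym, rule re[OF f]) (use cl[OF f] in simp)
  qed (rule M.is_cring)
qed

text \<open>This is \<open>Hom(K, N)\<close>, kept inside \<open>Hom(K, M)\<close>: for varying
  \<open>N\<close> it gives submodules of one ambient module, as \<open>artinian_between\<close>
  needs.\<close>

definition homs_into ::
    "('a, 'r) ring_scheme \<Rightarrow> ('a, 'f) module \<Rightarrow> 'f set \<Rightarrow> ('a, 'b) module \<Rightarrow> 'b set \<Rightarrow> ('f \<Rightarrow> 'b) set" where
  "homs_into R F K M N = {f \<in> carrier (hom_module R (F\<lparr>carrier := K\<rparr>) M). f ` K \<subseteq> N}"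

definition homs_extending ::
    "('a, 'r) ring_scheme \<Rightarrow> ('a, 'f) module \<Rightarrow> 'f set \<Rightarrow> ('a, 'b) module \<Rightarrow> 'b set \<Rightarrow> ('f \<Rightarrow> 'b) set" where
  "homs_extending R F K M N = (\<lambda>h. restrict h K) ` {h \<in> module_hom R F M. h ` carrier F \<subseteq> N}"

lemma submodule_homs_into:
  assumes F: "module R F" and K: "submodule K R F" and M: "module R M" and N: "submodule N R M"
  shows "submodule (homs_into R F K M N) R (hom_module R (F\<lparr>carrier := K\<rparr>) M)"
proof -
  let ?H = "hom_module R (F\<lparr>carrier := K\<rparr>) M"
  interpret H: module R ?H
    by (rule module_hom_module[OF module.module_submodule[OF F K] M])
  have *: "f \<in> homs_into R F K M N \<longleftrightarrow> f \<in> carrier ?H \<and> (\<forall>x\<in>K. f x \<in> N)" for f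
    by (auto simp: homs_into_def)
  show ?thesis
  proof (rule H.submoduleI')
    show "homs_into R F K M N \<subseteq> carrier ?H" using * by blast
    show "\<zero>\<^bsub>?H\<^esub> \<in> homs_into R F K M N"
      using H.M.zero_closed submodule_zero[OF N] unfolding * by simp
    show "f \<oplus>\<^bsub>?H\<^esub> g \<in> homs_into R F K M N" if "f \<in> homs_into R F K M N" "g \<in> homs_into R F K M N" for f g
      using that H.M.a_closed[of f g] submodule_add[OF N] unfolding * by simp
    show "r \<odot>\<^bsub>?H\<^esub> f \<in> homs_into R F K M N" if "r \<in> carrier R" "f \<in> homs_into R F K M N" for r f
      using that H.smult_closed[of r f] submodule_smult[OF N] unfolding * by simp
  qed
qed

lemma homs_extending_subset:
  assumes "module R F" "submodule K R F"
  shows "homs_extending R F K M N \<subseteq> homs_into R F K M N"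
proof
  fix f assume "f \<in> homs_extending R F K M N"
  then obtain h where h: "h \<in> module_hom R F M" "h ` carrier F \<subseteq> N" "f = restrict h K"
    by (auto simp: homs_extending_def)
  have "h \<in> module_hom R (F\<lparr>carrier := K\<rparr>) M"
    by (rule module_hom_restrict_carrier[OF h(1) submodule_subset[OF assms(2)]])
  then have "f \<in> module_hom R (F\<lparr>carrier := K\<rparr>) M"
    using restrict_module_hom[OF module.module_submodule[OF assms], of h M] h(3) by simp
  then show "f \<in> homs_into R F K M N"
    using h submodule_subset[OF assms(2)] by (auto simp: homs_into_def)
qed

lemma homs_extending_mono: "N \<subseteq> N' \<Longrightarrow> homs_extending R F K M N \<subseteq> homs_extending R F K M N'"
  unfolding homs_extending_def by blast

lemma submodule_homs_extending:
  assumes F: "module R F" and K: "submodule K R F" and M: "module R M" and N: "submodule N R M"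
  shows "submodule (homs_extending R F K M N) R (hom_module R (F\<lparr>carrier := K\<rparr>) M)"
proof -
  let ?H = "hom_module R (F\<lparr>carrier := K\<rparr>) M" and ?E = "homs_extending R F K M N"
  let ?S = "{h \<in> module_hom R F M. h ` carrier F \<subseteq> N}"
  interpret H: module R ?H
    by (rule module_hom_module[OF module.module_submodule[OF F K] M])
  interpret M: module R M by fact
  show ?thesis
  proof (rule H.submoduleI')
    show "?E \<subseteq> carrier ?H"
      using homs_extending_subset[OF F K] submodule_subset[OF submodule_homs_into[OF assms]] by blast
    have "(\<lambda>x. \<zero>\<^bsub>M\<^esub>) \<in> ?S"
      using submodule_zero[OF N] by (auto intro!: module_homI)
    then show "\<zero>\<^bsub>?H\<^esub> \<in> ?E" unfolding homs_extending_def by (intro image_eqI) simp_all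
    show "f \<oplus>\<^bsub>?H\<^esub> g \<in> ?E" if fg: "f \<in> ?E" "g \<in> ?E" for f g
    proof -
      obtain f' g' where *: "f' \<in> ?S" "g' \<in> ?S" "f = restrict f' K" "g = restrict g' K"
        using fg unfolding homs_extending_def by blast
      then have "(\<lambda>x. f' x \<oplus>\<^bsub>M\<^esub> g' x) \<in> ?S"
        by (auto intro!: module_hom_pointwise_add[OF F M] submodule_add[OF N])
      then show ?thesis
        unfolding homs_extending_def by (rule image_eqI[rotated]) (simp add: * cong: restrict_cong)
    qed
    show "r \<odot>\<^bsub>?H\<^esub> f \<in> ?E" if rf: "r \<in> carrier R" "f \<in> ?E" for r f
    proof -
      obtain f' where *: "f' \<in> ?S" "f = restrict f' K"
        using rf unfolding homs_extending_def by blast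
      then have "(\<lambda>x. r \<odot>\<^bsub>M\<^esub> f' x) \<in> ?S"
        using rf(1) by (auto intro!: module_hom_pointwise_smult[OF F M] submodule_smult[OF N])
      then show ?thesis
        unfolding homs_extending_def by (rule image_eqI[rotated]) (simp add: * cong: restrict_cong)
    qed
  qed
qed

text \<open>Evaluation on the finite generating set \<open>A\<close> embeds
  \<open>Hom(K, Z) / Hom(K, B)\<close> into a finite power of \<open>Z / B\<close>.\<close>

lemma artinian_between_homs_into:
  assumes F: "module R F" and K: "submodule K R F" and M: "module R M"
    and B: "submodule B R M" "B \<subseteq> Z" and Z: "submodule Z R M"
    and A: "finite A" "A \<subseteq> K" "\<And>N. submodule N R F \<Longrightarrow> A \<subseteq> N \<Longrightarrow> K \<subseteq> N"
    and art: "artinian_between R M Z B"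
  shows "artinian_between R (hom_module R (F\<lparr>carrier := K\<rparr>) M) (homs_into R F K M Z) (homs_into R F K M B)"
proof -
  let ?H = "hom_module R (F\<lparr>carrier := K\<rparr>) M"
  note FK = module.module_submodule[OF F K]
  interpret F: module R F by fact
  interpret H: module R ?H by (rule module_hom_module[OF FK M])
  define T where "T S = {f \<in> homs_into R F K M Z. \<forall>k\<in>S. f k \<in> B}" for S
  note into = submodule_homs_into[OF F K M Z]
  have T: "submodule (T S) R ?H" if "S \<subseteq> K" for S
  proof (rule H.submoduleI')
    show "T S \<subseteq> carrier ?H" using submodule_subset[OF into] by (auto simp: T_def)
    show "\<zero>\<^bsub>?H\<^esub> \<in> T S" using submodule_zero[OF into] submodule_zero[OF B(1)] that by (auto simp: T_def)
    show "f \<oplus>\<^bsub>?H\<^esub> g \<in> T S" if fg: "f \<in> T S" "g \<in> T S" for f g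
      using submodule_add[OF into, of f g] submodule_add[OF B(1)] fg \<open>S \<subseteq> K\<close> by (auto simp: T_def)
    show "r \<odot>\<^bsub>?H\<^esub> f \<in> T S" if rf: "r \<in> carrier R" "f \<in> T S" for r f
      using submodule_smult[OF into, of r f] submodule_smult[OF B(1)] rf \<open>S \<subseteq> K\<close> by (auto simp: T_def)
  qed
  have "artinian_between R ?H (homs_into R F K M Z) (T S)" if "finite S" "S \<subseteq> K" for S
    using that
  proof (induction S)
    case empty
    then show ?case by (simp add: T_def artinian_between_refl)
  next
    case (insert k S)
    then have k: "k \<in> K" and S: "S \<subseteq> K" by auto
    show ?case
    proof (rule H.artinian_between_trans[OF T[OF S] _ _ into])
      show "artinian_between R ?H (homs_into R F K M Z) (T S)" using insert by blast
      \<comment> \<open>Evaluation at the new generator \<open>k\<close> embeds this factor into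
        \<open>Z / B\<close>.\<close>
      show "artinian_between R ?H (T S) (T (insert k S))"
      proof (rule artinian_between_rel[OF H.module_axioms M Z B T[OF insert.prems], where \<rho> = "\<lambda>f y. f \<in> carrier ?H \<and> y = f k"])
        show "f \<in> carrier ?H \<and> y \<in> carrier M" if "f \<in> carrier ?H \<and> y = f k" for f y
          using that module_hom_closed[of f R "F\<lparr>carrier := K\<rparr>" M k] k by simp
        show "f \<oplus>\<^bsub>?H\<^esub> f' \<in> carrier ?H \<and> y \<oplus>\<^bsub>M\<^esub> y' = (f \<oplus>\<^bsub>?H\<^esub> f') k"
          if "f \<in> carrier ?H \<and> y = f k" "f' \<in> carrier ?H \<and> y' = f' k" for f y f' y'
          using that H.M.a_closed[of f f'] k by simp
        show "r \<odot>\<^bsub>?H\<^esub> f \<in> carrier ?H \<and> r \<odot>\<^bsub>M\<^esub> y = (r \<odot>\<^bsub>?H\<^esub> f) k"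
          if "r \<in> carrier R" "f \<in> carrier ?H \<and> y = f k" for r f y
          using that H.smult_closed[of r f] k by simp
        show "\<exists>y\<in>Z. f \<in> carrier ?H \<and> y = f k" if "f \<in> T S" for f
          using that k by (auto simp: T_def homs_into_def)
        show "f \<in> T (insert k S)" if "f \<in> carrier ?H \<and> y = f k" "f \<in> T S" "y \<in> B" for f y
          using that by (auto simp: T_def)
      qed (rule art)
    qed (auto simp: T_def)
  qed
  from this[OF A(1,2)] show ?thesis
  proof (rule artinian_between_mono)
    show "T A \<subseteq> homs_into R F K M B"
    proof
      fix f assume f: "f \<in> T A"
      then have fh: "f \<in> module_hom R (F\<lparr>carrier := K\<rparr>) M" by (simp add: T_def homs_into_def)
      have "submodule {x \<in> K. f x \<in> B} R F"
        using submodule_vimage[OF FK M fh B(1)] F.submodule_restrict_iff[OF K] by simp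
      from A(3)[OF this] have "K \<subseteq> {x \<in> K. f x \<in> B}" using f A(2) by (auto simp: T_def)
      then show "f \<in> homs_into R F K M B" using f by (auto simp: T_def homs_into_def)
    qed
  qed simp
qed

section \<open>Modules with Artinian first extension groups\<close>

text \<open>\<open>Hom(K, N)\<close> modulo the restrictions of homomorphisms \<open>R\<^sup>p \<rightarrow> N\<close> is \<open>Ext\<^sup>1(R\<^sup>p / K, N)\<close>.
  Hence the following definition requires \<open>Ext\<^sup>1(L, N)\<close> to be Artinian for all finitely
  generated \<open>L\<close>; dimension shifting in \<open>L\<close> then covers all higher extension groups.\<close>

definition ext_artinian ::
    "('a, 'r) ring_scheme \<Rightarrow> ('a, 'b) module \<Rightarrow> 'b set \<Rightarrow> bool" where
  "ext_artinian R M N \<longleftrightarrow> (\<forall>p K. submodule K R (free_module R p) \<longrightarrow>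
     artinian_between R (hom_module R ((free_module R p)\<lparr>carrier := K\<rparr>) M)
       (homs_into R (free_module R p) K M N) (homs_extending R (free_module R p) K M N))"

text \<open>The vanishing of \<open>Ext^1(L, M)\<close> for finitely generated \<open>L\<close>,
  which is the part of injectivity that the argument uses. The tests are submodules of
  \<open>R^p\<close>, whatever the type of the elements of \<open>M\<close>.\<close>

definition ext_trivial :: "('a, 'r) ring_scheme \<Rightarrow> ('a, 'b) module \<Rightarrow> bool" where
  "ext_trivial R M \<longleftrightarrow> (\<forall>p K f. submodule K R (free_module R p) \<and>
     f \<in> module_hom R ((free_module R p)\<lparr>carrier := K\<rparr>) M \<longrightarrow>
     (\<exists>g \<in> module_hom R (free_module R p) M. \<forall>x\<in>K. g x = f x))"

lemma ext_artinian_zero: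
  assumes "module R M"
  shows "ext_artinian R M {\<zero>\<^bsub>M\<^esub>}"
  unfolding ext_artinian_def
proof (intro allI impI)
  interpret M: module R M by fact
  fix p K assume K: "submodule K R (free_module R p)"
  have "homs_into R (free_module R p) K M {\<zero>\<^bsub>M\<^esub>} \<subseteq> homs_extending R (free_module R p) K M {\<zero>\<^bsub>M\<^esub>}"
  proof
    fix f assume "f \<in> homs_into R (free_module R p) K M {\<zero>\<^bsub>M\<^esub>}"
    then have "f = restrict (\<lambda>x. \<zero>\<^bsub>M\<^esub>) K"
      by (auto simp: homs_into_def intro!: extensionalityI[of _ K])
    then show "f \<in> homs_extending R (free_module R p) K M {\<zero>\<^bsub>M\<^esub>}"
      unfolding homs_extending_def by (simp, intro image_eqI) (auto intro!: module_homI)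
  qed
  then show "artinian_between R (hom_module R ((free_module R p)\<lparr>carrier := K\<rparr>) M)
       (homs_into R (free_module R p) K M {\<zero>\<^bsub>M\<^esub>}) (homs_extending R (free_module R p) K M {\<zero>\<^bsub>M\<^esub>})"
    using artinian_between_mono[OF artinian_between_refl _ order_refl] by blast
qed

text \<open>The piece \<open>Ext^1(L, B) -> Ext^1(L, Z) -> Ext^1(L, Z/B)\<close> of the long exact
  sequence, as a filtration: \<open>Hom(K, Z)\<close> modulo \<open>Hom(K, B)\<close> is Artinian
  because \<open>K\<close> is finitely generated, and what \<open>Hom(K, B)\<close> contributes
  modulo extendable maps is a quotient of \<open>Ext^1(L, B)\<close>.\<close>

lemma ext_artinian_extension:
  assumes R: "cring R" "noetherian_ring R" and M: "module R M"
    and B: "submodule B R M" "B \<subseteq> Z" and Z: "submodule Z R M"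
    and extB: "ext_artinian R M B" and art: "artinian_between R M Z B"
  shows "ext_artinian R M Z"
  unfolding ext_artinian_def
proof (intro allI impI)
  interpret R: cring R by fact
  fix p K assume K: "submodule K R (free_module R p)"
  let ?F = "free_module R p"
  note F = R.module_free_module[of p]
  let ?H = "hom_module R (?F\<lparr>carrier := K\<rparr>) M"
  let ?I = "homs_into R ?F K M" and ?E = "homs_extending R ?F K M"
  interpret H: module R ?H
    by (rule module_hom_module[OF module.module_submodule[OF F K] M])
  obtain A where A: "finite A" "A \<subseteq> K" "\<And>N. submodule N R ?F \<Longrightarrow> A \<subseteq> N \<Longrightarrow> K \<subseteq> N"
    using free_module_noetherian[OF R K] by blast
  note IZ = submodule_homs_into[OF F K M Z] and IB = submodule_homs_into[OF F K M B(1)]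
  note EZ = submodule_homs_extending[OF F K M Z] and EB = submodule_homs_extending[OF F K M B(1)]
  have "?I B \<subseteq> ?I Z" using B(2) by (auto simp: homs_into_def)
  show "artinian_between R ?H (?I Z) (?E Z)"
  proof (rule H.artinian_between_trans[OF _ _ _ IZ])
    show "submodule (?I B <+>\<^bsub>?H\<^esub> ?E Z) R ?H" by (rule H.submodule_set_add[OF IB EZ])
    show "?E Z \<subseteq> ?I B <+>\<^bsub>?H\<^esub> ?E Z" by (rule H.set_add_upper2[OF IB EZ])
    show "?I B <+>\<^bsub>?H\<^esub> ?E Z \<subseteq> ?I Z"
      by (rule H.set_add_least[OF IZ \<open>?I B \<subseteq> ?I Z\<close> homs_extending_subset[OF F K]])
    show "artinian_between R ?H (?I Z) (?I B <+>\<^bsub>?H\<^esub> ?E Z)"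
      by (rule artinian_between_mono[OF artinian_between_homs_into[OF F K M B Z A art]
            H.set_add_upper1[OF IB EZ] order_refl])
    show "artinian_between R ?H (?I B <+>\<^bsub>?H\<^esub> ?E Z) (?E Z)"
      by (rule H.artinian_between_set_add[OF IB EB homs_extending_subset[OF F K]
            homs_extending_mono[OF B(2)] EZ])
        (use extB K in \<open>simp add: ext_artinian_def\<close>)
  qed
qed

lemma submodule_a_kernel:
  assumes "module R M" "module R N" "f \<in> module_hom R M N"
  shows "submodule {x \<in> carrier M. f x = \<zero>\<^bsub>N\<^esub>} R M"
  using submodule_vimage[OF assms module.submodule_zero_singleton[OF assms(2)]] by simp

text \<open>For \<open>0 \<rightarrow> Z \<rightarrow> G \<rightarrow> dG \<rightarrow> 0\<close> and a presentation \<open>0 \<rightarrow> L \<rightarrow> R\<^sup>q \<rightarrow> K \<rightarrow> 0\<close>, a homomorphism \<open>K \<rightarrow> dG\<close> lifts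
  to \<open>R\<^sup>q \<rightarrow> G\<close>, and restricting the lift to \<open>L\<close> gives the connecting map, which is injective.\<close>

lemma ext_artinian_shift:
  assumes R: "cring R" "noetherian_ring R" and G: "module R G" and G': "module R G'"
    and d: "d \<in> module_hom R G G'" and triv: "ext_trivial R G"
    and ext: "ext_artinian R G {x \<in> carrier G. d x = \<zero>\<^bsub>G'\<^esub>}"
  shows "ext_artinian R G' (d ` carrier G)"
  unfolding ext_artinian_def
proof (intro allI impI)
  interpret R: cring R by fact
  interpret G: module R G by fact
  interpret G': module R G' by fact
  fix p K assume K: "submodule K R (free_module R p)"
  let ?F = "free_module R p" and ?Z = "{x \<in> carrier G. d x = \<zero>\<^bsub>G'\<^esub>}"
  note F = R.module_free_module[of p]
  interpret F: module R ?F by fact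
  note FK = F.module_submodule[OF K]
  obtain A where A: "finite A" "A \<subseteq> K" "\<And>N. submodule N R ?F \<Longrightarrow> A \<subseteq> N \<Longrightarrow> K \<subseteq> N"
    using free_module_noetherian[OF R K] by blast
  obtain q \<pi> where \<pi>: "\<pi> \<in> module_hom R (free_module R q) ?F" "\<pi> ` carrier (free_module R q) = K"
    by (rule R.free_module_presentation[OF K A]) (assumption, assumption, rule that)
  let ?Q = "free_module R q"
  note Q = R.module_free_module[of q]
  interpret Q: module R ?Q by fact
  define L where "L = {v \<in> carrier ?Q. \<pi> v = \<zero>\<^bsub>?F\<^esub>}"
  have L: "submodule L R ?Q" unfolding L_def by (rule submodule_a_kernel[OF Q F \<pi>(1)])
  have LQ: "v \<in> carrier ?Q" if "v \<in> L" for v using that by (simp add: L_def)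
  have Z: "submodule ?Z R G" by (rule submodule_a_kernel[OF G G' d])
  have dG: "submodule (d ` carrier G) R G'"
    by (rule submodule_image[OF G G' d G.carrier_is_submodule])
  let ?H' = "hom_module R (?F\<lparr>carrier := K\<rparr>) G'" and ?H = "hom_module R (?Q\<lparr>carrier := L\<rparr>) G"
  note QL = Q.module_submodule[OF L]
  interpret H': module R ?H' by (rule module_hom_module[OF FK G'])
  interpret H: module R ?H by (rule module_hom_module[OF QL G])
  \<comment> \<open>The connecting map as a relation: \<open>u\<close> is the restriction to
    \<open>L\<close> of any lift \<open>g\<close> of the composite of \<open>\<pi>\<close> and
    \<open>h\<close>. The lift is not unique, so \<open>u\<close> is not a function of
    \<open>h\<close>.\<close>
  let ?\<rho> = "\<lambda>h u. h \<in> carrier ?H' \<and> u \<in> carrier ?H \<and> (\<exists>g \<in> module_hom R ?Q G.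
      (\<forall>v\<in>carrier ?Q. d (g v) = h (\<pi> v)) \<and> (\<forall>v\<in>L. u v = g v))"
  have \<pi>K: "\<pi> v \<in> K" if "v \<in> carrier ?Q" for v using that \<pi>(2) by blast
  show "artinian_between R ?H' (homs_into R ?F K G' (d ` carrier G)) (homs_extending R ?F K G' (d ` carrier G))"
  proof (rule artinian_between_rel[OF H'.module_axioms H.module_axioms submodule_homs_into[OF Q L G Z]
        submodule_homs_extending[OF Q L G Z] homs_extending_subset[OF Q L]
        submodule_homs_extending[OF F K G' dG], where \<rho> = ?\<rho>])
    show "h \<in> carrier ?H' \<and> u \<in> carrier ?H" if "?\<rho> h u" for h u using that by blast
    show "?\<rho> (h \<oplus>\<^bsub>?H'\<^esub> h') (u \<oplus>\<^bsub>?H\<^esub> u')" if 1: "?\<rho> h u" and 2: "?\<rho> h' u'" for h u h' u'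
    proof -
      obtain g g' where g: "g \<in> module_hom R ?Q G" "\<forall>v\<in>carrier ?Q. d (g v) = h (\<pi> v)" "\<forall>v\<in>L. u v = g v"
        and g': "g' \<in> module_hom R ?Q G" "\<forall>v\<in>carrier ?Q. d (g' v) = h' (\<pi> v)" "\<forall>v\<in>L. u' v = g' v"
        using 1 2 by blast
      have "(\<lambda>v. g v \<oplus>\<^bsub>G\<^esub> g' v) \<in> module_hom R ?Q G"
        by (rule module_hom_pointwise_add[OF Q G g(1) g'(1)])
      moreover have "\<forall>v\<in>carrier ?Q. d (g v \<oplus>\<^bsub>G\<^esub> g' v) = (h \<oplus>\<^bsub>?H'\<^esub> h') (\<pi> v)"
        using g g' \<pi>K module_hom_add[OF d] module_hom_closed[OF g(1)] module_hom_closed[OF g'(1)] by simp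
      moreover have "\<forall>v\<in>L. (u \<oplus>\<^bsub>?H\<^esub> u') v = g v \<oplus>\<^bsub>G\<^esub> g' v"
        using g g' by simp
      moreover have "h \<oplus>\<^bsub>?H'\<^esub> h' \<in> carrier ?H'" "u \<oplus>\<^bsub>?H\<^esub> u' \<in> carrier ?H"
        using 1 2 by (blast intro: H'.M.a_closed H.M.a_closed)+
      ultimately show ?thesis by (intro conjI bexI[of _ "\<lambda>v. g v \<oplus>\<^bsub>G\<^esub> g' v"])
    qed
    show "?\<rho> (r \<odot>\<^bsub>?H'\<^esub> h) (r \<odot>\<^bsub>?H\<^esub> u)" if r: "r \<in> carrier R" and 1: "?\<rho> h u" for r h u
    proof -
      obtain g where g: "g \<in> module_hom R ?Q G" "\<forall>v\<in>carrier ?Q. d (g v) = h (\<pi> v)" "\<forall>v\<in>L. u v = g v"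
        using 1 by blast
      have "(\<lambda>v. r \<odot>\<^bsub>G\<^esub> g v) \<in> module_hom R ?Q G"
        by (rule module_hom_pointwise_smult[OF Q G g(1) r])
      moreover have "\<forall>v\<in>carrier ?Q. d (r \<odot>\<^bsub>G\<^esub> g v) = (r \<odot>\<^bsub>?H'\<^esub> h) (\<pi> v)"
        using g \<pi>K r module_hom_smult[OF d] module_hom_closed[OF g(1)] by simp
      moreover have "\<forall>v\<in>L. (r \<odot>\<^bsub>?H\<^esub> u) v = r \<odot>\<^bsub>G\<^esub> g v"
        using g by simp
      moreover have "r \<odot>\<^bsub>?H'\<^esub> h \<in> carrier ?H'" "r \<odot>\<^bsub>?H\<^esub> u \<in> carrier ?H"
        using 1 r by (blast intro: H'.smult_closed H.smult_closed)+
      ultimately show ?thesis by (intro conjI bexI[of _ "\<lambda>v. r \<odot>\<^bsub>G\<^esub> g v"])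
    qed
    show "\<exists>u\<in>homs_into R ?Q L G ?Z. ?\<rho> h u" if h: "h \<in> homs_into R ?F K G' (d ` carrier G)" for h
    proof -
      have hh: "h \<in> module_hom R (?F\<lparr>carrier := K\<rparr>) G'" "h ` K \<subseteq> d ` carrier G" "h \<in> carrier ?H'"
        using h by (auto simp: homs_into_def)
      have "\<pi> \<in> module_hom R ?Q (?F\<lparr>carrier := K\<rparr>)"
        using \<pi> unfolding module_hom_def by auto
      then have h\<pi>: "(\<lambda>v. h (\<pi> v)) \<in> module_hom R ?Q G'" by (rule module_hom_compose[OF _ hh(1)])
      have im: "(\<lambda>v. h (\<pi> v)) ` carrier ?Q \<subseteq> d ` carrier G" using hh(2) \<pi>(2) by blast
      obtain g where g: "g \<in> module_hom R ?Q G" "\<And>v. v \<in> carrier ?Q \<Longrightarrow> d (g v) = h (\<pi> v)"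
        by (rule R.free_module_projective[OF G G' d h\<pi> im]) (rule that)
      have h0: "h \<zero>\<^bsub>?F\<^esub> = \<zero>\<^bsub>G'\<^esub>" using module_hom_zero[OF hh(1) FK G'] by simp
      have gL: "g \<in> module_hom R (?Q\<lparr>carrier := L\<rparr>) G"
        by (rule module_hom_restrict_carrier[OF g(1) submodule_subset[OF L]])
      then have "restrict g L \<in> carrier ?H" using restrict_module_hom[OF QL, of g G] by simp
      moreover have "restrict g L ` L \<subseteq> ?Z"
        using g module_hom_closed[OF g(1)] h0 by (auto simp: L_def)
      ultimately show ?thesis
        using g hh(3) by (intro bexI[of _ "restrict g L"]) (auto simp: homs_into_def)
    qed
    show "h \<in> homs_extending R ?F K G' (d ` carrier G)"
      if \<rho>: "?\<rho> h u" and h: "h \<in> homs_into R ?F K G' (d ` carrier G)" and u: "u \<in> homs_extending R ?Q L G ?Z" for h u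
    proof -
      obtain g where g: "g \<in> module_hom R ?Q G" "\<And>v. v \<in> carrier ?Q \<Longrightarrow> d (g v) = h (\<pi> v)" "\<And>v. v \<in> L \<Longrightarrow> u v = g v"
        using \<rho> by blast
      obtain z where z: "z \<in> module_hom R ?Q G" "z ` carrier ?Q \<subseteq> ?Z" "u = restrict z L"
        using u unfolding homs_extending_def by blast
      \<comment> \<open>Since \<open>u\<close> extends to \<open>z\<close> with values in the kernel
        of \<open>d\<close>, the lift \<open>g\<close> can be replaced by \<open>g - z\<close>,
        which vanishes on \<open>L\<close> and therefore descends to a map \<open>f\<close> on
        \<open>K\<close>. Extending \<open>f\<close> to \<open>R^p\<close> by
        \<open>ext_trivial\<close> and composing with \<open>d\<close> extends
        \<open>h\<close>.\<close>
      let ?k = "\<lambda>v. g v \<ominus>\<^bsub>G\<^esub> z v"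
      have k: "?k \<in> module_hom R ?Q G" by (rule module_hom_diff[OF Q G g(1) z(1)])
      have k0: "?k v = \<zero>\<^bsub>G\<^esub>" if "v \<in> L" for v
        using g(3)[OF that] z(3) that module_hom_closed[OF g(1) LQ[OF that]] by simp
      have k_eq: "?k v = ?k v'" if v: "v \<in> carrier ?Q" "v' \<in> carrier ?Q" "\<pi> v = \<pi> v'" for v v'
      proof -
        have "\<pi> (v \<ominus>\<^bsub>?Q\<^esub> v') = \<zero>\<^bsub>?F\<^esub>"
          using module_hom_minus[OF \<pi>(1) Q F v(1,2)] v module_hom_closed[OF \<pi>(1)]
          by (simp del: free_module_sel)
        then have "v \<ominus>\<^bsub>?Q\<^esub> v' \<in> L" using v by (simp add: L_def del: free_module_sel)
        from k0[OF this] have "?k v \<ominus>\<^bsub>G\<^esub> ?k v' = \<zero>\<^bsub>G\<^esub>"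
          using module_hom_minus[OF k Q G v(1,2)] by simp
        then show ?thesis using module_hom_closed[OF k] v G.minus_eq_zero_iff by simp
      qed
      define s where "s = inv_into (carrier ?Q) \<pi>"
      have s: "s x \<in> carrier ?Q" "\<pi> (s x) = x" if "x \<in> K" for x
        unfolding s_def
        using that \<pi>(2) inv_into_into[of x \<pi> "carrier ?Q"] f_inv_into_f[of x \<pi> "carrier ?Q"]
        by simp_all
      define f where "f x = ?k (s x)" for x
      have f: "f (\<pi> v) = ?k v" if "v \<in> carrier ?Q" for v
        unfolding f_def using s[OF \<pi>K[OF that]] that by (intro k_eq) auto
      have fhom: "f \<in> module_hom R (?F\<lparr>carrier := K\<rparr>) G"
      proof (rule module_homI)
        fix x assume "x \<in> carrier (?F\<lparr>carrier := K\<rparr>)"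
        then have x: "x \<in> K" by simp
        show "f x \<in> carrier G" unfolding f_def by (rule module_hom_closed[OF k s(1)[OF x]])
        show "f (x \<oplus>\<^bsub>?F\<lparr>carrier := K\<rparr>\<^esub> y) = f x \<oplus>\<^bsub>G\<^esub> f y" if "y \<in> carrier (?F\<lparr>carrier := K\<rparr>)" for y
        proof -
          have y: "y \<in> K" using that by simp
          have "f (x \<oplus>\<^bsub>?F\<^esub> y) = f (\<pi> (s x \<oplus>\<^bsub>?Q\<^esub> s y))"
            using module_hom_add[OF \<pi>(1) s(1)[OF x] s(1)[OF y]] s x y by (simp del: free_module_sel)
          also have "\<dots> = ?k (s x) \<oplus>\<^bsub>G\<^esub> ?k (s y)"
            using f[OF Q.M.a_closed] module_hom_add[OF k s(1)[OF x] s(1)[OF y]] s x y by (simp del: free_module_sel)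
          finally show ?thesis by (simp add: f_def del: free_module_sel)
        qed
        show "f (r \<odot>\<^bsub>?F\<lparr>carrier := K\<rparr>\<^esub> x) = r \<odot>\<^bsub>G\<^esub> f x" if r: "r \<in> carrier R" for r
        proof -
          have "f (r \<odot>\<^bsub>?F\<^esub> x) = f (\<pi> (r \<odot>\<^bsub>?Q\<^esub> s x))"
            using module_hom_smult[OF \<pi>(1) r s(1)[OF x]] s x by (simp del: free_module_sel)
          also have "\<dots> = r \<odot>\<^bsub>G\<^esub> ?k (s x)"
            using f[OF Q.smult_closed] module_hom_smult[OF k r s(1)[OF x]] s x r by (simp del: free_module_sel)
          finally show ?thesis by (simp add: f_def del: free_module_sel)
        qed
      qed
      obtain f' where f': "f' \<in> module_hom R ?F G" "\<And>x. x \<in> K \<Longrightarrow> f' x = f x"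
        using triv K fhom unfolding ext_trivial_def by blast
      have df': "(\<lambda>x. d (f' x)) \<in> module_hom R ?F G'" by (rule module_hom_compose[OF f'(1) d])
      have "d (f' x) = h x" if x: "x \<in> K" for x
      proof -
        let ?v = "s x"
        have v: "?v \<in> carrier ?Q" by (rule s(1)[OF x])
        have "d (f' x) = d (g ?v \<ominus>\<^bsub>G\<^esub> z ?v)" using f'(2)[OF x] by (simp add: f_def)
        also have "\<dots> = d (g ?v) \<ominus>\<^bsub>G'\<^esub> d (z ?v)"
          using module_hom_minus[OF d G G'] module_hom_closed[OF g(1) v] module_hom_closed[OF z(1) v] by simp
        also have "d (z ?v) = \<zero>\<^bsub>G'\<^esub>" using z(2) v by blast
        also have "d (g ?v) \<ominus>\<^bsub>G'\<^esub> \<zero>\<^bsub>G'\<^esub> = d (g ?v)"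
          using module_hom_closed[OF d module_hom_closed[OF g(1) v]] by (simp add: G'.M.minus_eq)
        also have "\<dots> = h x" using g(2)[OF v] s(2)[OF x] by simp
        finally show ?thesis .
      qed
      moreover have "h \<in> extensional K" using h by (simp add: homs_into_def)
      ultimately have "h = restrict (\<lambda>x. d (f' x)) K"
        by (intro extensionalityI[of _ K]) auto
      then show ?thesis
        unfolding homs_extending_def using df' module_hom_closed[OF f'(1)] by blast
    qed
    show "artinian_between R ?H (homs_into R ?Q L G ?Z) (homs_extending R ?Q L G ?Z)"
      using ext L unfolding ext_artinian_def by blast
  qed
qed

text \<open>An ideal \<open>I\<close> is a submodule of \<open>R\<^sup>1\<close>, and an element \<open>z\<close> of \<open>M\<close> gives the homomorphism
  \<open>r \<mapsto> r z\<close> from \<open>I\<close> to \<open>M\<close>.\<close>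

definition ideal_vectors :: "('a, 'r) ring_scheme \<Rightarrow> 'a set \<Rightarrow> (nat \<Rightarrow> 'a) set" where
  "ideal_vectors R I = {f \<in> carrier (free_module R 1). f 0 \<in> I}"

definition evaluation_hom :: "('a, 'r) ring_scheme \<Rightarrow> 'a set \<Rightarrow> ('a, 'b) module \<Rightarrow> 'b \<Rightarrow> (nat \<Rightarrow> 'a) \<Rightarrow> 'b" where
  "evaluation_hom R I M z = (\<lambda>f\<in>ideal_vectors R I. f 0 \<odot>\<^bsub>M\<^esub> z)"

section \<open>The first extension group of a cyclic module\<close>

context cring
begin

lemma submodule_ideal_vectors:
  assumes "ideal I R"
  shows "submodule (ideal_vectors R I) R (free_module R 1)"
proof -
  interpret F: module R "free_module R 1" by (rule module_free_module)
  interpret ideal I R by fact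
  show ?thesis
  proof (rule F.submoduleI')
    show "x \<oplus>\<^bsub>free_module R 1\<^esub> y \<in> ideal_vectors R I" if "x \<in> ideal_vectors R I" "y \<in> ideal_vectors R I" for x y
      using that F.M.a_closed[of x y] by (simp add: ideal_vectors_def)
    show "r \<odot>\<^bsub>free_module R 1\<^esub> x \<in> ideal_vectors R I" if "r \<in> carrier R" "x \<in> ideal_vectors R I" for r x
      using that F.smult_closed[of r x] by (simp add: ideal_vectors_def I_l_closed)
    show "\<zero>\<^bsub>free_module R 1\<^esub> \<in> ideal_vectors R I"
      using F.M.zero_closed by (simp add: ideal_vectors_def)
  qed (auto simp: ideal_vectors_def)
qed

lemma evaluation_hom_simps:
  assumes M: "module R M" and I: "ideal I R"
  shows evaluation_hom_closed: "z \<in> carrier M \<Longrightarrow>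
      evaluation_hom R I M z \<in> carrier (hom_module R ((free_module R 1)\<lparr>carrier := ideal_vectors R I\<rparr>) M)"
    and evaluation_hom_add: "z \<in> carrier M \<Longrightarrow> z' \<in> carrier M \<Longrightarrow> evaluation_hom R I M (z \<oplus>\<^bsub>M\<^esub> z') =
      evaluation_hom R I M z \<oplus>\<^bsub>hom_module R ((free_module R 1)\<lparr>carrier := ideal_vectors R I\<rparr>) M\<^esub> evaluation_hom R I M z'"
    and evaluation_hom_smult: "r \<in> carrier R \<Longrightarrow> z \<in> carrier M \<Longrightarrow> evaluation_hom R I M (r \<odot>\<^bsub>M\<^esub> z) =
      r \<odot>\<^bsub>hom_module R ((free_module R 1)\<lparr>carrier := ideal_vectors R I\<rparr>) M\<^esub> evaluation_hom R I M z"
proof -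
  let ?K = "(free_module R 1)\<lparr>carrier := ideal_vectors R I\<rparr>"
  interpret M: module R M by fact
  interpret F: module R "free_module R 1" by (rule module_free_module)
  have K: "module R ?K" by (rule F.module_submodule[OF submodule_ideal_vectors[OF I]])
  have co: "f 0 \<in> carrier R" if "f \<in> ideal_vectors R I" for f
    using that free_module_coord[of f 1 0] by (simp add: ideal_vectors_def)
  show "evaluation_hom R I M z \<in> carrier (hom_module R ?K M)" if z: "z \<in> carrier M"
  proof -
    have "(\<lambda>f. f 0 \<odot>\<^bsub>M\<^esub> z) \<in> module_hom R ?K M"
      using z co by (intro module_homI) (simp_all add: M.smult_l_distr M.smult_assoc1)
    then show ?thesis
      using restrict_module_hom[OF K, of "\<lambda>f. f 0 \<odot>\<^bsub>M\<^esub> z" M] by (simp add: evaluation_hom_def)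
  qed
  show "evaluation_hom R I M (z \<oplus>\<^bsub>M\<^esub> z') = evaluation_hom R I M z \<oplus>\<^bsub>hom_module R ?K M\<^esub> evaluation_hom R I M z'"
    if "z \<in> carrier M" "z' \<in> carrier M"
    using that co by (auto simp: evaluation_hom_def M.smult_r_distr intro!: restrict_ext)
  show "evaluation_hom R I M (r \<odot>\<^bsub>M\<^esub> z) = r \<odot>\<^bsub>hom_module R ?K M\<^esub> evaluation_hom R I M z"
    if "r \<in> carrier R" "z \<in> carrier M"
    using that co by (auto simp: evaluation_hom_def M.smult_comm intro!: restrict_ext)
qed

text \<open>A homomorphism on \<open>R^1\<close> is multiplication by its value \<open>b\<close> at
  the unit vector.\<close>

lemma evaluation_hom_mem_extending:
  assumes M: "module R M" and I: "ideal I R" and z: "z \<in> carrier M" and N: "submodule N R M"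
    and *: "evaluation_hom R I M z \<in> homs_extending R (free_module R 1) (ideal_vectors R I) M N"
  obtains b where "b \<in> N" "\<And>r. r \<in> I \<Longrightarrow> r \<odot>\<^bsub>M\<^esub> z = r \<odot>\<^bsub>M\<^esub> b"
proof -
  let ?e = "unit_vector R 0"
  have e: "?e \<in> carrier (free_module R 1)" by (rule unit_vector_in_free_module) simp
  obtain h where h: "h \<in> module_hom R (free_module R 1) M" "h ` carrier (free_module R 1) \<subseteq> N"
    "evaluation_hom R I M z = restrict h (ideal_vectors R I)"
    using * unfolding homs_extending_def by blast
  have "r \<odot>\<^bsub>M\<^esub> z = r \<odot>\<^bsub>M\<^esub> h ?e" if r: "r \<in> I" for r
  proof -
    have rc: "r \<in> carrier R" by (rule ideal.Icarr[OF I r])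
    let ?v = "r \<odot>\<^bsub>free_module R 1\<^esub> ?e"
    have v0: "?v 0 = r" using rc by (simp add: unit_vector_def)
    have v: "?v \<in> ideal_vectors R I"
      using free_module_closed(2)[OF e rc] v0 r by (simp add: ideal_vectors_def del: free_module_sel)
    have "r \<odot>\<^bsub>M\<^esub> z = evaluation_hom R I M z ?v"
      using v v0 by (simp add: evaluation_hom_def del: free_module_sel)
    also have "\<dots> = h ?v" using h(3) v by (simp del: free_module_sel)
    finally show ?thesis using module_hom_smult[OF h(1) rc e] by simp
  qed
  then show ?thesis using that h(2) e by blast
qed

lemma evaluation_hom_mem_into:
  assumes M: "module R M" and I: "ideal I R" and z: "z \<in> carrier M"
    and *: "\<And>r. r \<in> I \<Longrightarrow> r \<odot>\<^bsub>M\<^esub> z \<in> N"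
  shows "evaluation_hom R I M z \<in> homs_into R (free_module R 1) (ideal_vectors R I) M N"
  using evaluation_hom_closed[OF M I z] * by (auto simp: homs_into_def evaluation_hom_def ideal_vectors_def)

text \<open>An element \<open>z\<close> of \<open>Z\<close> with \<open>I z\<close> inside
  \<open>B\<close> gives the map \<open>r \<mapsto> r z\<close> from \<open>I\<close> to
  \<open>B\<close>. It extends to \<open>R\<close> with values in \<open>B\<close> exactly when
  \<open>z\<close> differs from some \<open>b\<close> in \<open>B\<close> by an element killed by
  \<open>I\<close>. So the cokernel of \<open>(0 :_Z I) -> (0 :_(Z/B) I)\<close> embeds into
  \<open>Ext^1(R/I, B)\<close>.\<close>

lemma artinian_between_transporter:
  assumes M: "module R M" and I: "ideal I R" and B: "submodule B R M" "B \<subseteq> Z" and Z: "submodule Z R M"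
    and ext: "ext_artinian R M B"
  shows "artinian_between R M {z \<in> Z. \<forall>r\<in>I. r \<odot>\<^bsub>M\<^esub> z \<in> B} ({z \<in> Z. \<forall>r\<in>I. r \<odot>\<^bsub>M\<^esub> z = \<zero>\<^bsub>M\<^esub>} <+>\<^bsub>M\<^esub> B)"
proof -
  let ?F = "free_module R 1" and ?K = "ideal_vectors R I"
  let ?H = "hom_module R (?F\<lparr>carrier := ?K\<rparr>) M"
  note F = module_free_module[of 1] and K = submodule_ideal_vectors[OF I]
  interpret M: module R M by fact
  have Isub: "I \<subseteq> carrier R" using ideal.Icarr[OF I] by blast
  have Z0: "submodule {z \<in> Z. \<forall>r\<in>I. r \<odot>\<^bsub>M\<^esub> z = \<zero>\<^bsub>M\<^esub>} R M"
    using submodule_transporter[OF M Z M.submodule_zero_singleton Isub] by simp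
  show ?thesis
  proof (rule artinian_between_rel[OF M module_hom_module[OF module.module_submodule[OF F K] M]
        submodule_homs_into[OF F K M B(1)] submodule_homs_extending[OF F K M B(1)] homs_extending_subset[OF F K]
        M.submodule_set_add[OF Z0 B(1)],
        where \<rho> = "\<lambda>z \<phi>. z \<in> carrier M \<and> \<phi> = evaluation_hom R I M z"])
    note ev = evaluation_hom_simps[OF M I]
    show "z \<in> carrier M \<and> \<phi> \<in> carrier ?H" if "z \<in> carrier M \<and> \<phi> = evaluation_hom R I M z" for z \<phi>
      using that ev(1) by blast
    show "z \<oplus>\<^bsub>M\<^esub> z' \<in> carrier M \<and> \<phi> \<oplus>\<^bsub>?H\<^esub> \<phi>' = evaluation_hom R I M (z \<oplus>\<^bsub>M\<^esub> z')"
      if "z \<in> carrier M \<and> \<phi> = evaluation_hom R I M z" "z' \<in> carrier M \<and> \<phi>' = evaluation_hom R I M z'" for z \<phi> z' \<phi>'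
      using that ev(2) by auto
    show "r \<odot>\<^bsub>M\<^esub> z \<in> carrier M \<and> r \<odot>\<^bsub>?H\<^esub> \<phi> = evaluation_hom R I M (r \<odot>\<^bsub>M\<^esub> z)"
      if "r \<in> carrier R" "z \<in> carrier M \<and> \<phi> = evaluation_hom R I M z" for r z \<phi>
      using that ev(3) by auto
    show "\<exists>\<phi>\<in>homs_into R ?F ?K M B. z \<in> carrier M \<and> \<phi> = evaluation_hom R I M z"
      if "z \<in> {z \<in> Z. \<forall>r\<in>I. r \<odot>\<^bsub>M\<^esub> z \<in> B}" for z
      using that evaluation_hom_mem_into[OF M I] submodule_mem[OF Z] by blast
    show "z \<in> {z \<in> Z. \<forall>r\<in>I. r \<odot>\<^bsub>M\<^esub> z = \<zero>\<^bsub>M\<^esub>} <+>\<^bsub>M\<^esub> B"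
      if z: "z \<in> carrier M \<and> \<phi> = evaluation_hom R I M z" "z \<in> {z \<in> Z. \<forall>r\<in>I. r \<odot>\<^bsub>M\<^esub> z \<in> B}"
        and \<phi>: "\<phi> \<in> homs_extending R ?F ?K M B" for z \<phi>
    proof -
      have zc: "z \<in> carrier M" and zZ: "z \<in> Z" using z by auto
      obtain b where b: "b \<in> B" "\<And>r. r \<in> I \<Longrightarrow> r \<odot>\<^bsub>M\<^esub> z = r \<odot>\<^bsub>M\<^esub> b"
        using evaluation_hom_mem_extending[OF M I zc B(1)] z \<phi> by blast
      have bc: "b \<in> carrier M" by (rule submodule_mem[OF B(1) b(1)])
      have "z \<ominus>\<^bsub>M\<^esub> b \<in> Z" using M.submodule_minus[OF Z zZ] b(1) B(2) by blast
      moreover have "r \<odot>\<^bsub>M\<^esub> (z \<ominus>\<^bsub>M\<^esub> b) = \<zero>\<^bsub>M\<^esub>" if "r \<in> I" for r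
        using b(2)[OF that] ideal.Icarr[OF I that] zc bc by (simp add: M.smult_minus)
      moreover have "z = (z \<ominus>\<^bsub>M\<^esub> b) \<oplus>\<^bsub>M\<^esub> b"
        using M.minus_add_cancel[OF zc bc] zc bc by (simp add: M.M.a_comm)
      ultimately show ?thesis unfolding M.set_add_mem using b(1) by blast
    qed
    show "artinian_between R ?H (homs_into R ?F ?K M B) (homs_extending R ?F ?K M B)"
      using ext K unfolding ext_artinian_def by blast
  qed
qed

text \<open>For \<open>y = d z\<close> killed by \<open>I\<close>, the map
  \<open>r \<mapsto> r z\<close> on \<open>I\<close> takes values in the kernel of \<open>d\<close>,
  and it extends to \<open>R\<close> within the kernel exactly when an element of the kernel
  corrects \<open>z\<close> to an element killed by \<open>I\<close>. This embeds the cokernel of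
  \<open>Hom(R/I, G) -> Hom(R/I, d G)\<close> into \<open>Ext^1(R/I, ker d)\<close>.\<close>

lemma artinian_between_annihilator_image:
  assumes G: "module R G" and G': "module R G'" and d: "d \<in> module_hom R G G'" and I: "ideal I R"
    and ext: "ext_artinian R G {x \<in> carrier G. d x = \<zero>\<^bsub>G'\<^esub>}"
  shows "artinian_between R G' {y \<in> d ` carrier G. \<forall>r\<in>I. r \<odot>\<^bsub>G'\<^esub> y = \<zero>\<^bsub>G'\<^esub>}
    (d ` {x \<in> carrier G. \<forall>r\<in>I. r \<odot>\<^bsub>G\<^esub> x = \<zero>\<^bsub>G\<^esub>})"
proof -
  let ?F = "free_module R 1" and ?K = "ideal_vectors R I" and ?Z = "{x \<in> carrier G. d x = \<zero>\<^bsub>G'\<^esub>}"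
  let ?H = "hom_module R (?F\<lparr>carrier := ?K\<rparr>) G"
  note F = module_free_module[of 1] and K = submodule_ideal_vectors[OF I]
  interpret G: module R G by fact
  interpret G': module R G' by fact
  have Isub: "I \<subseteq> carrier R" using ideal.Icarr[OF I] by blast
  note Z = submodule_a_kernel[OF G G' d]
  have G0: "submodule {x \<in> carrier G. \<forall>r\<in>I. r \<odot>\<^bsub>G\<^esub> x = \<zero>\<^bsub>G\<^esub>} R G"
    using submodule_transporter[OF G G.carrier_is_submodule G.submodule_zero_singleton Isub] by simp
  show ?thesis
  proof (rule artinian_between_rel[OF G' module_hom_module[OF module.module_submodule[OF F K] G]
        submodule_homs_into[OF F K G Z] submodule_homs_extending[OF F K G Z] homs_extending_subset[OF F K]
        submodule_image[OF G G' d G0],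
        where \<rho> = "\<lambda>y \<phi>. \<exists>z \<in> carrier G. y = d z \<and> \<phi> = evaluation_hom R I G z"])
    note ev = evaluation_hom_simps[OF G I]
    show "y \<in> carrier G' \<and> \<phi> \<in> carrier ?H" if "\<exists>z \<in> carrier G. y = d z \<and> \<phi> = evaluation_hom R I G z" for y \<phi>
      using that ev(1) module_hom_closed[OF d] by blast
    show "\<exists>z \<in> carrier G. y \<oplus>\<^bsub>G'\<^esub> y' = d z \<and> \<phi> \<oplus>\<^bsub>?H\<^esub> \<phi>' = evaluation_hom R I G z"
      if "\<exists>z \<in> carrier G. y = d z \<and> \<phi> = evaluation_hom R I G z"
        "\<exists>z \<in> carrier G. y' = d z \<and> \<phi>' = evaluation_hom R I G z" for y \<phi> y' \<phi>'
      using that ev(2) module_hom_add[OF d] G.M.a_closed by metis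
    show "\<exists>z \<in> carrier G. r \<odot>\<^bsub>G'\<^esub> y = d z \<and> r \<odot>\<^bsub>?H\<^esub> \<phi> = evaluation_hom R I G z"
      if "r \<in> carrier R" "\<exists>z \<in> carrier G. y = d z \<and> \<phi> = evaluation_hom R I G z" for r y \<phi>
      using that ev(3) module_hom_smult[OF d] G.smult_closed by metis
    show "\<exists>\<phi>\<in>homs_into R ?F ?K G ?Z. \<exists>z \<in> carrier G. y = d z \<and> \<phi> = evaluation_hom R I G z"
      if y: "y \<in> {y \<in> d ` carrier G. \<forall>r\<in>I. r \<odot>\<^bsub>G'\<^esub> y = \<zero>\<^bsub>G'\<^esub>}" for y
    proof -
      obtain z where z: "z \<in> carrier G" "y = d z" using y by blast
      have "r \<odot>\<^bsub>G\<^esub> z \<in> ?Z" if "r \<in> I" for r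
        using y z that module_hom_smult[OF d] Isub by auto
      then show ?thesis using evaluation_hom_mem_into[OF G I z(1)] z by blast
    qed
    show "y \<in> d ` {x \<in> carrier G. \<forall>r\<in>I. r \<odot>\<^bsub>G\<^esub> x = \<zero>\<^bsub>G\<^esub>}"
      if y: "\<exists>z \<in> carrier G. y = d z \<and> \<phi> = evaluation_hom R I G z"
        and \<phi>: "\<phi> \<in> homs_extending R ?F ?K G ?Z" for y \<phi>
    proof -
      obtain z where z: "z \<in> carrier G" "y = d z" "\<phi> = evaluation_hom R I G z" using y by blast
      obtain b where b: "b \<in> ?Z" "\<And>r. r \<in> I \<Longrightarrow> r \<odot>\<^bsub>G\<^esub> z = r \<odot>\<^bsub>G\<^esub> b"
        using evaluation_hom_mem_extending[OF G I z(1) Z] z \<phi> by blast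
      have bc: "b \<in> carrier G" using b(1) by blast
      have "r \<odot>\<^bsub>G\<^esub> (z \<ominus>\<^bsub>G\<^esub> b) = \<zero>\<^bsub>G\<^esub>" if "r \<in> I" for r
        using b(2)[OF that] ideal.Icarr[OF I that] z(1) bc by (simp add: G.smult_minus)
      moreover have "d (z \<ominus>\<^bsub>G\<^esub> b) = y"
        using module_hom_minus[OF d G G' z(1) bc] b(1) z module_hom_closed[OF d z(1)]
        by (simp add: G'.M.minus_eq)
      ultimately show ?thesis using G.M.minus_closed[OF z(1) bc] by blast
    qed
    show "artinian_between R ?H (homs_into R ?F ?K G ?Z) (homs_extending R ?F ?K G ?Z)"
      using ext K unfolding ext_artinian_def by blast
  qed
qed

end

declare free_module_sel [simp del]

section \<open>Torsion parts of modules with trivial extension groups\<close>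

text \<open>Meant for a vector \<open>k + l\<close> whose chosen component in \<open>K\<close> is
  \<open>s\<close> instead of \<open>k\<close>: the difference of the two
  \<open>K\<close>-components becomes a difference of elements of \<open>L\<close>.\<close>

lemma (in module) minus_diff_swap:
  assumes "s \<in> carrier M" "k \<in> carrier M" "l \<in> carrier M"
  shows "s \<ominus>\<^bsub>M\<^esub> k = l \<ominus>\<^bsub>M\<^esub> (k \<oplus>\<^bsub>M\<^esub> l \<ominus>\<^bsub>M\<^esub> s)"
proof -
  have "l \<ominus>\<^bsub>M\<^esub> (k \<oplus>\<^bsub>M\<^esub> l \<ominus>\<^bsub>M\<^esub> s) = l \<oplus>\<^bsub>M\<^esub> (\<ominus>\<^bsub>M\<^esub> l \<oplus>\<^bsub>M\<^esub> (s \<ominus>\<^bsub>M\<^esub> k))"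
    using assms by (simp add: M.minus_eq M.minus_add M.a_ac)
  then show ?thesis using assms by (simp add: M.r_neg2)
qed

lemma submodule_Union_chain:
  assumes M: "module R M" and C: "C \<noteq> {}" "\<And>N. N \<in> C \<Longrightarrow> submodule N R M"
    and chain: "\<And>N N'. N \<in> C \<Longrightarrow> N' \<in> C \<Longrightarrow> N \<subseteq> N' \<or> N' \<subseteq> N"
  shows "submodule (\<Union>C) R M"
proof -
  interpret M: module R M by fact
  show ?thesis
  proof (rule M.submoduleI')
    show "\<Union>C \<subseteq> carrier M" using submodule_subset[OF C(2)] by blast
    show "\<zero>\<^bsub>M\<^esub> \<in> \<Union>C" using C(1) submodule_zero[OF C(2)] by blast
    show "x \<oplus>\<^bsub>M\<^esub> y \<in> \<Union>C" if xy: "x \<in> \<Union>C" "y \<in> \<Union>C" for x y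
    proof -
      obtain N where "N \<in> C" "x \<in> N" "y \<in> N" using xy chain by (metis UnionE subsetD)
      then show ?thesis using submodule_add[OF C(2)] by blast
    qed
    show "r \<odot>\<^bsub>M\<^esub> x \<in> \<Union>C" if "r \<in> carrier R" "x \<in> \<Union>C" for r x
      using that submodule_smult[OF C(2)] by blast
  qed
qed

lemma module_torsion_power:
  assumes "module R M" "x \<in> carrier R" "y \<in> carrier M"
  shows "(x [^]\<^bsub>R\<^esub> (m + n)) \<odot>\<^bsub>M\<^esub> y = (x [^]\<^bsub>R\<^esub> (m::nat)) \<odot>\<^bsub>M\<^esub> ((x [^]\<^bsub>R\<^esub> (n::nat)) \<odot>\<^bsub>M\<^esub> y)"
proof -
  interpret module R M by fact
  show ?thesis using assms(2,3) by (simp add: R.nat_pow_mult[symmetric] smult_assoc1)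
qed

lemma submodule_power_transporter:
  fixes M :: "('a, 'b) module"
  assumes M: "module R M" and x: "x \<in> carrier R" and N: "submodule N R M"
  shows "submodule {y \<in> carrier M. (x [^]\<^bsub>R\<^esub> (n::nat)) \<odot>\<^bsub>M\<^esub> y \<in> N} R M"
proof -
  interpret module R M by fact
  show ?thesis
    by (rule submodule_vimage[OF M M smult_module_hom[OF M] N]) (use x in simp)
qed

lemma power_transporter_mono:
  fixes M :: "('a, 'b) module"
  assumes M: "module R M" and x: "x \<in> carrier R" and N: "submodule N R M" and "n \<le> m"
    and y: "y \<in> carrier M" "(x [^]\<^bsub>R\<^esub> (n::nat)) \<odot>\<^bsub>M\<^esub> y \<in> N"
  shows "(x [^]\<^bsub>R\<^esub> m) \<odot>\<^bsub>M\<^esub> y \<in> N"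
proof -
  interpret module R M by fact
  have "(x [^]\<^bsub>R\<^esub> (m - n + n)) \<odot>\<^bsub>M\<^esub> y \<in> N"
    unfolding module_torsion_power[OF M x y(1)] using x by (intro submodule_smult[OF N] y(2)) simp
  then show ?thesis using \<open>n \<le> m\<close> by simp
qed

lemma submodule_torsion:
  fixes M :: "('a, 'b) module"
  assumes M: "module R M" and X: "X \<subseteq> carrier R"
  shows "submodule {y \<in> carrier M. \<forall>x\<in>X. \<exists>n::nat. (x [^]\<^bsub>R\<^esub> n) \<odot>\<^bsub>M\<^esub> y = \<zero>\<^bsub>M\<^esub>} R M"
proof -
  interpret module R M by fact
  note z = submodule_zero_singleton
  note pt = submodule_power_transporter[OF M _ z]
  show ?thesis
  proof (rule submoduleI')
    fix y y' assume y: "y \<in> {y \<in> carrier M. \<forall>x\<in>X. \<exists>n::nat. (x [^]\<^bsub>R\<^esub> n) \<odot>\<^bsub>M\<^esub> y = \<zero>\<^bsub>M\<^esub>}"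
      "y' \<in> {y \<in> carrier M. \<forall>x\<in>X. \<exists>n::nat. (x [^]\<^bsub>R\<^esub> n) \<odot>\<^bsub>M\<^esub> y = \<zero>\<^bsub>M\<^esub>}"
    have "\<exists>n::nat. (x [^]\<^bsub>R\<^esub> n) \<odot>\<^bsub>M\<^esub> (y \<oplus>\<^bsub>M\<^esub> y') = \<zero>\<^bsub>M\<^esub>" if x: "x \<in> X" for x
    proof -
      have xc: "x \<in> carrier R" using x X by blast
      obtain n n' :: nat where n: "(x [^]\<^bsub>R\<^esub> n) \<odot>\<^bsub>M\<^esub> y \<in> {\<zero>\<^bsub>M\<^esub>}" "(x [^]\<^bsub>R\<^esub> n') \<odot>\<^bsub>M\<^esub> y' \<in> {\<zero>\<^bsub>M\<^esub>}"
        using y x by blast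
      let ?m = "max n n'"
      have "(x [^]\<^bsub>R\<^esub> ?m) \<odot>\<^bsub>M\<^esub> y \<in> {\<zero>\<^bsub>M\<^esub>}" "(x [^]\<^bsub>R\<^esub> ?m) \<odot>\<^bsub>M\<^esub> y' \<in> {\<zero>\<^bsub>M\<^esub>}"
        using power_transporter_mono[OF M xc z _ _ n(1), of ?m] power_transporter_mono[OF M xc z _ _ n(2), of ?m] y
        by auto
      then have "(x [^]\<^bsub>R\<^esub> ?m) \<odot>\<^bsub>M\<^esub> (y \<oplus>\<^bsub>M\<^esub> y') = \<zero>\<^bsub>M\<^esub>"
        using submodule_add[OF pt[OF xc, of ?m], of y y'] y by auto
      then show ?thesis ..
    qed
    then show "y \<oplus>\<^bsub>M\<^esub> y' \<in> {y \<in> carrier M. \<forall>x\<in>X. \<exists>n::nat. (x [^]\<^bsub>R\<^esub> n) \<odot>\<^bsub>M\<^esub> y = \<zero>\<^bsub>M\<^esub>}"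
      using y by simp
  next
    fix r y assume r: "r \<in> carrier R" and y: "y \<in> {y \<in> carrier M. \<forall>x\<in>X. \<exists>n::nat. (x [^]\<^bsub>R\<^esub> n) \<odot>\<^bsub>M\<^esub> y = \<zero>\<^bsub>M\<^esub>}"
    have "\<exists>n::nat. (x [^]\<^bsub>R\<^esub> n) \<odot>\<^bsub>M\<^esub> (r \<odot>\<^bsub>M\<^esub> y) = \<zero>\<^bsub>M\<^esub>" if x: "x \<in> X" for x
    proof -
      have xc: "x \<in> carrier R" using x X by blast
      obtain n :: nat where n: "(x [^]\<^bsub>R\<^esub> n) \<odot>\<^bsub>M\<^esub> y = \<zero>\<^bsub>M\<^esub>" using y x by blast
      then have "(x [^]\<^bsub>R\<^esub> n) \<odot>\<^bsub>M\<^esub> (r \<odot>\<^bsub>M\<^esub> y) = \<zero>\<^bsub>M\<^esub>"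
        using submodule_smult[OF pt[OF xc, of n] r, of y] y by auto
      then show ?thesis ..
    qed
    then show "r \<odot>\<^bsub>M\<^esub> y \<in> {y \<in> carrier M. \<forall>x\<in>X. \<exists>n::nat. (x [^]\<^bsub>R\<^esub> n) \<odot>\<^bsub>M\<^esub> y = \<zero>\<^bsub>M\<^esub>}"
      using y r by simp
  qed (use X in auto)
qed

lemma carrier_torsion_module:
  assumes M: "module R M" and X: "finite X" "X \<subseteq> carrier R"
  shows "carrier (torsion_module R (genideal R X) M) =
    {y \<in> carrier M. \<forall>x\<in>X. \<exists>n::nat. (x [^]\<^bsub>R\<^esub> n) \<odot>\<^bsub>M\<^esub> y = \<zero>\<^bsub>M\<^esub>}"
  using module.torsion_iff[OF M X] by (auto simp: torsion_module_def)

text \<open>Choose \<open>L\<close> maximal among the submodules of \<open>F\<close> whose intersection with \<open>K\<close> lies in the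
  kernel of \<open>f\<close>. By maximality \<open>L\<close> contains that kernel, and a Fitting argument shows that a
  power of \<open>x\<close> sends \<open>F\<close> into \<open>L\<close>. So an extension of \<open>f\<close> that vanishes on \<open>L\<close> has torsion values.\<close>

lemma ext_trivial_torsion_module:
  fixes M :: "('a, 'b) module"
  assumes R: "cring R" "noetherian_ring R" and M: "module R M" and triv: "ext_trivial R M"
    and X: "finite X" "X \<subseteq> carrier R"
  shows "ext_trivial R (torsion_module R (genideal R X) M)"
  unfolding ext_trivial_def
proof (intro allI impI, elim conjE)
  interpret R: cring R by fact
  interpret M: module R M by fact
  fix p K f
  let ?F = "free_module R p" and ?T = "torsion_module R (genideal R X) M"
  assume K: "submodule K R ?F" and f: "f \<in> module_hom R (?F\<lparr>carrier := K\<rparr>) ?T"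
  note F = R.module_free_module[of p]
  interpret F: module R ?F by fact
  note FK = F.module_submodule[OF K]
  interpret FK: module R "?F\<lparr>carrier := K\<rparr>" by fact
  note Tcar = carrier_torsion_module[OF M X]
  have Tsel: "add ?T = add M" "smult ?T = smult M" "zero ?T = zero M" by (simp_all add: torsion_module_def)
  have fM: "f \<in> module_hom R (?F\<lparr>carrier := K\<rparr>) M"
    using f unfolding module_hom_def Tsel Tcar by blast
  have tors: "\<exists>n::nat. (x [^]\<^bsub>R\<^esub> n) \<odot>\<^bsub>M\<^esub> f k = \<zero>\<^bsub>M\<^esub>" if "k \<in> K" "x \<in> X" for k x
    using module_hom_closed[OF f, of k] that unfolding Tcar by simp
  have noeth: "\<exists>A. finite A \<and> A \<subseteq> K' \<and> (\<forall>N. submodule N R ?F \<longrightarrow> A \<subseteq> N \<longrightarrow> K' \<subseteq> N)"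
    if "submodule K' R ?F" for K'
    by (rule free_module_noetherian[OF R that])
  have fadd: "f (a \<oplus>\<^bsub>?F\<^esub> b) = f a \<oplus>\<^bsub>M\<^esub> f b" if "a \<in> K" "b \<in> K" for a b
    using module_hom_add[OF fM, of a b] that by simp
  have fsm: "f (r \<odot>\<^bsub>?F\<^esub> a) = r \<odot>\<^bsub>M\<^esub> f a" if "r \<in> carrier R" "a \<in> K" for r a
    using module_hom_smult[OF fM, of r a] that by simp
  have fcl: "f a \<in> carrier M" if "a \<in> K" for a using module_hom_closed[OF fM, of a] that by simp
  define ker where "ker = {k \<in> K. f k = \<zero>\<^bsub>M\<^esub>}"
  have ker: "submodule ker R ?F"
    using submodule_a_kernel[OF FK M fM] F.submodule_restrict_iff[OF K] by (simp add: ker_def)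
  have Kc: "a \<in> carrier ?F" if "a \<in> K" for a by (rule submodule_mem[OF K that])
  have diff_ker: "f a = f b" if ab: "a \<in> K" "b \<in> K" "a \<ominus>\<^bsub>?F\<^esub> b \<in> ker" for a b
  proof -
    have "f (b \<oplus>\<^bsub>?F\<^esub> (a \<ominus>\<^bsub>?F\<^esub> b)) = f b \<oplus>\<^bsub>M\<^esub> f (a \<ominus>\<^bsub>?F\<^esub> b)"
      using ab by (intro fadd) (auto simp: ker_def)
    then show ?thesis
      using F.minus_add_cancel[OF Kc[OF ab(1)] Kc[OF ab(2)]] ab fcl by (simp add: ker_def)
  qed
  \<comment> \<open>One exponent works for all of \<open>K\<close>, because \<open>K\<close> is
    finitely generated.\<close>
  have bound: "\<exists>k::nat. \<forall>y\<in>K. (x [^]\<^bsub>R\<^esub> k) \<odot>\<^bsub>M\<^esub> f y = \<zero>\<^bsub>M\<^esub>" if x: "x \<in> X" for x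
  proof -
    have xc: "x \<in> carrier R" using x X by blast
    obtain A where A: "finite A" "A \<subseteq> K" "\<And>N. submodule N R ?F \<Longrightarrow> A \<subseteq> N \<Longrightarrow> K \<subseteq> N"
      using noeth[OF K] by blast
    obtain n :: "_ \<Rightarrow> nat" where n: "\<And>k. k \<in> K \<Longrightarrow> (x [^]\<^bsub>R\<^esub> n k) \<odot>\<^bsub>M\<^esub> f k = \<zero>\<^bsub>M\<^esub>"
      using tors[OF _ x] by metis
    define m where "m = Max (insert 0 (n ` A))"
    have sub: "submodule {y \<in> K. f y \<in> {y \<in> carrier M. (x [^]\<^bsub>R\<^esub> m) \<odot>\<^bsub>M\<^esub> y \<in> {\<zero>\<^bsub>M\<^esub>}}} R ?F"
      using submodule_vimage[OF FK M fM submodule_power_transporter[OF M xc M.submodule_zero_singleton, of m]]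
        F.submodule_restrict_iff[OF K] by simp
    have "K \<subseteq> {y \<in> K. f y \<in> {y \<in> carrier M. (x [^]\<^bsub>R\<^esub> m) \<odot>\<^bsub>M\<^esub> y \<in> {\<zero>\<^bsub>M\<^esub>}}}"
    proof (rule A(3)[OF sub], rule subsetI)
      fix a assume a: "a \<in> A"
      then have aK: "a \<in> K" using A(2) by blast
      have "n a \<le> m" unfolding m_def by (rule Max_ge) (use A(1) a in auto)
      from power_transporter_mono[OF M xc M.submodule_zero_singleton this fcl[OF aK]] n[OF aK]
      show "a \<in> {y \<in> K. f y \<in> {y \<in> carrier M. (x [^]\<^bsub>R\<^esub> m) \<odot>\<^bsub>M\<^esub> y \<in> {\<zero>\<^bsub>M\<^esub>}}}"
        using aK fcl by simp
    qed
    then show ?thesis by blast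
  qed
  let ?\<L> = "{L. submodule L R ?F \<and> L \<inter> K \<subseteq> ker}"
  have "{\<zero>\<^bsub>?F\<^esub>} \<in> ?\<L>"
    using F.submodule_zero_singleton submodule_zero[OF ker] by auto
  then have "?\<L> \<noteq> {}" by blast
  then have "\<exists>L\<in>?\<L>. \<forall>L'\<in>?\<L>. L \<subseteq> L' \<longrightarrow> L' = L"
  proof (rule subset_Zorn_nonempty)
    fix C assume C: "C \<noteq> {}" "subset.chain ?\<L> C"
    then have "submodule (\<Union>C) R ?F"
      by (intro submodule_Union_chain[OF F]) (auto simp: subset_chain_def)
    moreover have "\<Union>C \<inter> K \<subseteq> ker" using C(2) by (auto simp: subset_chain_def)
    ultimately show "\<Union>C \<in> ?\<L>" by blast
  qed
  then obtain L where "L \<in> ?\<L>" and "\<forall>L'\<in>?\<L>. L \<subseteq> L' \<longrightarrow> L' = L" by (rule bexE)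
  then have L: "submodule L R ?F" "L \<inter> K \<subseteq> ker"
    and max: "\<And>L'. submodule L' R ?F \<Longrightarrow> L' \<inter> K \<subseteq> ker \<Longrightarrow> L \<subseteq> L' \<Longrightarrow> L' = L"
    by auto
  have Lc: "a \<in> carrier ?F" if "a \<in> L" for a by (rule submodule_mem[OF L(1) that])
  have kerL: "ker \<subseteq> L"
  proof -
    have "(L <+>\<^bsub>?F\<^esub> ker) \<inter> K \<subseteq> ker"
    proof
      fix z assume z: "z \<in> (L <+>\<^bsub>?F\<^esub> ker) \<inter> K"
      then obtain l u where lu: "l \<in> L" "u \<in> ker" "z = l \<oplus>\<^bsub>?F\<^esub> u" by (auto simp: F.set_add_mem)
      have uK: "u \<in> K" using lu by (simp add: ker_def)
      have "z \<ominus>\<^bsub>?F\<^esub> u \<in> K" using F.submodule_minus[OF K _ uK] z by blast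
      moreover have "z \<ominus>\<^bsub>?F\<^esub> u = l" unfolding lu(3) by (rule F.add_minus_cancel[OF Lc[OF lu(1)] Kc[OF uK]])
      ultimately have "l \<in> ker" using lu L(2) by blast
      then show "z \<in> ker" using submodule_add[OF ker _ lu(2)] lu(3) by blast
    qed
    from max[OF F.submodule_set_add[OF L(1) ker] this F.set_add_upper1[OF L(1) ker]]
    show ?thesis using F.set_add_upper2[OF L(1) ker] by blast
  qed
  have power_L: "\<exists>n::nat. \<forall>u\<in>carrier ?F. (x [^]\<^bsub>R\<^esub> n) \<odot>\<^bsub>?F\<^esub> u \<in> L" if x: "x \<in> X" for x
  proof -
    have xc: "x \<in> carrier R" using x X by blast
    have pc: "x [^]\<^bsub>R\<^esub> n \<in> carrier R" for n :: nat using xc by simp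
    \<comment> \<open>An ascending chain whose union is finitely generated, hence constant from some
      \<open>n\<close> on: whatever some power of \<open>x\<close> moves into \<open>L\<close> is
      already moved there by \<open>x^n\<close>.\<close>
    define S where "S n = {u \<in> carrier ?F. (x [^]\<^bsub>R\<^esub> (n::nat)) \<odot>\<^bsub>?F\<^esub> u \<in> L}" for n
    have S: "submodule (S n) R ?F" for n
      unfolding S_def by (rule submodule_power_transporter[OF F xc L(1)])
    have S_mono: "S n \<subseteq> S m" if "n \<le> m" for n m
      using power_transporter_mono[OF F xc L(1) that] unfolding S_def by blast
    have U: "submodule (\<Union>(range S)) R ?F"
    proof (rule submodule_Union_chain[OF F])
      show "N \<subseteq> N' \<or> N' \<subseteq> N" if N: "N \<in> range S" "N' \<in> range S" for N N'
      proof -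
        obtain i j where "N = S i" "N' = S j" using N by blast
        then show ?thesis using S_mono[of i j] S_mono[of j i] linear[of i j] by auto
      qed
    qed (use S in auto)
    obtain A where A: "finite A" "A \<subseteq> \<Union>(range S)" "\<And>N. submodule N R ?F \<Longrightarrow> A \<subseteq> N \<Longrightarrow> \<Union>(range S) \<subseteq> N"
      using noeth[OF U] by blast
    obtain n where "A \<subseteq> S n"
    proof -
      from A(2) obtain N where N: "\<And>a. a \<in> A \<Longrightarrow> a \<in> S (N a)" by (auto simp: subset_iff) metis
      have "A \<subseteq> S (Max (insert 0 (N ` A)))"
      proof
        fix a assume a: "a \<in> A"
        have "N a \<le> Max (insert 0 (N ` A))" by (rule Max_ge) (use A(1) a in auto)
        then show "a \<in> S (Max (insert 0 (N ` A)))" using N[OF a] S_mono by blast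
      qed
      then show ?thesis using that by blast
    qed
    then have Sn: "S m \<subseteq> S n" for m using A(3)[OF S] by blast
    obtain k :: nat where k: "\<And>y. y \<in> K \<Longrightarrow> (x [^]\<^bsub>R\<^esub> k) \<odot>\<^bsub>M\<^esub> f y = \<zero>\<^bsub>M\<^esub>"
      using bound[OF x] by blast
    let ?W = "(\<lambda>u. (x [^]\<^bsub>R\<^esub> n) \<odot>\<^bsub>?F\<^esub> u) ` carrier ?F"
    have W: "submodule ?W R ?F"
      by (rule submodule_image[OF F F smult_module_hom[OF F pc] F.carrier_is_submodule])
    \<comment> \<open>If \<open>y = l + x^n u\<close> lies in \<open>K\<close>, then
      \<open>x^k y\<close> lies in \<open>ker\<close>, hence in \<open>L\<close>. So
      \<open>x^(k+n) u\<close> lies in \<open>L\<close>, and by the choice of \<open>n\<close>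
      already \<open>x^n u\<close> does. Maximality of \<open>L\<close> then forces the image of
      \<open>x^n\<close> into \<open>L\<close>.\<close>
    have "(L <+>\<^bsub>?F\<^esub> ?W) \<inter> K \<subseteq> ker"
    proof
      fix y assume y: "y \<in> (L <+>\<^bsub>?F\<^esub> ?W) \<inter> K"
      then obtain l u where lu: "l \<in> L" "u \<in> carrier ?F" "y = l \<oplus>\<^bsub>?F\<^esub> (x [^]\<^bsub>R\<^esub> n) \<odot>\<^bsub>?F\<^esub> u"
        by (auto simp: F.set_add_mem)
      let ?w = "(x [^]\<^bsub>R\<^esub> n) \<odot>\<^bsub>?F\<^esub> u"
      have wc: "?w \<in> carrier ?F" using lu(2) pc by (rule F.smult_closed[rotated])
      have yK: "y \<in> K" using y by blast
      have "(x [^]\<^bsub>R\<^esub> k) \<odot>\<^bsub>?F\<^esub> y \<in> ker"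
        using submodule_smult[OF K pc yK] fsm[OF pc yK] k[OF yK] by (simp add: ker_def)
      then have 1: "(x [^]\<^bsub>R\<^esub> k) \<odot>\<^bsub>?F\<^esub> y \<in> L" using kerL by blast
      have 2: "(x [^]\<^bsub>R\<^esub> k) \<odot>\<^bsub>?F\<^esub> l \<in> L" by (rule submodule_smult[OF L(1) pc lu(1)])
      have "(x [^]\<^bsub>R\<^esub> k) \<odot>\<^bsub>?F\<^esub> y = (x [^]\<^bsub>R\<^esub> k) \<odot>\<^bsub>?F\<^esub> l \<oplus>\<^bsub>?F\<^esub> (x [^]\<^bsub>R\<^esub> k) \<odot>\<^bsub>?F\<^esub> ?w"
        unfolding lu(3) by (rule F.smult_r_distr[OF pc Lc[OF lu(1)] wc])
      then have "(x [^]\<^bsub>R\<^esub> k) \<odot>\<^bsub>?F\<^esub> ?w = (x [^]\<^bsub>R\<^esub> k) \<odot>\<^bsub>?F\<^esub> y \<ominus>\<^bsub>?F\<^esub> (x [^]\<^bsub>R\<^esub> k) \<odot>\<^bsub>?F\<^esub> l"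
        using F.add_minus_cancel'[OF F.smult_closed[OF pc Lc[OF lu(1)]] F.smult_closed[OF pc wc]] by metis
      then have "(x [^]\<^bsub>R\<^esub> (k + n)) \<odot>\<^bsub>?F\<^esub> u \<in> L"
        using F.submodule_minus[OF L(1) 1 2] module_torsion_power[OF F xc lu(2), of k n] by metis
      then have "u \<in> S (k + n)" using lu(2) by (simp add: S_def)
      then have "?w \<in> L" using Sn[of "k + n"] by (auto simp: S_def)
      then have "y \<in> L" unfolding lu(3) by (rule submodule_add[OF L(1) lu(1)])
      then show "y \<in> ker" using yK L(2) by blast
    qed
    from max[OF F.submodule_set_add[OF L(1) W] this F.set_add_upper1[OF L(1) W]]
    have "?W \<subseteq> L" using F.set_add_upper2[OF L(1) W] by blast
    then show ?thesis by blast
  qed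
  let ?S = "K <+>\<^bsub>?F\<^esub> L"
  have S: "submodule ?S R ?F" by (rule F.submodule_set_add[OF K L(1)])
  have "\<exists>k\<in>K. z \<ominus>\<^bsub>?F\<^esub> k \<in> L" if z: "z \<in> ?S" for z
  proof -
    obtain k l where kl: "k \<in> K" "l \<in> L" "z = k \<oplus>\<^bsub>?F\<^esub> l" using z by (auto simp: F.set_add_mem)
    have "z \<ominus>\<^bsub>?F\<^esub> k = l" unfolding kl(3) by (rule F.add_minus_cancel'[OF Kc[OF kl(1)] Lc[OF kl(2)]])
    then show ?thesis using kl by blast
  qed
  then obtain s where s: "\<And>z. z \<in> ?S \<Longrightarrow> s z \<in> K" "\<And>z. z \<in> ?S \<Longrightarrow> z \<ominus>\<^bsub>?F\<^esub> s z \<in> L"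
    by metis
  \<comment> \<open>The map \<open>k + l \<mapsto> f k\<close> on \<open>K + L\<close>, which is
    well defined because \<open>L \<inter> K\<close> lies in the kernel of \<open>f\<close>.\<close>
  define \<psi> where "\<psi> z = f (s z)" for z
  have \<psi>: "\<psi> (k \<oplus>\<^bsub>?F\<^esub> l) = f k" if kl: "k \<in> K" "l \<in> L" for k l
    unfolding \<psi>_def
  proof (rule diff_ker)
    let ?z = "k \<oplus>\<^bsub>?F\<^esub> l"
    have z: "?z \<in> ?S" using kl unfolding F.set_add_mem by blast
    show sK: "s ?z \<in> K" by (rule s(1)[OF z])
    show "k \<in> K" by fact
    have c: "?z \<in> carrier ?F" "s ?z \<in> carrier ?F" "k \<in> carrier ?F" "l \<in> carrier ?F"
      using submodule_mem[OF S z] Kc[OF sK] Kc[OF kl(1)] Lc[OF kl(2)] by auto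
    have "s ?z \<ominus>\<^bsub>?F\<^esub> k = l \<ominus>\<^bsub>?F\<^esub> (?z \<ominus>\<^bsub>?F\<^esub> s ?z)"
      by (rule F.minus_diff_swap[OF c(2-4)])
    then have "s ?z \<ominus>\<^bsub>?F\<^esub> k \<in> L" using F.submodule_minus[OF L(1) kl(2) s(2)[OF z]] by metis
    then show "s ?z \<ominus>\<^bsub>?F\<^esub> k \<in> ker" using F.submodule_minus[OF K sK kl(1)] L(2) by blast
  qed
  have \<psi>hom: "\<psi> \<in> module_hom R (?F\<lparr>carrier := ?S\<rparr>) M"
  proof (rule module_homI)
    fix z assume "z \<in> carrier (?F\<lparr>carrier := ?S\<rparr>)"
    then obtain k l where kl: "k \<in> K" "l \<in> L" "z = k \<oplus>\<^bsub>?F\<^esub> l" by (auto simp: F.set_add_mem)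
    then show "\<psi> z \<in> carrier M" using \<psi> fcl by simp
    show "\<psi> (z \<oplus>\<^bsub>?F\<lparr>carrier := ?S\<rparr>\<^esub> z') = \<psi> z \<oplus>\<^bsub>M\<^esub> \<psi> z'" if z': "z' \<in> carrier (?F\<lparr>carrier := ?S\<rparr>)" for z'
    proof -
      obtain k' l' where kl': "k' \<in> K" "l' \<in> L" "z' = k' \<oplus>\<^bsub>?F\<^esub> l'"
        using z' by (auto simp: F.set_add_mem)
      have "z \<oplus>\<^bsub>?F\<^esub> z' = (k \<oplus>\<^bsub>?F\<^esub> k') \<oplus>\<^bsub>?F\<^esub> (l \<oplus>\<^bsub>?F\<^esub> l')"
        unfolding kl(3) kl'(3) using Kc[OF kl(1)] Kc[OF kl'(1)] Lc[OF kl(2)] Lc[OF kl'(2)]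
        by (simp add: F.M.a_ac)
      then have "\<psi> (z \<oplus>\<^bsub>?F\<^esub> z') = f (k \<oplus>\<^bsub>?F\<^esub> k')"
        using \<psi>[OF submodule_add[OF K kl(1) kl'(1)] submodule_add[OF L(1) kl(2) kl'(2)]] by simp
      then show ?thesis using fadd[OF kl(1) kl'(1)] \<psi>[OF kl(1,2)] \<psi>[OF kl'(1,2)] kl kl'
        by (simp)
    qed
    show "\<psi> (r \<odot>\<^bsub>?F\<lparr>carrier := ?S\<rparr>\<^esub> z) = r \<odot>\<^bsub>M\<^esub> \<psi> z" if r: "r \<in> carrier R" for r
    proof -
      have "r \<odot>\<^bsub>?F\<^esub> z = (r \<odot>\<^bsub>?F\<^esub> k) \<oplus>\<^bsub>?F\<^esub> (r \<odot>\<^bsub>?F\<^esub> l)"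
        unfolding kl(3) by (rule F.smult_r_distr[OF r Kc[OF kl(1)] Lc[OF kl(2)]])
      then have "\<psi> (r \<odot>\<^bsub>?F\<^esub> z) = f (r \<odot>\<^bsub>?F\<^esub> k)"
        using \<psi>[OF submodule_smult[OF K r kl(1)] submodule_smult[OF L(1) r kl(2)]] by simp
      then show ?thesis using fsm[OF r kl(1)] \<psi>[OF kl(1,2)] kl by (simp)
    qed
  qed
  obtain \<Psi> where \<Psi>: "\<Psi> \<in> module_hom R ?F M" "\<And>z. z \<in> ?S \<Longrightarrow> \<Psi> z = \<psi> z"
    using triv S \<psi>hom unfolding ext_trivial_def by blast
  have \<Psi>K: "\<Psi> k = f k" if k: "k \<in> K" for k
  proof -
    have "k \<in> ?S" using F.set_add_upper1[OF K L(1)] k by blast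
    then show ?thesis
      using \<Psi>(2) \<psi>[OF k submodule_zero[OF L(1)]] F.M.r_zero[OF Kc[OF k]] by metis
  qed
  have \<Psi>L: "\<Psi> l = \<zero>\<^bsub>M\<^esub>" if l: "l \<in> L" for l
  proof -
    have "l \<in> ?S" using F.set_add_upper2[OF K L(1)] l by blast
    moreover have "\<psi> (\<zero>\<^bsub>?F\<^esub> \<oplus>\<^bsub>?F\<^esub> l) = f \<zero>\<^bsub>?F\<^esub>" by (rule \<psi>[OF submodule_zero[OF K] l])
    moreover have "f \<zero>\<^bsub>?F\<^esub> = \<zero>\<^bsub>M\<^esub>" using module_hom_zero[OF fM FK M] by simp
    ultimately show ?thesis using \<Psi>(2) F.M.l_zero[OF Lc[OF l]] by metis
  qed
  have "\<Psi> \<in> module_hom R ?F ?T"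
  proof (rule module_homI)
    fix u assume u: "u \<in> carrier ?F"
    \<comment> \<open>A power of each \<open>x\<close> moves \<open>u\<close> into \<open>L\<close>,
      where \<open>\<Psi>\<close> vanishes; so the values of \<open>\<Psi>\<close> are torsion
      although the extension was only taken in \<open>M\<close>.\<close>
    have "\<exists>n::nat. (x [^]\<^bsub>R\<^esub> n) \<odot>\<^bsub>M\<^esub> \<Psi> u = \<zero>\<^bsub>M\<^esub>" if x: "x \<in> X" for x
    proof -
      obtain n :: nat where n: "(x [^]\<^bsub>R\<^esub> n) \<odot>\<^bsub>?F\<^esub> u \<in> L" using power_L[OF x] u by blast
      have "x [^]\<^bsub>R\<^esub> n \<in> carrier R" using x X by auto
      then show ?thesis using \<Psi>L[OF n] module_hom_smult[OF \<Psi>(1) _ u] by metis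
    qed
    then show "\<Psi> u \<in> carrier ?T" using module_hom_closed[OF \<Psi>(1) u] unfolding Tcar by blast
    show "\<Psi> (u \<oplus>\<^bsub>?F\<^esub> v) = \<Psi> u \<oplus>\<^bsub>?T\<^esub> \<Psi> v" if "v \<in> carrier ?F" for v
      unfolding Tsel by (rule module_hom_add[OF \<Psi>(1) u that])
    show "\<Psi> (r \<odot>\<^bsub>?F\<^esub> u) = r \<odot>\<^bsub>?T\<^esub> \<Psi> u" if "r \<in> carrier R" for r
      unfolding Tsel by (rule module_hom_smult[OF \<Psi>(1) that u])
  qed
  then show "\<exists>g\<in>module_hom R ?F ?T. \<forall>x\<in>K. g x = f x" using \<Psi>K by blast
qed

section \<open>Complexes of injective torsion modules\<close>

text \<open>For the torsion parts \<open>G\<close> of an injective resolution, the cohomology of \<open>G\<close> and of its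
  annihilated part \<open>(0 :\<^sub>G I)\<close> are local cohomology and \<open>Ext(R / I, -)\<close>.\<close>

locale torsion_complex =
  fixes R :: "('a, 'r) ring_scheme" and X :: "'a set" and G :: "nat \<Rightarrow> ('a, 'u) module"
    and d :: "nat \<Rightarrow> 'u \<Rightarrow> 'u"
  assumes cring: "cring R" and noetherian: "noetherian_ring R"
    and X: "finite X" "X \<subseteq> carrier R"
    and G: "\<And>n. module R (G n)"
    and d: "\<And>n. d n \<in> module_hom R (G n) (G (Suc n))"
    and dd: "\<And>n x. x \<in> carrier (G n) \<Longrightarrow> d (Suc n) (d n x) = \<zero>\<^bsub>G (Suc (Suc n))\<^esub>"
    and trivial: "\<And>n. ext_trivial R (G n)"
    and torsion: "\<And>n x y. x \<in> X \<Longrightarrow> y \<in> carrier (G n) \<Longrightarrow> \<exists>k::nat. (x [^]\<^bsub>R\<^esub> k) \<odot>\<^bsub>G n\<^esub> y = \<zero>\<^bsub>G n\<^esub>"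
begin

abbreviation "I \<equiv> genideal R X"

definition "Z n = {x \<in> carrier (G n). d n x = \<zero>\<^bsub>G (Suc n)\<^esub>}"

definition "B n = (case n of 0 \<Rightarrow> {\<zero>\<^bsub>G 0\<^esub>} | Suc m \<Rightarrow> d m ` carrier (G m))"

definition "annihilated n = {x \<in> carrier (G n). \<forall>r\<in>I. r \<odot>\<^bsub>G n\<^esub> x = \<zero>\<^bsub>G n\<^esub>}"

definition "ZI n = {x \<in> annihilated n. d n x = \<zero>\<^bsub>G (Suc n)\<^esub>}"

text \<open>In general smaller than \<open>annihilated n \<inter> B n\<close>: a coboundary killed
  by \<open>I\<close> need not come from an element killed by \<open>I\<close>.\<close>

definition "BI n = (case n of 0 \<Rightarrow> {\<zero>\<^bsub>G 0\<^esub>} | Suc m \<Rightarrow> d m ` annihilated m)"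

lemma ideal_I: "ideal I R"
  using cring.axioms(1)[OF cring] X(2) by (rule ring.genideal_ideal)

lemma I_subset: "I \<subseteq> carrier R"
  using ideal.Icarr[OF ideal_I] by blast

lemma submodule_Z: "submodule (Z n) R (G n)"
  unfolding Z_def by (rule submodule_a_kernel[OF G G d])

lemma submodule_B: "submodule (B n) R (G n)"
proof (cases n)
  case 0
  then show ?thesis using module.submodule_zero_singleton[OF G[of 0]] by (simp add: B_def)
next
  case (Suc m)
  then show ?thesis
    using submodule_image[OF G G d module.carrier_is_submodule[OF G[of m]]] by (simp add: B_def)
qed

lemma submodule_annihilated: "submodule (annihilated n) R (G n)"
  unfolding annihilated_def
  using submodule_transporter[OF G[of n] module.carrier_is_submodule[OF G[of n]]
      module.submodule_zero_singleton[OF G[of n]] I_subset]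
  by simp

lemma submodule_ZI: "submodule (ZI n) R (G n)"
proof -
  have "ZI n = annihilated n \<inter> Z n" by (auto simp: ZI_def Z_def annihilated_def)
  then show ?thesis using module.submodule_Int[OF G submodule_annihilated submodule_Z] by simp
qed

lemma submodule_BI: "submodule (BI n) R (G n)"
proof (cases n)
  case 0
  then show ?thesis using module.submodule_zero_singleton[OF G[of 0]] by (simp add: BI_def)
next
  case (Suc m)
  then show ?thesis
    using submodule_image[OF G G d submodule_annihilated[of m]] by (simp add: BI_def)
qed

lemma B_subset_Z: "B n \<subseteq> Z n"
proof (cases n)
  case 0
  then show ?thesis
    using submodule_zero[OF submodule_Z[of 0]] by (simp add: B_def)
next
  case (Suc m)
  then show ?thesis using dd[of _ m] module_hom_closed[OF d[of m]] by (auto simp: B_def Z_def)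
qed

lemma BI_subset_annihilated: "BI n \<subseteq> annihilated n"
proof (cases n)
  case 0
  then show ?thesis using submodule_zero[OF submodule_annihilated[of 0]] by (simp add: BI_def)
next
  case (Suc m)
  have "d m x \<in> annihilated (Suc m)" if x: "x \<in> annihilated m" for x
  proof -
    have xc: "x \<in> carrier (G m)" using x by (simp add: annihilated_def)
    have "r \<odot>\<^bsub>G (Suc m)\<^esub> d m x = \<zero>\<^bsub>G (Suc m)\<^esub>" if r: "r \<in> I" for r
    proof -
      have "r \<odot>\<^bsub>G m\<^esub> x = \<zero>\<^bsub>G m\<^esub>" using x r by (simp add: annihilated_def)
      then show ?thesis
        using module_hom_smult[OF d[of m], of r x] module_hom_zero[OF d[of m] G G] r I_subset xc by auto
    qed
    then show ?thesis using module_hom_closed[OF d xc] by (simp add: annihilated_def)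
  qed
  then show ?thesis using Suc by (auto simp: BI_def)
qed

lemma BI_subset_B: "BI n \<subseteq> B n"
  by (cases n) (auto simp: B_def BI_def annihilated_def)

lemma ZI_eq: "ZI n = {z \<in> Z n. \<forall>r\<in>I. r \<odot>\<^bsub>G n\<^esub> z = \<zero>\<^bsub>G n\<^esub>}"
  by (auto simp: ZI_def Z_def annihilated_def)

text \<open>What degree \<open>n\<close> has to know about the lower degrees. The first condition
  controls which cohomology classes killed by \<open>I\<close> have representatives killed by
  \<open>I\<close>; the second bounds the gap between the coboundaries killed by \<open>I\<close>
  and the coboundaries of the annihilated complex.\<close>

definition "boundary_artinian n \<longleftrightarrow> ext_artinian R (G n) (B n) \<and>
  artinian_between R (G n) (annihilated n \<inter> B n) (BI n)"

lemma boundary_artinian_0: "boundary_artinian 0"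
proof -
  have "annihilated 0 \<inter> B 0 \<subseteq> BI 0" by (auto simp: B_def BI_def)
  then show ?thesis
    unfolding boundary_artinian_def
    using ext_artinian_zero[OF G[of 0]] artinian_between_mono[OF artinian_between_refl order_refl]
    by (simp add: B_def)
qed

text \<open>\<open>Z n\<close> is an extension of the Artinian cohomology by \<open>B n\<close>, so
  it inherits the condition on extension groups. Being the kernel of \<open>d n\<close>, it passes
  the condition on to the image of \<open>d n\<close>, and for \<open>R/I\<close> it also controls
  the coboundaries killed by \<open>I\<close>.\<close>

lemma boundary_artinian_Suc:
  assumes "boundary_artinian n" "artinian_between R (G n) (Z n) (B n)"
  shows "boundary_artinian (Suc n)"
proof -
  have extZ: "ext_artinian R (G n) (Z n)"
    using assms by (intro ext_artinian_extension[OF cring noetherian G submodule_B B_subset_Z submodule_Z])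
      (auto simp: boundary_artinian_def)
  have "annihilated (Suc n) \<inter> B (Suc n) = {y \<in> d n ` carrier (G n). \<forall>r\<in>I. r \<odot>\<^bsub>G (Suc n)\<^esub> y = \<zero>\<^bsub>G (Suc n)\<^esub>}"
    using module_hom_closed[OF d] by (auto simp: annihilated_def B_def)
  then show ?thesis
    unfolding boundary_artinian_def
    using ext_artinian_shift[OF cring noetherian G G d trivial extZ[unfolded Z_def]]
      cring.artinian_between_annihilator_image[OF cring G G d ideal_I extZ[unfolded Z_def]]
    by (simp add: B_def BI_def annihilated_def)
qed

lemma artinian_cohomology_iff:
  assumes "boundary_artinian n"
  shows "artinian_between R (G n) (Z n) (B n) \<longleftrightarrow> artinian_between R (G n) (ZI n) (BI n)"
proof
  interpret module R "G n" by (rule G)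
  have ext: "ext_artinian R (G n) (B n)" and art: "artinian_between R (G n) (annihilated n \<inter> B n) (BI n)"
    using assms by (auto simp: boundary_artinian_def)
  have BI: "BI n \<subseteq> annihilated n \<inter> B n" using BI_subset_annihilated BI_subset_B by blast
  have sub: "annihilated n \<inter> B n \<subseteq> ZI n" using B_subset_Z by (auto simp: ZI_def Z_def)
  note smAB = submodule_Int[OF submodule_annihilated submodule_B]
  have ZI_Z: "ZI n \<subseteq> Z n" by (auto simp: ZI_eq)
  {
    assume "artinian_between R (G n) (Z n) (B n)"
    \<comment> \<open>The cocycles killed by \<open>I\<close> map to the cohomology with kernel
      \<open>annihilated n \<inter> B n\<close>; the hypothesis \<open>boundary_artinian\<close>
      fills the gap from there down to \<open>BI n\<close>.\<close>
    then have "artinian_between R (G n) (ZI n) (annihilated n \<inter> B n)"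
      by (rule artinian_between_rel[OF G G submodule_Z submodule_B B_subset_Z smAB, rotated 5,
            where \<rho> = "\<lambda>x y. x = y \<and> x \<in> carrier (G n)"])
        (use submodule_mem[OF submodule_Z] ZI_Z in \<open>auto simp: ZI_def\<close>)
    then show "artinian_between R (G n) (ZI n) (BI n)"
      by (rule artinian_between_trans[OF smAB BI sub submodule_ZI _ art])
  next
    assume a: "artinian_between R (G n) (ZI n) (BI n)"
    \<comment> \<open>Modulo \<open>B n\<close>, this is the part of the cohomology killed by
      \<open>I\<close>. It is Artinian because \<open>(ZI n + B n) / B n\<close> is a quotient of
      \<open>ZI n / BI n\<close> and the factor above it embeds into
      \<open>Ext^1(R/I, B n)\<close>.\<close>
    let ?T = "{z \<in> Z n. \<forall>r\<in>I. r \<odot>\<^bsub>G n\<^esub> z \<in> B n}"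
    have T: "submodule ?T R (G n)" by (rule submodule_transporter[OF G submodule_Z submodule_B I_subset])
    have ZIB: "submodule (ZI n <+>\<^bsub>G n\<^esub> B n) R (G n)" by (rule submodule_set_add[OF submodule_ZI submodule_B])
    have 1: "artinian_between R (G n) (ZI n <+>\<^bsub>G n\<^esub> B n) (B n)"
      by (rule artinian_between_set_add[OF submodule_ZI submodule_BI _ BI_subset_B submodule_B a])
        (use BI sub in blast)
    have 2: "artinian_between R (G n) ?T (ZI n <+>\<^bsub>G n\<^esub> B n)"
      using cring.artinian_between_transporter[OF cring G ideal_I submodule_B B_subset_Z submodule_Z ext]
      by (simp add: ZI_eq)
    have BT: "B n \<subseteq> ?T" using B_subset_Z submodule_smult[OF submodule_B] I_subset by blast
    have "ZI n \<subseteq> ?T" using submodule_zero[OF submodule_B[of n]] by (auto simp: ZI_eq)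
    then have "artinian_between R (G n) ?T (B n)"
      using artinian_between_trans[OF ZIB set_add_upper2[OF submodule_ZI submodule_B]
          set_add_least[OF T _ BT] T 2 1] by blast
    moreover have "?T = {z \<in> Z n. \<forall>x\<in>X. x \<odot>\<^bsub>G n\<^esub> z \<in> B n}"
      using genideal_transporter[OF submodule_B submodule_mem[OF submodule_Z] X(2)]
        ring.genideal_self[OF cring.axioms(1)[OF cring] X(2)] by blast
    ultimately have 3: "artinian_between R (G n) {z \<in> Z n. \<forall>x\<in>X. x \<odot>\<^bsub>G n\<^esub> z \<in> B n} (B n)" by simp
    show "artinian_between R (G n) (Z n) (B n)"
    proof (rule artinian_between_torsion_finite[OF G submodule_B B_subset_Z submodule_Z X _ 3])
      fix x z assume "x \<in> X" "z \<in> Z n"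
      then show "\<exists>k::nat. (x [^]\<^bsub>R\<^esub> k) \<odot>\<^bsub>G n\<^esub> z \<in> B n"
        using torsion[of x z n] submodule_mem[OF submodule_Z] submodule_zero[OF submodule_B[of n]] by metis
    qed
  }
qed

text \<open>The comparison in degree \<open>t\<close> uses \<open>boundary_artinian t\<close>, which
  rests only on the degrees below \<open>t\<close>, where the induction hypothesis makes the two
  conditions interchangeable.\<close>

theorem artinian_cohomology_all_iff:
  "(\<forall>i<t. artinian_between R (G i) (Z i) (B i)) \<longleftrightarrow> (\<forall>i<t. artinian_between R (G i) (ZI i) (BI i))"
proof (induction t)
  case (Suc t)
  have "boundary_artinian n" if "n \<le> t" "\<forall>i<t. artinian_between R (G i) (Z i) (B i)" for n
    using that by (induction n) (auto intro: boundary_artinian_0 boundary_artinian_Suc)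
  then show ?case using Suc artinian_cohomology_iff[of t] by (auto simp: less_Suc_eq)
qed simp

end

section \<open>Quotient modules\<close>

text \<open>The module axioms are inherited along a surjection compatible with the operations; this
  serves both quotients and copies of modules.\<close>

lemma module_homomorphic_image:
  assumes M: "module R M" and car: "carrier Q = h ` carrier M"
    and add: "\<And>x y. x \<in> carrier M \<Longrightarrow> y \<in> carrier M \<Longrightarrow> h x \<oplus>\<^bsub>Q\<^esub> h y = h (x \<oplus>\<^bsub>M\<^esub> y)"
    and smult: "\<And>r x. r \<in> carrier R \<Longrightarrow> x \<in> carrier M \<Longrightarrow> r \<odot>\<^bsub>Q\<^esub> h x = h (r \<odot>\<^bsub>M\<^esub> x)"
    and zero: "\<zero>\<^bsub>Q\<^esub> = h \<zero>\<^bsub>M\<^esub>"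
  shows "module R Q"
proof -
  interpret M: module R M by fact
  show ?thesis
  proof (rule moduleI)
    show "abelian_group Q"
    proof (rule abelian_groupI)
      fix a assume "a \<in> carrier Q"
      then obtain x where x: "x \<in> carrier M" "a = h x" using car by blast
      show "\<zero>\<^bsub>Q\<^esub> \<oplus>\<^bsub>Q\<^esub> a = a" using x by (simp add: zero add)
      have "h (\<ominus>\<^bsub>M\<^esub> x) \<oplus>\<^bsub>Q\<^esub> a = \<zero>\<^bsub>Q\<^esub>" using x by (simp add: zero add M.M.l_neg)
      then show "\<exists>b\<in>carrier Q. b \<oplus>\<^bsub>Q\<^esub> a = \<zero>\<^bsub>Q\<^esub>" using x car by blast
      fix b assume "b \<in> carrier Q"
      then obtain y where y: "y \<in> carrier M" "b = h y" using car by blast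
      show "a \<oplus>\<^bsub>Q\<^esub> b \<in> carrier Q" "a \<oplus>\<^bsub>Q\<^esub> b = b \<oplus>\<^bsub>Q\<^esub> a"
        using x y by (auto simp: add car M.M.a_comm)
      fix c assume "c \<in> carrier Q"
      then obtain z where z: "z \<in> carrier M" "c = h z" using car by blast
      show "a \<oplus>\<^bsub>Q\<^esub> b \<oplus>\<^bsub>Q\<^esub> c = a \<oplus>\<^bsub>Q\<^esub> (b \<oplus>\<^bsub>Q\<^esub> c)"
        using x y z by (simp add: add M.M.a_assoc)
    qed (auto simp: zero car)
  qed (auto simp: M.is_cring car add smult M.smult_l_distr M.smult_r_distr M.smult_assoc1)
qed

lemma quotient_module_sel [simp]:
  "carrier (quotient_module M N) = (\<lambda>x. N +>\<^bsub>M\<^esub> x) ` carrier M"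
  "\<zero>\<^bsub>quotient_module M N\<^esub> = N"
  "C \<oplus>\<^bsub>quotient_module M N\<^esub> D = C <+>\<^bsub>M\<^esub> D"
  "r \<odot>\<^bsub>quotient_module M N\<^esub> C = (\<Union>x\<in>C. N +>\<^bsub>M\<^esub> (r \<odot>\<^bsub>M\<^esub> x))"
  by (auto simp: quotient_module_def A_RCOSETS_def')

context
  fixes R :: "('a, 'r) ring_scheme" and M :: "('a, 'b) module" and N :: "'b set"
  assumes M: "module R M" and N: "submodule N R M"
begin

interpretation module R M by (rule M)

interpretation abelian_subgroup N M
  by (rule abelian_subgroupI3)
    (use submodule.axioms(1)[OF N] in \<open>auto intro: additive_subgroupI M.abelian_group_axioms\<close>)

lemma coset_eq_iff:
  assumes "x \<in> carrier M" "y \<in> carrier M"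
  shows "N +>\<^bsub>M\<^esub> x = N +>\<^bsub>M\<^esub> y \<longleftrightarrow> x \<ominus>\<^bsub>M\<^esub> y \<in> N"
proof
  assume "N +>\<^bsub>M\<^esub> x = N +>\<^bsub>M\<^esub> y"
  then have "x \<in> N +>\<^bsub>M\<^esub> y" using a_rcos_self[OF assms(1)] by simp
  then show "x \<ominus>\<^bsub>M\<^esub> y \<in> N" using a_rcos_module[OF assms(2,1)] by (simp add: M.minus_eq)
next
  assume "x \<ominus>\<^bsub>M\<^esub> y \<in> N"
  then have "x \<in> N +>\<^bsub>M\<^esub> y" using a_rcos_module[OF assms(2,1)] by (simp add: M.minus_eq)
  then show "N +>\<^bsub>M\<^esub> x = N +>\<^bsub>M\<^esub> y" using a_repr_independence' assms by metis
qed

lemma coset_smult: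
  assumes r: "r \<in> carrier R" and x: "x \<in> carrier M"
  shows "r \<odot>\<^bsub>quotient_module M N\<^esub> (N +>\<^bsub>M\<^esub> x) = N +>\<^bsub>M\<^esub> (r \<odot>\<^bsub>M\<^esub> x)"
proof -
  have "N +>\<^bsub>M\<^esub> (r \<odot>\<^bsub>M\<^esub> y) = N +>\<^bsub>M\<^esub> (r \<odot>\<^bsub>M\<^esub> x)" if y: "y \<in> N +>\<^bsub>M\<^esub> x" for y
  proof -
    have yc: "y \<in> carrier M" by (rule a_elemrcos_carrier[OF x y])
    have "y \<ominus>\<^bsub>M\<^esub> x \<in> N" using y a_rcos_module[OF x yc] by (simp add: M.minus_eq)
    then have "r \<odot>\<^bsub>M\<^esub> y \<ominus>\<^bsub>M\<^esub> r \<odot>\<^bsub>M\<^esub> x \<in> N"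
      using submodule_smult[OF N r] smult_minus[OF r yc x] by metis
    then show ?thesis using coset_eq_iff r x yc by simp
  qed
  \<comment> \<open>Scalar multiplication on the quotient is defined as a union over
    representatives. All its members are the same coset, and there is at least one because the coset
    contains \<open>x\<close>.\<close>
  then have "(\<Union>y\<in>N +>\<^bsub>M\<^esub> x. N +>\<^bsub>M\<^esub> (r \<odot>\<^bsub>M\<^esub> y)) = (\<Union>y\<in>N +>\<^bsub>M\<^esub> x. N +>\<^bsub>M\<^esub> (r \<odot>\<^bsub>M\<^esub> x))"
    by (rule SUP_cong[OF refl])
  also have "\<dots> = N +>\<^bsub>M\<^esub> (r \<odot>\<^bsub>M\<^esub> x)"
    using a_rcos_self[OF x] unfolding UN_constant by (metis empty_iff)
  finally show ?thesis by simp
qed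

lemma coset_add:
  assumes "x \<in> carrier M" "y \<in> carrier M"
  shows "(N +>\<^bsub>M\<^esub> x) \<oplus>\<^bsub>quotient_module M N\<^esub> (N +>\<^bsub>M\<^esub> y) = N +>\<^bsub>M\<^esub> (x \<oplus>\<^bsub>M\<^esub> y)"
  using a_rcos_sum[OF assms] by simp

lemma coset_zero: "N +>\<^bsub>M\<^esub> \<zero>\<^bsub>M\<^esub> = N"
  using submodule_subset[OF N] by simp

lemma coset_eq_zero_iff:
  assumes "x \<in> carrier M"
  shows "N +>\<^bsub>M\<^esub> x = N \<longleftrightarrow> x \<in> N"
proof -
  have "x \<ominus>\<^bsub>M\<^esub> \<zero>\<^bsub>M\<^esub> = x" using minus_add_cancel[OF assms M.zero_closed] assms by simp
  then show ?thesis using coset_eq_iff[OF assms M.zero_closed] coset_zero by simp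
qed

lemma module_quotient_module: "module R (quotient_module M N)"
  by (rule module_homomorphic_image[OF M, where h = "\<lambda>x. N +>\<^bsub>M\<^esub> x"])
    (auto simp: coset_add coset_smult coset_zero simp del: quotient_module_sel(3,4))

lemma quotient_module_hom: "(\<lambda>x. N +>\<^bsub>M\<^esub> x) \<in> module_hom R M (quotient_module M N)"
  by (rule module_homI) (auto simp: coset_add coset_smult simp del: quotient_module_sel(3,4))

end

lemma artinian_module_iff:
  "artinian_module R M \<longleftrightarrow> module R M \<and> artinian_between R M (carrier M) {\<zero>\<^bsub>M\<^esub>}"
proof -
  have "(submodule N R M \<and> {\<zero>\<^bsub>M\<^esub>} \<subseteq> N \<and> N \<subseteq> carrier M) = submodule N R M" for N
    using submodule_zero[of N R M] submodule_subset[of N R M] by blast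
  then show ?thesis unfolding artinian_module_def artinian_between_def by simp
qed

text \<open>The graph of the projection relates \<open>M\<close> to its quotient and the converse
  relates the quotient to \<open>M\<close>; \<open>artinian_between_rel\<close> applies to
  both.\<close>

lemma artinian_quotient_module_iff:
  assumes M: "module R M" and N: "submodule N R M"
  shows "artinian_module R (quotient_module M N) \<longleftrightarrow> artinian_between R M (carrier M) N"
proof -
  let ?Q = "quotient_module M N" and ?\<pi> = "\<lambda>x. N +>\<^bsub>M\<^esub> x"
  note Q = module_quotient_module[OF M N] and \<pi> = quotient_module_hom[OF M N]
  interpret M: module R M by fact
  interpret Q: module R ?Q by fact
  have car: "\<And>x. x \<in> carrier M \<Longrightarrow> ?\<pi> x \<in> carrier ?Q" by simp
  have N_sub: "N \<subseteq> carrier M" by (rule submodule_subset[OF N])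
  have "artinian_between R ?Q (carrier ?Q) {\<zero>\<^bsub>?Q\<^esub>} \<longleftrightarrow> artinian_between R M (carrier M) N"
  proof
    assume a: "artinian_between R ?Q (carrier ?Q) {\<zero>\<^bsub>?Q\<^esub>}"
    show "artinian_between R M (carrier M) N"
      by (rule artinian_between_rel[OF M Q Q.carrier_is_submodule Q.submodule_zero_singleton _ N _ _ _ _ _ a,
            where \<rho> = "\<lambda>x y. x \<in> carrier M \<and> y = ?\<pi> x"])
        (use car Q.M.zero_closed module_homD[OF \<pi>] coset_eq_zero_iff[OF M N] in
          \<open>auto simp del: quotient_module_sel(3,4)\<close>)
  next
    assume a: "artinian_between R M (carrier M) N"
    show "artinian_between R ?Q (carrier ?Q) {\<zero>\<^bsub>?Q\<^esub>}"
      by (rule artinian_between_rel[OF Q M M.carrier_is_submodule N N_sub Q.submodule_zero_singleton _ _ _ _ _ a,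
            where \<rho> = "\<lambda>y x. x \<in> carrier M \<and> y = ?\<pi> x"])
        (use car module_homD[OF \<pi>] coset_eq_zero_iff[OF M N] in \<open>auto simp del: quotient_module_sel(3,4)\<close>)
  qed
  then show ?thesis using Q unfolding artinian_module_iff by simp
qed

lemma artinian_between_restrict_carrier:
  assumes M: "module R M" and A: "submodule A R M"
  shows "artinian_between R (M\<lparr>carrier := A\<rparr>) A B \<longleftrightarrow> artinian_between R M A B"
  unfolding artinian_between_def module.submodule_restrict_iff[OF M A] by blast

lemma a_kernel_eq: "a_kernel G H h = {x \<in> carrier G. h x = \<zero>\<^bsub>H\<^esub>}"
  by (simp add: a_kernel_def kernel_def)

lemma artinian_subquotient_iff:
  assumes M: "module R M" and Z: "submodule Z R M" and B: "submodule B R M" "B \<subseteq> Z"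
  shows "artinian_module R (quotient_module (M\<lparr>carrier := Z\<rparr>) B) \<longleftrightarrow> artinian_between R M Z B"
proof -
  have "submodule B R (M\<lparr>carrier := Z\<rparr>)"
    using B module.submodule_restrict_iff[OF M Z] by blast
  from artinian_quotient_module_iff[OF module.module_submodule[OF M Z] this] show ?thesis
    by (simp add: artinian_between_restrict_carrier[OF M Z])
qed

section \<open>Homomorphisms out of \<open>R / I\<close>\<close>

lemma regular_module_sel [simp]:
  "carrier (regular_module R) = carrier R" "\<zero>\<^bsub>regular_module R\<^esub> = \<zero>\<^bsub>R\<^esub>"
  "x \<oplus>\<^bsub>regular_module R\<^esub> y = x \<oplus>\<^bsub>R\<^esub> y" "r \<odot>\<^bsub>regular_module R\<^esub> x = r \<otimes>\<^bsub>R\<^esub> x"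
  by (simp_all add: regular_module_def)

lemma (in cring) module_regular_module: "module R (regular_module R)"
proof (rule moduleI)
  show "abelian_group (regular_module R)"
  proof (rule abelian_groupI)
    fix x assume "x \<in> carrier (regular_module R)"
    then show "\<exists>y\<in>carrier (regular_module R). y \<oplus>\<^bsub>regular_module R\<^esub> x = \<zero>\<^bsub>regular_module R\<^esub>"
      by (intro bexI[of _ "\<ominus> x"]) (simp_all add: l_neg)
  qed (auto simp: a_ac)
qed (auto simp: is_cring l_distr r_distr m_assoc)

lemma (in cring) submodule_regular_module_iff: "submodule I R (regular_module R) \<longleftrightarrow> ideal I R"
proof
  interpret M: module R "regular_module R" by (rule module_regular_module)
  show "submodule I R (regular_module R)" if I: "ideal I R"
  proof -
    interpret ideal I R by fact
    show ?thesis
      by (rule M.submoduleI') (auto simp: I_l_closed dest: a_subset[THEN subsetD])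
  qed
  show "ideal I R" if I: "submodule I R (regular_module R)"
    by (rule ideal_of_subset)
      (use submodule_subset[OF I] submodule_zero[OF I] submodule_add[OF I] submodule_smult[OF I] in auto)
qed

context
  fixes R :: "('a, 'r) ring_scheme" and I :: "'a set"
begin

definition "cyclic_module = quotient_module (regular_module R) I"

definition "cyclic_gen = I +>\<^bsub>regular_module R\<^esub> \<one>\<^bsub>R\<^esub>"

context
  assumes R: "cring R" and I: "ideal I R"
begin

interpretation cring R by (rule R)

lemmas ideal_submodule_regular = submodule_regular_module_iff[THEN iffD2, OF I]

lemma module_cyclic_module: "module R cyclic_module"
  unfolding cyclic_module_def by (rule module_quotient_module[OF module_regular_module ideal_submodule_regular])

interpretation RI: module R cyclic_module by (rule module_cyclic_module)

lemma cyclic_gen_closed: "cyclic_gen \<in> carrier cyclic_module"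
  by (simp add: cyclic_gen_def cyclic_module_def)

lemma coset_eq_smult_cyclic_gen: "s \<in> carrier R \<Longrightarrow> I +>\<^bsub>regular_module R\<^esub> s = s \<odot>\<^bsub>cyclic_module\<^esub> cyclic_gen"
  unfolding cyclic_module_def cyclic_gen_def
  using coset_smult[OF module_regular_module ideal_submodule_regular, of s "\<one>\<^bsub>R\<^esub>"] by simp

lemma carrier_cyclic_module: "carrier cyclic_module = (\<lambda>s. s \<odot>\<^bsub>cyclic_module\<^esub> cyclic_gen) ` carrier R"
proof -
  have "carrier cyclic_module = (\<lambda>s. I +>\<^bsub>regular_module R\<^esub> s) ` carrier R" by (simp add: cyclic_module_def)
  then show ?thesis using coset_eq_smult_cyclic_gen by (simp cong: image_cong_simp)
qed

lemma smult_cyclic_gen_eq_iff: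
  "s \<in> carrier R \<Longrightarrow> s' \<in> carrier R \<Longrightarrow> s \<odot>\<^bsub>cyclic_module\<^esub> cyclic_gen = s' \<odot>\<^bsub>cyclic_module\<^esub> cyclic_gen \<longleftrightarrow> s \<ominus>\<^bsub>regular_module R\<^esub> s' \<in> I"
  using coset_eq_iff[OF module_regular_module ideal_submodule_regular, of s s'] by (simp add: coset_eq_smult_cyclic_gen)

lemma smult_cyclic_gen_eq_zero:
  assumes "r \<in> I" shows "r \<odot>\<^bsub>cyclic_module\<^esub> cyclic_gen = \<zero>\<^bsub>cyclic_module\<^esub>"
  using coset_eq_zero_iff[OF module_regular_module ideal_submodule_regular, of r] coset_eq_smult_cyclic_gen[of r] assms
    ideal.Icarr[OF I assms] by (simp add: cyclic_module_def)

end

end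

context
  fixes R :: "('a, 'r) ring_scheme" and I :: "'a set" and M :: "('a, 'b) module"
  assumes R: "cring R" and I: "ideal I R" and M: "module R M"
begin

interpretation cring R by (rule R)
interpretation M: module R M by (rule M)
interpretation RI: module R "cyclic_module R I" by (rule module_cyclic_module[OF R I])

lemma hom_cyclic_module_eqI:
  assumes "f \<in> carrier (hom_module R (cyclic_module R I) M)" "g \<in> carrier (hom_module R (cyclic_module R I) M)" "f (cyclic_gen R I) = g (cyclic_gen R I)"
  shows "f = g"
proof (rule extensionalityI[of _ "carrier (cyclic_module R I)"])
  have f: "f \<in> module_hom R (cyclic_module R I) M" and g: "g \<in> module_hom R (cyclic_module R I) M" using assms by auto
  fix c assume "c \<in> carrier (cyclic_module R I)"
  then obtain s where "s \<in> carrier R" "c = s \<odot>\<^bsub>cyclic_module R I\<^esub> (cyclic_gen R I)" using carrier_cyclic_module[OF R I] by blast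
  then show "f c = g c"
    using module_hom_smult[OF f _ cyclic_gen_closed[OF R I]] module_hom_smult[OF g _ cyclic_gen_closed[OF R I]] assms(3) by simp
qed (use assms in auto)

lemma hom_cyclic_module_annihilated:
  assumes "f \<in> carrier (hom_module R (cyclic_module R I) M)"
  shows "f (cyclic_gen R I) \<in> carrier M" "r \<in> I \<Longrightarrow> r \<odot>\<^bsub>M\<^esub> f (cyclic_gen R I) = \<zero>\<^bsub>M\<^esub>"
proof -
  have f: "f \<in> module_hom R (cyclic_module R I) M" using assms by simp
  show "f (cyclic_gen R I) \<in> carrier M" by (rule module_hom_closed[OF f cyclic_gen_closed[OF R I]])
  show "r \<odot>\<^bsub>M\<^esub> f (cyclic_gen R I) = \<zero>\<^bsub>M\<^esub>" if "r \<in> I"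
    using module_hom_smult[OF f _ cyclic_gen_closed[OF R I], of r] smult_cyclic_gen_eq_zero[OF R I that] ideal.Icarr[OF I that]
      module_hom_zero[OF f module_cyclic_module[OF R I] M] by simp
qed

text \<open>The class of \<open>s\<close> is sent to \<open>s y\<close>; two representatives of a
  class differ by an element of \<open>I\<close>, which kills \<open>y\<close>.\<close>

lemma hom_cyclic_module_exists:
  assumes y: "y \<in> carrier M" and kill: "\<And>r. r \<in> I \<Longrightarrow> r \<odot>\<^bsub>M\<^esub> y = \<zero>\<^bsub>M\<^esub>"
  obtains f where "f \<in> carrier (hom_module R (cyclic_module R I) M)" "f (cyclic_gen R I) = y"
proof -
  interpret RR: module R "regular_module R" by (rule module_regular_module)
  define s where "s c = (SOME s. s \<in> carrier R \<and> c = s \<odot>\<^bsub>cyclic_module R I\<^esub> (cyclic_gen R I))" for c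
  have s: "s c \<in> carrier R \<and> c = s c \<odot>\<^bsub>cyclic_module R I\<^esub> (cyclic_gen R I)" if c: "c \<in> carrier (cyclic_module R I)" for c
    unfolding s_def by (rule someI_ex) (use c carrier_cyclic_module[OF R I] in blast)
  define f where "f c = s c \<odot>\<^bsub>M\<^esub> y" for c
  have f: "f (r \<odot>\<^bsub>cyclic_module R I\<^esub> (cyclic_gen R I)) = r \<odot>\<^bsub>M\<^esub> y" if r: "r \<in> carrier R" for r
  proof -
    let ?s = "s (r \<odot>\<^bsub>cyclic_module R I\<^esub> (cyclic_gen R I))"
    have sc: "?s \<in> carrier R" "r \<odot>\<^bsub>cyclic_module R I\<^esub> (cyclic_gen R I) = ?s \<odot>\<^bsub>cyclic_module R I\<^esub> (cyclic_gen R I)" using s[of "r \<odot>\<^bsub>cyclic_module R I\<^esub> (cyclic_gen R I)"] r cyclic_gen_closed[OF R I] by auto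
    let ?t = "?s \<ominus>\<^bsub>regular_module R\<^esub> r"
    have t: "?t \<in> I" using smult_cyclic_gen_eq_iff[OF R I sc(1) r] sc(2) by simp
    have "?s = r \<oplus>\<^bsub>R\<^esub> ?t" using RR.minus_add_cancel[of ?s r] sc r by simp
    then have "?s \<odot>\<^bsub>M\<^esub> y = r \<odot>\<^bsub>M\<^esub> y \<oplus>\<^bsub>M\<^esub> ?t \<odot>\<^bsub>M\<^esub> y"
      using M.smult_l_distr[OF r ideal.Icarr[OF I t] y] by simp
    then show ?thesis using kill[OF t] r y by (simp add: f_def)
  qed
  have "f \<in> module_hom R (cyclic_module R I) M"
  proof (rule module_homI)
    fix c assume "c \<in> carrier (cyclic_module R I)"
    then obtain r where r: "r \<in> carrier R" "c = r \<odot>\<^bsub>cyclic_module R I\<^esub> (cyclic_gen R I)" using carrier_cyclic_module[OF R I] by blast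
    show "f c \<in> carrier M" using f r y by simp
    show "f (r' \<odot>\<^bsub>cyclic_module R I\<^esub> c) = r' \<odot>\<^bsub>M\<^esub> f c" if r': "r' \<in> carrier R" for r'
      using f[of "r' \<otimes>\<^bsub>R\<^esub> r"] f[of r] r r' y RI.smult_assoc1[OF r' r(1) cyclic_gen_closed[OF R I]]
      by (simp add: M.smult_assoc1)
    show "f (c \<oplus>\<^bsub>cyclic_module R I\<^esub> c') = f c \<oplus>\<^bsub>M\<^esub> f c'" if c': "c' \<in> carrier (cyclic_module R I)" for c'
    proof -
      obtain r' where r': "r' \<in> carrier R" "c' = r' \<odot>\<^bsub>cyclic_module R I\<^esub> (cyclic_gen R I)" using c' carrier_cyclic_module[OF R I] by blast
      show ?thesis
        using f[of "r \<oplus>\<^bsub>R\<^esub> r'"] f[of r] f[of r'] r r' y RI.smult_l_distr[OF r(1) r'(1) cyclic_gen_closed[OF R I]]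
        by (simp add: M.smult_l_distr)
    qed
  qed
  then have "restrict f (carrier (cyclic_module R I)) \<in> carrier (hom_module R (cyclic_module R I) M)"
    using restrict_module_hom[OF module_cyclic_module[OF R I], of f M] by simp
  moreover have "restrict f (carrier (cyclic_module R I)) (cyclic_gen R I) = y"
  proof -
    have "f (\<one>\<^bsub>R\<^esub> \<odot>\<^bsub>cyclic_module R I\<^esub> (cyclic_gen R I)) = \<one>\<^bsub>R\<^esub> \<odot>\<^bsub>M\<^esub> y" by (rule f) simp
    then show ?thesis using cyclic_gen_closed[OF R I] y by simp
  qed
  ultimately show ?thesis using that by blast
qed

end

section \<open>Transport of structure\<close>

text \<open>Transport along a map that is injective on the carrier. Injectivity is tested in one
  fixed type, so free modules, coinduced modules and cokernels have to be moved there.\<close>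

definition copy_module :: "('b \<Rightarrow> 'c) \<Rightarrow> ('a, 'b) module \<Rightarrow> ('a, 'c) module" where
  "copy_module h M =
     \<lparr>carrier = h ` carrier M, monoid.mult = undefined, monoid.one = undefined, ring.zero = h \<zero>\<^bsub>M\<^esub>,
      ring.add = (\<lambda>x y. h (inv_into (carrier M) h x \<oplus>\<^bsub>M\<^esub> inv_into (carrier M) h y)),
      smult = (\<lambda>r x. h (r \<odot>\<^bsub>M\<^esub> inv_into (carrier M) h x))\<rparr>"

context
  fixes R :: "('a, 'r) ring_scheme" and M :: "('a, 'b) module" and h :: "'b \<Rightarrow> 'c"
  assumes M: "module R M" and h: "inj_on h (carrier M)"
begin

lemma copy_module_sel:
  "carrier (copy_module h M) = h ` carrier M"
  "\<zero>\<^bsub>copy_module h M\<^esub> = h \<zero>\<^bsub>M\<^esub>"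
  "x \<in> carrier M \<Longrightarrow> y \<in> carrier M \<Longrightarrow> h x \<oplus>\<^bsub>copy_module h M\<^esub> h y = h (x \<oplus>\<^bsub>M\<^esub> y)"
  "x \<in> carrier M \<Longrightarrow> r \<odot>\<^bsub>copy_module h M\<^esub> h x = h (r \<odot>\<^bsub>M\<^esub> x)"
  by (simp_all add: copy_module_def inv_into_f_f[OF h])

lemma module_copy_module: "module R (copy_module h M)"
  by (rule module_homomorphic_image[OF M, where h = h]) (simp_all add: copy_module_sel)

lemma copy_module_hom: "h \<in> module_hom R M (copy_module h M)"
  by (rule module_homI) (simp_all add: copy_module_sel)

lemma copy_module_inv_hom: "inv_into (carrier M) h \<in> module_hom R (copy_module h M) M"
proof (rule module_homI)
  interpret M: module R M by (rule M)
  fix x assume "x \<in> carrier (copy_module h M)"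
  then obtain x' where x: "x' \<in> carrier M" "x = h x'" by (auto simp: copy_module_sel)
  show "inv_into (carrier M) h x \<in> carrier M" using x by (simp add: inv_into_f_f[OF h])
  show "inv_into (carrier M) h (r \<odot>\<^bsub>copy_module h M\<^esub> x) = r \<odot>\<^bsub>M\<^esub> inv_into (carrier M) h x"
    if "r \<in> carrier R" for r
    using x that by (simp add: copy_module_sel inv_into_f_f[OF h])
  fix y assume "y \<in> carrier (copy_module h M)"
  then obtain y' where y: "y' \<in> carrier M" "y = h y'" by (auto simp: copy_module_sel)
  show "inv_into (carrier M) h (x \<oplus>\<^bsub>copy_module h M\<^esub> y) =
      inv_into (carrier M) h x \<oplus>\<^bsub>M\<^esub> inv_into (carrier M) h y"
    using x y by (simp add: copy_module_sel inv_into_f_f[OF h])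
qed

end

lemma injective_module_extend:
  fixes E A B :: "('a, 'u) module"
  assumes "injective_module R E" "module R A" "module R B" "i \<in> module_hom R A B" "inj_on i (carrier A)"
    "f \<in> module_hom R A E"
  obtains g where "g \<in> module_hom R B E" "\<And>x. x \<in> carrier A \<Longrightarrow> g (i x) = f x"
  using assms(1)[unfolded injective_module_def, THEN conjunct2, rule_format, of A B i f] assms(2-) by blast

text \<open>\<open>R^p\<close> is copied into the universe as singletons of words of length
  \<open>p\<close>. With the same encoding for \<open>K\<close>, the inclusion becomes the identity,
  and the copies form an admissible test for injectivity.\<close>

lemma injective_imp_ext_trivial:
  fixes E :: "('a, ('a, 'b) universe) module"
  assumes R: "cring R" and E: "injective_module R E"
  shows "ext_trivial R E"
  unfolding ext_trivial_def
proof (intro allI impI, elim conjE)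
  interpret R: cring R by fact
  fix p K f
  let ?F = "free_module R p"
  assume K: "submodule K R ?F" and f: "f \<in> module_hom R (?F\<lparr>carrier := K\<rparr>) E"
  note F = R.module_free_module[of p]
  interpret F: module R ?F by fact
  define h :: "(nat \<Rightarrow> 'a) \<Rightarrow> ('a, 'b) universe" where "h v = {map (\<lambda>i. Inl (v i)) [0..<p]}" for v
  have inj: "inj_on h (carrier ?F)"
  proof (rule inj_onI)
    fix v w assume v: "v \<in> carrier ?F" and w: "w \<in> carrier ?F" and "h v = h w"
    then have "map (\<lambda>i. Inl (v i) :: 'a + 'b) [0..<p] = map (\<lambda>i. Inl (w i)) [0..<p]" by (simp add: h_def)
    then have "v i = w i" if "i < p" for i using that by (auto simp: list_eq_iff_nth_eq)
    then show "v = w" using v w unfolding free_module_carrier by (metis ext not_le)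
  qed
  let ?FK = "?F\<lparr>carrier := K\<rparr>"
  note FK = F.module_submodule[OF K]
  have K_sub: "K \<subseteq> carrier ?F" by (rule submodule_subset[OF K])
  have injK: "inj_on h (carrier ?FK)" using inj K_sub by (simp add: inj_on_subset)
  let ?A = "copy_module h ?FK" and ?B = "copy_module h ?F"
  note sA = copy_module_sel[OF FK injK] and sB = copy_module_sel[OF F inj]
  have id: "id \<in> module_hom R ?A ?B"
    by (rule module_homI) (use K_sub in \<open>auto simp: copy_module_sel[OF FK injK] copy_module_sel[OF F inj] subset_iff\<close>)
  let ?g = "\<lambda>x. f (inv_into K h x)"
  have g: "?g \<in> module_hom R ?A E"
    using module_hom_compose[OF copy_module_inv_hom[OF FK injK] f] by simp
  obtain g' where g': "g' \<in> module_hom R ?B E" "\<And>x. x \<in> carrier ?A \<Longrightarrow> g' (id x) = ?g x"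
    using injective_module_extend[OF E module_copy_module[OF FK injK] module_copy_module[OF F inj] id _ g]
    by (metis inj_on_id)
  have "(\<lambda>x. g' (h x)) \<in> module_hom R ?F E"
    by (rule module_hom_compose[OF copy_module_hom[OF F inj] g'(1)])
  moreover have "g' (h x) = f x" if "x \<in> K" for x
    using g'(2)[of "h x"] that inv_into_f_f[OF injK, of x] by (simp add: copy_module_sel[OF FK injK])
  ultimately show "\<exists>g\<in>module_hom R ?F E. \<forall>x\<in>K. g x = f x"
    by (intro bexI[of _ "\<lambda>x. g' (h x)"] ballI)
qed

section \<open>Local cohomology and extension groups of a resolution\<close>

lemma artinian_cohomology_iff_between:
  assumes C: "\<And>n. module R (C n)" and d: "\<And>n. d n \<in> module_hom R (C n) (C (Suc n))"
    and dd: "\<And>n x. x \<in> carrier (C n) \<Longrightarrow> d (Suc n) (d n x) = \<zero>\<^bsub>C (Suc (Suc n))\<^esub>"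
  shows "artinian_module R (cohomology C d i) \<longleftrightarrow>
    artinian_between R (C i) {x \<in> carrier (C i). d i x = \<zero>\<^bsub>C (Suc i)\<^esub>}
      (case i of 0 \<Rightarrow> {\<zero>\<^bsub>C 0\<^esub>} | Suc j \<Rightarrow> d j ` carrier (C j))" (is "_ \<longleftrightarrow> artinian_between R _ ?Z ?B")
proof -
  note Z = submodule_a_kernel[OF C C d, of i]
  have "submodule ?B R (C i) \<and> ?B \<subseteq> ?Z"
  proof (cases i)
    case 0
    interpret M: module R "C 0" by (rule C)
    show ?thesis using 0 M.submodule_zero_singleton submodule_zero[OF Z] by simp
  next
    case (Suc j)
    then show ?thesis
      using submodule_image[OF C C d module.carrier_is_submodule[OF C], of j] module_hom_closed[OF d[of j]] dd
      by auto
  qed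
  then show ?thesis
    using artinian_subquotient_iff[OF C[of i] Z] unfolding cohomology_def a_kernel_eq by blast
qed

text \<open>Evaluation at the class of one identifies \<open>Hom(R/I, E n)\<close> with the elements
  of \<open>E n\<close> killed by \<open>I\<close>, all of which are torsion. So the Hom complex is
  the annihilated part of the torsion complex, and \<open>artinian_cohomology_all_iff\<close>
  applies.\<close>

lemma artinian_cohomology_iff:
  fixes E :: "nat \<Rightarrow> ('a, ('a, 'b) universe) module"
  assumes R: "cring R" "noetherian_ring R" and I: "ideal I R"
    and E: "\<And>n. injective_module R (E n)" and d: "\<And>n. d n \<in> module_hom R (E n) (E (Suc n))"
    and dd: "\<And>n x. x \<in> carrier (E n) \<Longrightarrow> d (Suc n) (d n x) = \<zero>\<^bsub>E (Suc (Suc n))\<^esub>"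
  shows "(\<forall>i<t. artinian_module R (cohomology (\<lambda>n. torsion_module R I (E n)) d i)) \<longleftrightarrow>
    (\<forall>i<t. artinian_module R (cohomology (\<lambda>n. hom_module R (cyclic_module R I) (E n))
      (\<lambda>n. compose (carrier (cyclic_module R I)) (d n)) i))"
proof -
  interpret R: cring R by fact
  obtain X where X: "finite X" "X \<subseteq> carrier R" "I = genideal R X"
    using noetherian_ring.finetely_gen[OF R(2) I] by blast
  have E': "module R (E n)" for n using E by (simp add: injective_module_def)
  define G where "G n = torsion_module R I (E n)" for n
  have sel: "add (G n) = add (E n)" "smult (G n) = smult (E n)" "zero (G n) = zero (E n)" for n
    by (simp_all add: G_def torsion_module_def)
  have Gcar: "carrier (G n) = {y \<in> carrier (E n). \<forall>x\<in>X. \<exists>k::nat. (x [^]\<^bsub>R\<^esub> k) \<odot>\<^bsub>E n\<^esub> y = \<zero>\<^bsub>E n\<^esub>}" for n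
    unfolding G_def X(3) by (rule carrier_torsion_module[OF E' X(1,2)])
  have GE: "x \<in> carrier (E n)" if "x \<in> carrier (G n)" for x n using that unfolding Gcar by simp
  have G: "module R (G n)" for n
    unfolding G_def torsion_module_def
    using module.module_submodule[OF E' submodule_torsion[OF E' X(2)]] Gcar[of n]
    by (simp add: G_def torsion_module_def)
  have dG: "d n \<in> module_hom R (G n) (G (Suc n))" for n
  proof (rule module_homI)
    fix x assume x: "x \<in> carrier (G n)"
    note xE = GE[OF x]
    have "\<exists>k::nat. (a [^]\<^bsub>R\<^esub> k) \<odot>\<^bsub>E (Suc n)\<^esub> d n x = \<zero>\<^bsub>E (Suc n)\<^esub>" if a: "a \<in> X" for a
    proof -
      obtain k :: nat where k: "(a [^]\<^bsub>R\<^esub> k) \<odot>\<^bsub>E n\<^esub> x = \<zero>\<^bsub>E n\<^esub>" using x a unfolding Gcar by blast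
      have "a [^]\<^bsub>R\<^esub> k \<in> carrier R" using a X(2) by auto
      then show ?thesis using k module_hom_smult[OF d _ xE] module_hom_zero[OF d E' E'] by metis
    qed
    then show "d n x \<in> carrier (G (Suc n))" using module_hom_closed[OF d xE] unfolding Gcar by blast
    show "d n (x \<oplus>\<^bsub>G n\<^esub> y) = d n x \<oplus>\<^bsub>G (Suc n)\<^esub> d n y" if "y \<in> carrier (G n)" for y
      unfolding sel by (rule module_hom_add[OF d xE GE[OF that]])
    show "d n (r \<odot>\<^bsub>G n\<^esub> x) = r \<odot>\<^bsub>G (Suc n)\<^esub> d n x" if "r \<in> carrier R" for r
      unfolding sel by (rule module_hom_smult[OF d that xE])
  qed
  have ddG: "d (Suc n) (d n x) = \<zero>\<^bsub>G (Suc (Suc n))\<^esub>" if "x \<in> carrier (G n)" for n x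
    unfolding sel by (rule dd[OF GE[OF that]])
  have GI: "x \<in> carrier (G n)" if x: "x \<in> carrier (E n)" "\<And>r. r \<in> I \<Longrightarrow> r \<odot>\<^bsub>E n\<^esub> x = \<zero>\<^bsub>E n\<^esub>" for n x
  proof -
    have "(a [^]\<^bsub>R\<^esub> (1::nat)) \<odot>\<^bsub>E n\<^esub> x = \<zero>\<^bsub>E n\<^esub>" if "a \<in> X" for a
    proof -
      have "a \<in> I" "a \<in> carrier R" using that R.genideal_self[OF X(2)] X(2,3) by blast+
      then show ?thesis using x(2)[of a] by simp
    qed
    then show ?thesis using x(1) unfolding Gcar by blast
  qed
  interpret T: torsion_complex R X G d
  proof (rule torsion_complex.intro)
    show "ext_trivial R (G n)" for n
      unfolding G_def X(3)
      by (rule ext_trivial_torsion_module[OF R E' injective_imp_ext_trivial[OF R(1) E] X(1,2)])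
    show "\<exists>k::nat. (x [^]\<^bsub>R\<^esub> k) \<odot>\<^bsub>G n\<^esub> y = \<zero>\<^bsub>G n\<^esub>" if "x \<in> X" "y \<in> carrier (G n)" for n x y
      using that unfolding Gcar sel by blast
  qed (fact R X(1,2) G dG ddG)+
  have local: "artinian_module R (cohomology G d i) \<longleftrightarrow> artinian_between R (G i) (T.Z i) (T.B i)" for i
    unfolding T.Z_def T.B_def by (rule artinian_cohomology_iff_between[where C = G and d = d, OF G dG ddG])
  let ?Q = "cyclic_module R I"
  note Q = module_cyclic_module[OF R(1) I]
  define H where "H n = hom_module R ?Q (E n)" for n
  define \<delta> where "\<delta> n = compose (carrier ?Q) (d n)" for n
  have H: "module R (H n)" for n unfolding H_def by (rule module_hom_module[OF Q E'])
  let ?e = "cyclic_gen R I"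
  note e = cyclic_gen_closed[OF R(1) I]
  have Hcar: "f \<in> carrier (H n) \<longleftrightarrow> f \<in> module_hom R ?Q (E n) \<and> f \<in> extensional (carrier ?Q)" for f n
    by (simp add: H_def)
  have ev_closed: "f ?e \<in> T.annihilated n" if f: "f \<in> carrier (H n)" for f n
    using hom_cyclic_module_annihilated[OF R(1) I E' f[unfolded H_def]] GI
    unfolding T.annihilated_def sel X(3)[symmetric] by blast
  have ev_car: "f ?e \<in> carrier (G n)" if f: "f \<in> carrier (H n)" for f n
    using ev_closed[OF f] unfolding T.annihilated_def by blast
  have ev_inj: "f = g" if "f \<in> carrier (H n)" "g \<in> carrier (H n)" "f ?e = g ?e" for f g n
    by (rule hom_cyclic_module_eqI[OF R(1) I E'[of n]]) (use that in \<open>simp_all only: H_def\<close>)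
  have ev_surj: "\<exists>f\<in>carrier (H n). f ?e = y" if y: "y \<in> T.annihilated n" for y n
  proof -
    have "y \<in> carrier (E n)" "\<And>r. r \<in> I \<Longrightarrow> r \<odot>\<^bsub>E n\<^esub> y = \<zero>\<^bsub>E n\<^esub>"
      using y GE unfolding T.annihilated_def sel X(3)[symmetric] by blast+
    then show ?thesis using hom_cyclic_module_exists[OF R(1) I E'] unfolding H_def by metis
  qed
  have \<delta>_closed: "\<delta> n f \<in> carrier (H (Suc n))" if f: "f \<in> carrier (H n)" for f n
  proof -
    have "(\<lambda>x. d n (f x)) \<in> module_hom R ?Q (E (Suc n))"
      by (rule module_hom_compose[OF _ d]) (use f Hcar in blast)
    then show ?thesis
      unfolding Hcar \<delta>_def compose_def using restrict_module_hom[OF Q, of "\<lambda>x. d n (f x)"] by simp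
  qed
  have \<delta>_ev: "\<delta> n f ?e = d n (f ?e)" for n f using e by (simp add: \<delta>_def compose_def)
  have add_ev: "(f \<oplus>\<^bsub>H n\<^esub> g) ?e = f ?e \<oplus>\<^bsub>G n\<^esub> g ?e" for f g n using e by (simp add: H_def sel)
  have smult_ev: "(r \<odot>\<^bsub>H n\<^esub> f) ?e = r \<odot>\<^bsub>G n\<^esub> f ?e" for r f n using e by (simp add: H_def sel)
  have zero_ev: "\<zero>\<^bsub>H n\<^esub> ?e = \<zero>\<^bsub>G n\<^esub>" for n using e by (simp add: H_def sel)
  have H0: "\<zero>\<^bsub>H n\<^esub> \<in> carrier (H n)" for n
    by (rule submodule_zero[OF module.carrier_is_submodule[OF H]])
  \<comment> \<open>Linearity is checked at the class of one, where it becomes the linearity of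
    \<open>d n\<close>.\<close>
  have \<delta>: "\<delta> n \<in> module_hom R (H n) (H (Suc n))" for n
  proof (rule module_homI)
    fix f assume f: "f \<in> carrier (H n)"
    show "\<delta> n f \<in> carrier (H (Suc n))" by (rule \<delta>_closed[OF f])
    interpret H: module R "H n" by (rule H)
    interpret H': module R "H (Suc n)" by (rule H)
    show "\<delta> n (f \<oplus>\<^bsub>H n\<^esub> g) = \<delta> n f \<oplus>\<^bsub>H (Suc n)\<^esub> \<delta> n g" if g: "g \<in> carrier (H n)" for g
    proof (rule ev_inj)
      show "\<delta> n (f \<oplus>\<^bsub>H n\<^esub> g) ?e = (\<delta> n f \<oplus>\<^bsub>H (Suc n)\<^esub> \<delta> n g) ?e"
        unfolding \<delta>_ev add_ev by (rule module_hom_add[OF dG ev_car[OF f] ev_car[OF g]])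
    qed (use f g \<delta>_closed in blast)+
    show "\<delta> n (r \<odot>\<^bsub>H n\<^esub> f) = r \<odot>\<^bsub>H (Suc n)\<^esub> \<delta> n f" if r: "r \<in> carrier R" for r
    proof (rule ev_inj)
      show "\<delta> n (r \<odot>\<^bsub>H n\<^esub> f) ?e = (r \<odot>\<^bsub>H (Suc n)\<^esub> \<delta> n f) ?e"
        unfolding \<delta>_ev smult_ev by (rule module_hom_smult[OF dG r ev_car[OF f]])
    qed (use f r \<delta>_closed in blast)+
  qed
  have \<delta>_zero_iff: "\<delta> n f = \<zero>\<^bsub>H (Suc n)\<^esub> \<longleftrightarrow> d n (f ?e) = \<zero>\<^bsub>G (Suc n)\<^esub>" if f: "f \<in> carrier (H n)" for n f
    using ev_inj[OF \<delta>_closed[OF f] H0] \<delta>_ev zero_ev by metis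
  have \<delta>\<delta>: "\<delta> (Suc n) (\<delta> n f) = \<zero>\<^bsub>H (Suc (Suc n))\<^esub>" if f: "f \<in> carrier (H n)" for n f
    unfolding \<delta>_zero_iff[OF \<delta>_closed[OF f]] \<delta>_ev by (rule ddG[OF ev_car[OF f]])
  have "artinian_module R (cohomology H \<delta> i) \<longleftrightarrow> artinian_between R (G i) (T.ZI i) (T.BI i)" for i
  proof -
    define ZH where "ZH = {f \<in> carrier (H i). \<delta> i f = \<zero>\<^bsub>H (Suc i)\<^esub>}"
    define BH where "BH = (case i of 0 \<Rightarrow> {\<zero>\<^bsub>H 0\<^esub>} | Suc j \<Rightarrow> \<delta> j ` carrier (H j))"
    have ZH: "submodule ZH R (H i)" unfolding ZH_def by (rule submodule_a_kernel[OF H H \<delta>])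
    have BH: "submodule BH R (H i)" "BH \<subseteq> ZH"
    proof (atomize (full), cases i)
      case 0
      then show "submodule BH R (H i) \<and> BH \<subseteq> ZH"
        using module.submodule_zero_singleton[OF H[of 0]] submodule_zero[OF ZH] by (simp add: BH_def)
    next
      case (Suc j)
      then show "submodule BH R (H i) \<and> BH \<subseteq> ZH"
        using submodule_image[OF H H \<delta> module.carrier_is_submodule[OF H[of j]]] \<delta>_closed[of _ j] \<delta>\<delta>[of _ j]
        by (auto simp: BH_def ZH_def)
    qed
    have ZH_iff: "f \<in> ZH \<longleftrightarrow> f ?e \<in> T.ZI i" if "f \<in> carrier (H i)" for f
      using \<delta>_zero_iff[OF that] ev_closed[OF that] that by (simp add: ZH_def T.ZI_def)
    have BH_iff: "f \<in> BH \<longleftrightarrow> f ?e \<in> T.BI i" if f: "f \<in> carrier (H i)" for f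
    proof (cases i)
      case 0
      then show ?thesis
        using f ev_inj[OF _ H0[of 0], of f] zero_ev[of 0] by (auto simp: BH_def T.BI_def)
    next
      case (Suc j)
      show ?thesis
      proof
        assume "f \<in> BH"
        then obtain g where "g \<in> carrier (H j)" "f = \<delta> j g" using Suc by (auto simp: BH_def)
        then show "f ?e \<in> T.BI i" using ev_closed[of g j] \<delta>_ev Suc by (auto simp: T.BI_def)
      next
        assume "f ?e \<in> T.BI i"
        then obtain y where y: "y \<in> T.annihilated j" "f ?e = d j y" using Suc by (auto simp: T.BI_def)
        obtain g where g: "g \<in> carrier (H j)" "g ?e = y" using ev_surj[OF y(1)] by blast
        have "f = \<delta> j g"
          by (rule ev_inj[of _ i]) (use f g y \<delta>_closed[OF g(1)] \<delta>_ev Suc in auto)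
        then show "f \<in> BH" using g(1) Suc by (auto simp: BH_def)
      qed
    qed
    note sub = T.submodule_ZI T.submodule_BI
    have BZ: "T.BI i \<subseteq> T.ZI i"
      using T.BI_subset_annihilated[of i] T.BI_subset_B[of i] T.B_subset_Z[of i]
      by (auto simp: T.ZI_def T.Z_def)
    have ann: "T.ZI i \<subseteq> T.annihilated i" by (auto simp: T.ZI_def)
    let ?\<rho> = "\<lambda>f y. f \<in> carrier (H i) \<and> y = f ?e"
    have \<rho>: "f \<in> carrier (H i) \<and> y \<in> carrier (G i)" if "?\<rho> f y" for f y
      using that ev_car by blast
    have \<rho>_add: "?\<rho> (f \<oplus>\<^bsub>H i\<^esub> f') (y \<oplus>\<^bsub>G i\<^esub> y')" if "?\<rho> f y" "?\<rho> f' y'" for f y f' y'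
      using that submodule_add[OF module.carrier_is_submodule[OF H]] add_ev by auto
    have \<rho>_smult: "?\<rho> (r \<odot>\<^bsub>H i\<^esub> f) (r \<odot>\<^bsub>G i\<^esub> y)" if "r \<in> carrier R" "?\<rho> f y" for r f y
      using that submodule_smult[OF module.carrier_is_submodule[OF H]] smult_ev by auto
    have "artinian_between R (H i) ZH BH \<longleftrightarrow> artinian_between R (G i) (T.ZI i) (T.BI i)"
    proof
      assume a: "artinian_between R (G i) (T.ZI i) (T.BI i)"
      show "artinian_between R (H i) ZH BH"
      proof (rule artinian_between_rel[where \<rho> = ?\<rho>, OF H G sub BZ BH(1) \<rho> \<rho>_add \<rho>_smult _ _ a])
        show "\<exists>y\<in>T.ZI i. ?\<rho> f y" if "f \<in> ZH" for f
          using that ZH_iff submodule_mem[OF ZH that] by blast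
        show "f \<in> BH" if "?\<rho> f y" "y \<in> T.BI i" for f y
          using that BH_iff by blast
      qed
    next
      assume a: "artinian_between R (H i) ZH BH"
      show "artinian_between R (G i) (T.ZI i) (T.BI i)"
      proof (rule artinian_between_rel[where \<rho> = "\<lambda>y f. ?\<rho> f y", OF G H ZH BH sub(2) _ _ _ _ _ a])
        show "y \<in> carrier (G i) \<and> f \<in> carrier (H i)" if "?\<rho> f y" for f y
          using \<rho>[OF that] by blast
        show "\<exists>f\<in>ZH. ?\<rho> f y" if "y \<in> T.ZI i" for y
          using ev_surj[of y i] that ann ZH_iff by blast
        show "y \<in> T.BI i" if "?\<rho> f y" "f \<in> BH" for f y
          using that BH_iff by blast
      qed (erule (1) \<rho>_add, erule (1) \<rho>_smult)
    qed
    then show ?thesis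
      using artinian_cohomology_iff_between[where C = H and d = \<delta>, OF H \<delta> \<delta>\<delta>, of i] by (simp add: ZH_def BH_def)
  qed
  then show ?thesis
    using T.artinian_cohomology_all_iff[of t] local unfolding G_def[abs_def] H_def[abs_def] \<delta>_def[abs_def]
    by simp
qed

section \<open>Baer's criterion\<close>

text \<open>Partial extensions are represented by their graphs, so that Zorn's lemma applies to set
  inclusion.\<close>

lemma baer_criterion:
  fixes B :: "('a, 'b) module" and D :: "('a, 'c) module"
  assumes B: "module R B" and D: "module R D" and A: "submodule A R B"
    and f: "f \<in> module_hom R (B\<lparr>carrier := A\<rparr>) D"
    and baer: "\<And>J h. ideal J R \<Longrightarrow> h \<in> module_hom R ((regular_module R)\<lparr>carrier := J\<rparr>) D \<Longrightarrow>
      \<exists>e\<in>carrier D. \<forall>r\<in>J. h r = r \<odot>\<^bsub>D\<^esub> e"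
  obtains g where "g \<in> module_hom R B D" "\<And>x. x \<in> A \<Longrightarrow> g x = f x"
proof -
  interpret B: module R B by fact
  interpret D: module R D by fact
  note BA = B.module_submodule[OF A]
  note Amem = submodule_mem[OF A]
  \<comment> \<open>Graphs of partial homomorphisms: linear relations in which only zero lies over
    zero, which makes them single-valued.\<close>
  define lin where "lin \<Gamma> \<longleftrightarrow> \<Gamma> \<subseteq> carrier B \<times> carrier D \<and>
    (\<forall>x y x' y'. (x, y) \<in> \<Gamma> \<longrightarrow> (x', y') \<in> \<Gamma> \<longrightarrow> (x \<oplus>\<^bsub>B\<^esub> x', y \<oplus>\<^bsub>D\<^esub> y') \<in> \<Gamma>) \<and>
    (\<forall>r x y. r \<in> carrier R \<longrightarrow> (x, y) \<in> \<Gamma> \<longrightarrow> (r \<odot>\<^bsub>B\<^esub> x, r \<odot>\<^bsub>D\<^esub> y) \<in> \<Gamma>) \<and>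
    (\<forall>y. (\<zero>\<^bsub>B\<^esub>, y) \<in> \<Gamma> \<longrightarrow> y = \<zero>\<^bsub>D\<^esub>)" for \<Gamma>
  let ?\<Gamma>0 = "(\<lambda>x. (x, f x)) ` A"
  let ?\<G> = "{\<Gamma>. lin \<Gamma> \<and> ?\<Gamma>0 \<subseteq> \<Gamma>}"
  have fA: "f x \<in> carrier D" "f (x \<oplus>\<^bsub>B\<^esub> x') = f x \<oplus>\<^bsub>D\<^esub> f x'" "r \<in> carrier R \<Longrightarrow> f (r \<odot>\<^bsub>B\<^esub> x) = r \<odot>\<^bsub>D\<^esub> f x"
    if "x \<in> A" "x' \<in> A" for x x' r
    using that module_homD[OF f] by simp_all
  have "f \<zero>\<^bsub>B\<^esub> = \<zero>\<^bsub>D\<^esub>" using module_hom_zero[OF f BA D] by simp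
  then have "lin ?\<Gamma>0"
    unfolding lin_def using Amem fA submodule_add[OF A] submodule_smult[OF A] by auto
  then have "?\<G> \<noteq> {}" by blast
  then have "\<exists>\<Gamma>\<in>?\<G>. \<forall>\<Gamma>'\<in>?\<G>. \<Gamma> \<subseteq> \<Gamma>' \<longrightarrow> \<Gamma>' = \<Gamma>"
  proof (rule subset_Zorn_nonempty)
    fix C assume C: "C \<noteq> {}" "subset.chain ?\<G> C"
    have lin: "lin \<Gamma>" if "\<Gamma> \<in> C" for \<Gamma> using C that by (auto simp: subset_chain_def)
    have "lin (\<Union>C)"
      unfolding lin_def
    proof (intro conjI allI impI)
      show "\<Union>C \<subseteq> carrier B \<times> carrier D" using lin unfolding lin_def by blast
      show "y = \<zero>\<^bsub>D\<^esub>" if "(\<zero>\<^bsub>B\<^esub>, y) \<in> \<Union>C" for y using that lin unfolding lin_def by blast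
      show "(r \<odot>\<^bsub>B\<^esub> x, r \<odot>\<^bsub>D\<^esub> y) \<in> \<Union>C" if "r \<in> carrier R" "(x, y) \<in> \<Union>C" for r x y
        using that lin unfolding lin_def by blast
      show "(x \<oplus>\<^bsub>B\<^esub> x', y \<oplus>\<^bsub>D\<^esub> y') \<in> \<Union>C" if xy: "(x, y) \<in> \<Union>C" "(x', y') \<in> \<Union>C" for x y x' y'
      proof -
        have chain: "\<Gamma>1 \<subseteq> \<Gamma>2 \<or> \<Gamma>2 \<subseteq> \<Gamma>1" if "\<Gamma>1 \<in> C" "\<Gamma>2 \<in> C" for \<Gamma>1 \<Gamma>2
          using C(2) that by (simp add: subset_chain_def)
        obtain \<Gamma>1 \<Gamma>2 where "\<Gamma>1 \<in> C" "(x, y) \<in> \<Gamma>1" "\<Gamma>2 \<in> C" "(x', y') \<in> \<Gamma>2" using xy by blast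
        then obtain \<Gamma> where \<Gamma>: "\<Gamma> \<in> C" "(x, y) \<in> \<Gamma>" "(x', y') \<in> \<Gamma>"
          using chain[of \<Gamma>1 \<Gamma>2] by blast
        then have "(x \<oplus>\<^bsub>B\<^esub> x', y \<oplus>\<^bsub>D\<^esub> y') \<in> \<Gamma>" using lin[OF \<Gamma>(1)] unfolding lin_def by blast
        then show ?thesis using \<Gamma>(1) by blast
      qed
    qed
    moreover have "?\<Gamma>0 \<subseteq> \<Union>C" using C unfolding subset_chain_def by blast
    ultimately show "\<Union>C \<in> ?\<G>" by blast
  qed
  then obtain \<Gamma> where "\<Gamma> \<in> ?\<G>" and "\<forall>\<Gamma>'\<in>?\<G>. \<Gamma> \<subseteq> \<Gamma>' \<longrightarrow> \<Gamma>' = \<Gamma>" by (rule bexE)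
  then have \<Gamma>: "lin \<Gamma>" "?\<Gamma>0 \<subseteq> \<Gamma>"
    and max: "\<And>\<Gamma>'. lin \<Gamma>' \<Longrightarrow> ?\<Gamma>0 \<subseteq> \<Gamma>' \<Longrightarrow> \<Gamma> \<subseteq> \<Gamma>' \<Longrightarrow> \<Gamma>' = \<Gamma>"
    by auto
  have car: "x \<in> carrier B" "y \<in> carrier D" if "(x, y) \<in> \<Gamma>" for x y
    using \<Gamma>(1) that unfolding lin_def by blast+
  have add: "(x \<oplus>\<^bsub>B\<^esub> x', y \<oplus>\<^bsub>D\<^esub> y') \<in> \<Gamma>" if "(x, y) \<in> \<Gamma>" "(x', y') \<in> \<Gamma>" for x y x' y'
    using \<Gamma>(1) that unfolding lin_def by blast
  have smult: "(r \<odot>\<^bsub>B\<^esub> x, r \<odot>\<^bsub>D\<^esub> y) \<in> \<Gamma>" if "r \<in> carrier R" "(x, y) \<in> \<Gamma>" for r x y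
    using \<Gamma>(1) that unfolding lin_def by blast
  have minus: "(x \<ominus>\<^bsub>B\<^esub> x', y \<ominus>\<^bsub>D\<^esub> y') \<in> \<Gamma>" if "(x, y) \<in> \<Gamma>" "(x', y') \<in> \<Gamma>" for x y x' y'
    using add[OF that(1) smult[OF _ that(2), of "\<ominus>\<^bsub>R\<^esub> \<one>\<^bsub>R\<^esub>"]] car[OF that(2)]
    by (simp add: B.M.minus_eq D.M.minus_eq B.a_inv_eq_smult D.a_inv_eq_smult)
  have zero: "y = \<zero>\<^bsub>D\<^esub>" if "(\<zero>\<^bsub>B\<^esub>, y) \<in> \<Gamma>" for y
    using \<Gamma>(1) that unfolding lin_def by blast
  have sv: "y = y'" if "(x, y) \<in> \<Gamma>" "(x, y') \<in> \<Gamma>" for x y y'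
    using zero[of "y \<ominus>\<^bsub>D\<^esub> y'"] minus[OF that] car[OF that(1)] car[OF that(2)] by (simp add: D.minus_eq_zero_iff)
  have zeros: "(\<zero>\<^bsub>B\<^esub>, \<zero>\<^bsub>D\<^esub>) \<in> \<Gamma>"
    using \<Gamma>(2) submodule_zero[OF A] \<open>f \<zero>\<^bsub>B\<^esub> = \<zero>\<^bsub>D\<^esub>\<close> by (auto simp: image_subset_iff)
  have total: "\<exists>y. (b, y) \<in> \<Gamma>" if b: "b \<in> carrier B" for b
  proof -
    \<comment> \<open>\<open>J\<close> collects the scalars that bring \<open>b\<close> into the
      domain of \<open>\<Gamma>\<close>, and \<open>h r\<close> is the value at \<open>r b\<close>.
      The element \<open>e\<close> that represents \<open>h\<close> on \<open>J\<close> serves as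
      the value at \<open>b\<close>.\<close>
    define J where "J = {r \<in> carrier R. \<exists>y. (r \<odot>\<^bsub>B\<^esub> b, y) \<in> \<Gamma>}"
    have J: "ideal J R"
    proof (rule B.R.ideal_of_subset)
      show "\<zero>\<^bsub>R\<^esub> \<in> J" using zeros b by (auto simp: J_def)
      show "r \<oplus>\<^bsub>R\<^esub> s \<in> J" if "r \<in> J" "s \<in> J" for r s
        using that add b unfolding J_def by (auto simp: B.smult_l_distr) blast
      show "r \<otimes>\<^bsub>R\<^esub> s \<in> J" if "r \<in> carrier R" "s \<in> J" for r s
        using that smult b unfolding J_def by (auto simp: B.smult_assoc1)
    qed (auto simp: J_def)
    define h where "h r = (SOME y. (r \<odot>\<^bsub>B\<^esub> b, y) \<in> \<Gamma>)" for r
    have h: "(r \<odot>\<^bsub>B\<^esub> b, h r) \<in> \<Gamma>" if "r \<in> J" for r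
      using that unfolding J_def h_def by (auto intro: someI_ex)
    have Jc: "r \<in> carrier R" if "r \<in> J" for r using that by (simp add: J_def)
    have "h \<in> module_hom R ((regular_module R)\<lparr>carrier := J\<rparr>) D"
    proof (rule module_homI)
      fix r assume "r \<in> carrier ((regular_module R)\<lparr>carrier := J\<rparr>)"
      then have r: "r \<in> J" by simp
      show "h r \<in> carrier D" using car(2)[OF h[OF r]] .
      show "h (r \<oplus>\<^bsub>(regular_module R)\<lparr>carrier := J\<rparr>\<^esub> s) = h r \<oplus>\<^bsub>D\<^esub> h s"
        if "s \<in> carrier ((regular_module R)\<lparr>carrier := J\<rparr>)" for s
      proof -
        have s: "s \<in> J" using that by simp
        have rs: "r \<oplus>\<^bsub>R\<^esub> s \<in> J"
          using additive_subgroup.a_closed[OF ideal.axioms(1)[OF J] r s] .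
        have "((r \<oplus>\<^bsub>R\<^esub> s) \<odot>\<^bsub>B\<^esub> b, h r \<oplus>\<^bsub>D\<^esub> h s) \<in> \<Gamma>"
          using add[OF h[OF r] h[OF s]] B.smult_l_distr[OF Jc[OF r] Jc[OF s] b] by simp
        from sv[OF h[OF rs] this] show ?thesis by simp
      qed
      show "h (s \<odot>\<^bsub>(regular_module R)\<lparr>carrier := J\<rparr>\<^esub> r) = s \<odot>\<^bsub>D\<^esub> h r" if s: "s \<in> carrier R" for s
      proof -
        have sr: "s \<otimes>\<^bsub>R\<^esub> r \<in> J" by (rule ideal.I_l_closed[OF J r s])
        have "((s \<otimes>\<^bsub>R\<^esub> r) \<odot>\<^bsub>B\<^esub> b, s \<odot>\<^bsub>D\<^esub> h r) \<in> \<Gamma>"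
          using smult[OF s h[OF r]] B.smult_assoc1[OF s Jc[OF r] b] by simp
        from sv[OF h[OF sr] this] show ?thesis by simp
      qed
    qed
    then obtain e where e: "e \<in> carrier D" "\<And>r. r \<in> J \<Longrightarrow> h r = r \<odot>\<^bsub>D\<^esub> e"
      using baer[OF J] by blast
    define \<Gamma>' where "\<Gamma>' = {(x \<oplus>\<^bsub>B\<^esub> r \<odot>\<^bsub>B\<^esub> b, y \<oplus>\<^bsub>D\<^esub> r \<odot>\<^bsub>D\<^esub> e) | x y r. (x, y) \<in> \<Gamma> \<and> r \<in> carrier R}"
    have \<Gamma>'I: "(x \<oplus>\<^bsub>B\<^esub> r \<odot>\<^bsub>B\<^esub> b, y \<oplus>\<^bsub>D\<^esub> r \<odot>\<^bsub>D\<^esub> e) \<in> \<Gamma>'" if "(x, y) \<in> \<Gamma>" "r \<in> carrier R" for x y r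
      unfolding \<Gamma>'_def using that by blast
    have \<Gamma>'E: "\<exists>x y r. u = x \<oplus>\<^bsub>B\<^esub> r \<odot>\<^bsub>B\<^esub> b \<and> v = y \<oplus>\<^bsub>D\<^esub> r \<odot>\<^bsub>D\<^esub> e \<and> (x, y) \<in> \<Gamma> \<and> r \<in> carrier R"
      if "(u, v) \<in> \<Gamma>'" for u v
      using that unfolding \<Gamma>'_def by blast
    have "lin \<Gamma>'"
      unfolding lin_def
    proof (intro conjI allI impI)
      show "\<Gamma>' \<subseteq> carrier B \<times> carrier D" using car b e(1) unfolding \<Gamma>'_def by auto
      fix u v assume uv: "(u, v) \<in> \<Gamma>'"
      then obtain x y r where 1: "u = x \<oplus>\<^bsub>B\<^esub> r \<odot>\<^bsub>B\<^esub> b" "v = y \<oplus>\<^bsub>D\<^esub> r \<odot>\<^bsub>D\<^esub> e" "(x, y) \<in> \<Gamma>" "r \<in> carrier R"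
        using \<Gamma>'E by blast
      note c1 = car[OF 1(3)]
      show "(u \<oplus>\<^bsub>B\<^esub> u', v \<oplus>\<^bsub>D\<^esub> v') \<in> \<Gamma>'" if uv': "(u', v') \<in> \<Gamma>'" for u' v'
      proof -
        obtain x' y' r' where 2: "u' = x' \<oplus>\<^bsub>B\<^esub> r' \<odot>\<^bsub>B\<^esub> b" "v' = y' \<oplus>\<^bsub>D\<^esub> r' \<odot>\<^bsub>D\<^esub> e" "(x', y') \<in> \<Gamma>" "r' \<in> carrier R"
          using \<Gamma>'E[OF uv'] by blast
        note c2 = car[OF 2(3)]
        have "u \<oplus>\<^bsub>B\<^esub> u' = (x \<oplus>\<^bsub>B\<^esub> x') \<oplus>\<^bsub>B\<^esub> (r \<oplus>\<^bsub>R\<^esub> r') \<odot>\<^bsub>B\<^esub> b"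
          using 1 2 c1 c2 b by (simp add: B.smult_l_distr B.M.a_ac)
        moreover have "v \<oplus>\<^bsub>D\<^esub> v' = (y \<oplus>\<^bsub>D\<^esub> y') \<oplus>\<^bsub>D\<^esub> (r \<oplus>\<^bsub>R\<^esub> r') \<odot>\<^bsub>D\<^esub> e"
          using 1 2 c1 c2 e(1) by (simp add: D.smult_l_distr D.M.a_ac)
        ultimately show ?thesis using \<Gamma>'I[OF add[OF 1(3) 2(3)], of "r \<oplus>\<^bsub>R\<^esub> r'"] 1(4) 2(4) by simp
      qed
      show "(s \<odot>\<^bsub>B\<^esub> u, s \<odot>\<^bsub>D\<^esub> v) \<in> \<Gamma>'" if s: "s \<in> carrier R" for s
      proof -
        have "s \<odot>\<^bsub>B\<^esub> u = s \<odot>\<^bsub>B\<^esub> x \<oplus>\<^bsub>B\<^esub> (s \<otimes>\<^bsub>R\<^esub> r) \<odot>\<^bsub>B\<^esub> b"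
          using 1 c1 b s by (simp add: B.smult_r_distr B.smult_assoc1)
        moreover have "s \<odot>\<^bsub>D\<^esub> v = s \<odot>\<^bsub>D\<^esub> y \<oplus>\<^bsub>D\<^esub> (s \<otimes>\<^bsub>R\<^esub> r) \<odot>\<^bsub>D\<^esub> e"
          using 1 c1 e(1) s by (simp add: D.smult_r_distr D.smult_assoc1)
        ultimately show ?thesis using \<Gamma>'I[OF smult[OF s 1(3)], of "s \<otimes>\<^bsub>R\<^esub> r"] 1(4) s by simp
      qed
    next
      \<comment> \<open>If \<open>x + r b = 0\<close>, then \<open>r\<close> lies in
        \<open>J\<close> and \<open>r e = h r = -y\<close>, so the enlarged graph is still
        single-valued.\<close>
      fix v assume "(\<zero>\<^bsub>B\<^esub>, v) \<in> \<Gamma>'"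
      then obtain x y r where 1: "\<zero>\<^bsub>B\<^esub> = x \<oplus>\<^bsub>B\<^esub> r \<odot>\<^bsub>B\<^esub> b" "v = y \<oplus>\<^bsub>D\<^esub> r \<odot>\<^bsub>D\<^esub> e" "(x, y) \<in> \<Gamma>" "r \<in> carrier R"
        using \<Gamma>'E by blast
      note c1 = car[OF 1(3)]
      have rb: "r \<odot>\<^bsub>B\<^esub> b = \<zero>\<^bsub>B\<^esub> \<ominus>\<^bsub>B\<^esub> x"
        using B.add_minus_cancel'[of x "r \<odot>\<^bsub>B\<^esub> b"] 1 c1 b by simp
      have 2: "(r \<odot>\<^bsub>B\<^esub> b, \<zero>\<^bsub>D\<^esub> \<ominus>\<^bsub>D\<^esub> y) \<in> \<Gamma>" unfolding rb by (rule minus[OF zeros 1(3)])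
      then have "r \<in> J" using 1(4) by (auto simp: J_def)
      then have "r \<odot>\<^bsub>D\<^esub> e = \<zero>\<^bsub>D\<^esub> \<ominus>\<^bsub>D\<^esub> y" using sv[OF h 2] e(2) by metis
      then show "v = \<zero>\<^bsub>D\<^esub>" using 1(2) D.minus_add_cancel[OF D.M.zero_closed c1(2)] by simp
    qed
    moreover have "\<Gamma> \<subseteq> \<Gamma>'"
    proof
      fix p assume p: "p \<in> \<Gamma>"
      obtain x y where xy: "p = (x, y)" by (cases p)
      show "p \<in> \<Gamma>'"
        using \<Gamma>'I[of x y "\<zero>\<^bsub>R\<^esub>"] p xy car[of x y] b e(1) by simp
    qed
    ultimately have "\<Gamma>' = \<Gamma>" using max \<Gamma>(2) by blast
    moreover have "(b, e) \<in> \<Gamma>'" using \<Gamma>'I[OF zeros, of "\<one>\<^bsub>R\<^esub>"] b e(1) by simp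
    ultimately show ?thesis by blast
  qed
  define g where "g b = (SOME y. (b, y) \<in> \<Gamma>)" for b
  have g: "(b, g b) \<in> \<Gamma>" if "b \<in> carrier B" for b
    unfolding g_def using total[OF that] by (rule someI_ex)
  show ?thesis
  proof (rule that)
    show "g \<in> module_hom R B D"
    proof (rule module_homI)
      fix b assume b: "b \<in> carrier B"
      show "g b \<in> carrier D" by (rule car(2)[OF g[OF b]])
      show "g (b \<oplus>\<^bsub>B\<^esub> c) = g b \<oplus>\<^bsub>D\<^esub> g c" if c: "c \<in> carrier B" for c
        by (rule sv[OF g add[OF g[OF b] g[OF c]]]) (use b c in simp)
      show "g (r \<odot>\<^bsub>B\<^esub> b) = r \<odot>\<^bsub>D\<^esub> g b" if r: "r \<in> carrier R" for r
        by (rule sv[OF g smult[OF r g[OF b]]]) (use b r in simp)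
    qed
    show "g x = f x" if "x \<in> A" for x
      using sv[OF g] \<Gamma>(2) that Amem by blast
  qed
qed

section \<open>Divisible groups and coinduced modules\<close>

lemma int_ideal_principal:
  assumes J: "ideal J \<Z>"
  obtains n where "J = {k * n | k. True}"
proof (cases "J \<subseteq> {0}")
  case True
  then have "J = {0}" using additive_subgroup.zero_closed[OF ideal.axioms(1)[OF J]] by auto
  then have "J = {k * 0 | k. True}" by auto
  then show ?thesis using that by blast
next
  case False
  have add: "x + y \<in> J" if "x \<in> J" "y \<in> J" for x y
    using additive_subgroup.a_closed[OF ideal.axioms(1)[OF J] that] by simp
  have mul: "k * x \<in> J" if "x \<in> J" for k x
    using ideal.I_l_closed[OF J that, of k] by simp
  obtain x where x: "x \<in> J" "x \<noteq> 0" using False by blast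
  have "\<bar>x\<bar> \<in> J" using mul[OF x(1), of "sgn x"] by (metis abs_sgn mult.commute)
  then have "0 < nat \<bar>x\<bar> \<and> int (nat \<bar>x\<bar>) \<in> J" using x(2) by simp
  then have "\<exists>m::nat. 0 < m \<and> int m \<in> J" by blast
  then obtain m :: nat where m: "0 < m" "int m \<in> J" "\<And>k. k < m \<Longrightarrow> \<not> (0 < k \<and> int k \<in> J)"
    using exists_least_iff[of "\<lambda>m. 0 < m \<and> int m \<in> J"] by blast
  have "j = (j div int m) * int m" if j: "j \<in> J" for j
  proof -
    have "j mod int m = j + (- (j div int m)) * int m" by (simp add: minus_div_mult_eq_mod[symmetric])
    then have "j mod int m \<in> J" using add[OF j mul[OF m(2)]] by metis
    moreover have "0 \<le> j mod int m" "j mod int m < int m" using m(1) by simp_all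
    ultimately have "j mod int m = 0" using m(3)[of "nat (j mod int m)"] by (auto simp: nat_less_iff)
    then show ?thesis by auto
  qed
  then have "J = {k * int m | k. True}" using mul[OF m(2)] by blast
  then show ?thesis using that by blast
qed

definition divisible_module :: "(int, 'd) module \<Rightarrow> bool" where
  "divisible_module D \<longleftrightarrow> (\<forall>n. n \<noteq> 0 \<longrightarrow> (\<forall>x\<in>carrier D. \<exists>y\<in>carrier D. n \<odot>\<^bsub>D\<^esub> y = x))"

text \<open>By Baer's criterion over the integers only ideals generated by a single \<open>n\<close>
  matter, and there an extension amounts to dividing \<open>h n\<close> by \<open>n\<close>. For
  \<open>n = 0\<close> the value \<open>h n\<close> is zero and zero is taken as the
  quotient.\<close>

lemma divisible_extension:
  fixes B :: "(int, 'b) module" and D :: "(int, 'd) module"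
  assumes B: "module \<Z> B" and D: "module \<Z> D" and div: "divisible_module D" and A: "submodule A \<Z> B"
    and f: "f \<in> module_hom \<Z> (B\<lparr>carrier := A\<rparr>) D"
  obtains g where "g \<in> module_hom \<Z> B D" "\<And>x. x \<in> A \<Longrightarrow> g x = f x"
proof (rule baer_criterion[OF B D A f])
  fix J h assume J: "ideal J \<Z>" and h: "h \<in> module_hom \<Z> ((regular_module \<Z>)\<lparr>carrier := J\<rparr>) D"
  interpret D: module \<Z> D by fact
  obtain n where n: "J = {k * n | k. True}" using int_ideal_principal[OF J] .
  have nJ: "n \<in> J" using n by (auto intro: exI[of _ 1])
  have hn: "h n \<in> carrier D" using module_hom_closed[OF h, of n] nJ by simp
  have hk: "h (k * n) = k \<odot>\<^bsub>D\<^esub> h n" for k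
    using module_hom_smult[OF h, of k n] nJ by simp
  obtain e where e: "e \<in> carrier D" "n \<odot>\<^bsub>D\<^esub> e = h n"
  proof (cases "n = 0")
    case True
    have "h n = \<zero>\<^bsub>D\<^esub>" using hk[of 0] True D.smult_l_null[OF hn] by simp
    then show ?thesis using that[of "\<zero>\<^bsub>D\<^esub>"] D.smult_r_null[of n] by simp
  next
    case False
    then show ?thesis using that div hn unfolding divisible_module_def by blast
  qed
  have "h r = r \<odot>\<^bsub>D\<^esub> e" if r: "r \<in> J" for r
  proof -
    obtain k where "r = k * n" using r n by blast
    then show ?thesis using hk[of k] e D.smult_assoc1[of k n e] by simp
  qed
  then show "\<exists>e\<in>carrier D. \<forall>r\<in>J. h r = r \<odot>\<^bsub>D\<^esub> e" using e(1) by blast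
qed (rule that)

definition int_module :: "('c, 'm) ring_scheme \<Rightarrow> (int, 'c) module" where
  "int_module P =
     \<lparr>carrier = carrier P, monoid.mult = undefined, monoid.one = undefined, ring.zero = \<zero>\<^bsub>P\<^esub>,
      ring.add = (\<oplus>\<^bsub>P\<^esub>), smult = (\<lambda>n x. [n] \<cdot>\<^bsub>P\<^esub> x)\<rparr>"

lemma int_module_sel [simp]:
  "carrier (int_module P) = carrier P" "\<zero>\<^bsub>int_module P\<^esub> = \<zero>\<^bsub>P\<^esub>"
  "x \<oplus>\<^bsub>int_module P\<^esub> y = x \<oplus>\<^bsub>P\<^esub> y" "n \<odot>\<^bsub>int_module P\<^esub> x = [n] \<cdot>\<^bsub>P\<^esub> x"
  by (simp_all add: int_module_def)

lemma abelian_group_cong: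
  assumes "abelian_group P" "carrier Q = carrier P" "add Q = add P" "zero Q = zero P"
  shows "abelian_group Q"
proof (rule abelian_groupI)
  interpret P: abelian_group P by fact
  fix x assume "x \<in> carrier Q"
  then show "\<exists>y\<in>carrier Q. y \<oplus>\<^bsub>Q\<^esub> x = \<zero>\<^bsub>Q\<^esub>"
    unfolding assms(2-4) by (intro bexI[of _ "\<ominus>\<^bsub>P\<^esub> x"]) (simp_all add: P.l_neg)
next
  interpret P: abelian_group P by fact
  fix x y z assume "x \<in> carrier Q" "y \<in> carrier Q" "z \<in> carrier Q"
  then show "x \<oplus>\<^bsub>Q\<^esub> y \<oplus>\<^bsub>Q\<^esub> z = x \<oplus>\<^bsub>Q\<^esub> (y \<oplus>\<^bsub>Q\<^esub> z)"
    unfolding assms(2-4) by (rule P.a_assoc)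
next
  interpret P: abelian_group P by fact
  fix x y assume "x \<in> carrier Q" "y \<in> carrier Q"
  then show "x \<oplus>\<^bsub>Q\<^esub> y \<in> carrier Q" "x \<oplus>\<^bsub>Q\<^esub> y = y \<oplus>\<^bsub>Q\<^esub> x"
    unfolding assms(2-4) by (simp_all add: P.a_comm)
next
  interpret P: abelian_group P by fact
  show "\<zero>\<^bsub>Q\<^esub> \<in> carrier Q" unfolding assms(2-4) by simp
  show "\<zero>\<^bsub>Q\<^esub> \<oplus>\<^bsub>Q\<^esub> x = x" if "x \<in> carrier Q" for x using that unfolding assms(2-4) by simp
qed

lemma module_int_module:
  assumes P: "abelian_group P"
  shows "module \<Z> (int_module P)"
proof (rule moduleI)
  interpret P: abelian_group P by fact
  show "abelian_group (int_module P)"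
    by (rule abelian_group_cong[OF P]) (simp_all add: int_module_def)
  fix a b :: int and x y
  assume "x \<in> carrier (int_module P)" "y \<in> carrier (int_module P)"
  then have x: "x \<in> carrier P" and y: "y \<in> carrier P" by simp_all
  show "a \<odot>\<^bsub>int_module P\<^esub> (x \<oplus>\<^bsub>int_module P\<^esub> y) = a \<odot>\<^bsub>int_module P\<^esub> x \<oplus>\<^bsub>int_module P\<^esub> a \<odot>\<^bsub>int_module P\<^esub> y"
    using x y P.add.int_pow_mult_distrib[of x y a] by (simp add: P.a_comm add_pow_def)
next
  interpret P: abelian_group P by fact
  fix a b :: int and x
  assume "x \<in> carrier (int_module P)"
  then have x: "x \<in> carrier P" by simp
  show "a \<odot>\<^bsub>int_module P\<^esub> x \<in> carrier (int_module P)" using x by simp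
  show "(a \<oplus>\<^bsub>\<Z>\<^esub> b) \<odot>\<^bsub>int_module P\<^esub> x = a \<odot>\<^bsub>int_module P\<^esub> x \<oplus>\<^bsub>int_module P\<^esub> b \<odot>\<^bsub>int_module P\<^esub> x"
    using P.add.int_pow_mult[OF x, of a b] by (simp add: add_pow_def)
  show "(a \<otimes>\<^bsub>\<Z>\<^esub> b) \<odot>\<^bsub>int_module P\<^esub> x = a \<odot>\<^bsub>int_module P\<^esub> (b \<odot>\<^bsub>int_module P\<^esub> x)"
    using P.add.int_pow_pow[OF x, of a b] by (simp add: add_pow_def mult.commute)
  show "\<one>\<^bsub>\<Z>\<^esub> \<odot>\<^bsub>int_module P\<^esub> x = x" using x by simp
qed (simp_all add: int_is_cring)

text \<open>Induction over the integers in both directions from zero; on the way down, additivity is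
  read backwards and \<open>f x\<close> is cancelled.\<close>

lemma additive_imp_int_module_hom:
  assumes P: "module \<Z> P" and D: "module \<Z> D"
    and cl: "\<And>x. x \<in> carrier P \<Longrightarrow> f x \<in> carrier D"
    and add: "\<And>x y. x \<in> carrier P \<Longrightarrow> y \<in> carrier P \<Longrightarrow> f (x \<oplus>\<^bsub>P\<^esub> y) = f x \<oplus>\<^bsub>D\<^esub> f y"
  shows "f \<in> module_hom \<Z> P D"
proof (rule module_homI[OF cl add])
  interpret P: module \<Z> P by fact
  interpret D: module \<Z> D by fact
  fix n :: int and x assume x: "x \<in> carrier P"
  have Pm: "k \<odot>\<^bsub>P\<^esub> x \<in> carrier P" for k using P.smult_closed[of k x] x by simp
  have Dm: "k \<odot>\<^bsub>D\<^esub> f x \<in> carrier D" for k using D.smult_closed[of k "f x"] cl[OF x] by simp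
  have f1: "f ((k + 1) \<odot>\<^bsub>P\<^esub> x) = f (k \<odot>\<^bsub>P\<^esub> x) \<oplus>\<^bsub>D\<^esub> f x" for k :: int
    using P.smult_l_distr[of k 1 x] P.smult_one[OF x] x add[OF Pm x, of k] by simp
  have d1: "(k + 1) \<odot>\<^bsub>D\<^esub> f x = k \<odot>\<^bsub>D\<^esub> f x \<oplus>\<^bsub>D\<^esub> f x" for k :: int
    using D.smult_l_distr[of k 1 "f x"] D.smult_one[OF cl[OF x]] cl[OF x] by simp
  show "f (n \<odot>\<^bsub>P\<^esub> x) = n \<odot>\<^bsub>D\<^esub> f x"
  proof (induction n rule: int_induct[where k = 0])
    case base
    have "f \<zero>\<^bsub>P\<^esub> \<oplus>\<^bsub>D\<^esub> f \<zero>\<^bsub>P\<^esub> = f \<zero>\<^bsub>P\<^esub>" using add[of "\<zero>\<^bsub>P\<^esub>" "\<zero>\<^bsub>P\<^esub>"] by simp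
    then have "f \<zero>\<^bsub>P\<^esub> = \<zero>\<^bsub>D\<^esub>" using cl[of "\<zero>\<^bsub>P\<^esub>"] by (simp add: D.M.add.r_cancel_one')
    then show ?case using P.smult_l_null[OF x] D.smult_l_null[OF cl[OF x]] by simp
  next
    case (step1 i)
    then show ?case using f1 d1 by simp
  next
    case (step2 i)
    have "f ((i - 1) \<odot>\<^bsub>P\<^esub> x) \<oplus>\<^bsub>D\<^esub> f x = (i - 1) \<odot>\<^bsub>D\<^esub> f x \<oplus>\<^bsub>D\<^esub> f x"
      using f1[of "i - 1"] d1[of "i - 1"] step2 by simp
    then show ?case using cl[OF Pm] Dm cl[OF x] by (simp add: D.M.add.r_cancel)
  qed
qed

text \<open>The abelian group \<open>Hom_Z(R, D)\<close> with \<open>R\<close> acting on the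
  argument. It is right adjoint to forgetting the action of \<open>R\<close>, and this adjunction
  makes it injective for divisible \<open>D\<close>.\<close>

definition coinduced_module :: "('a, 'r) ring_scheme \<Rightarrow> (int, 'd) module \<Rightarrow> ('a, 'a \<Rightarrow> 'd) module" where
  "coinduced_module R D =
     \<lparr>carrier = carrier (hom_module \<Z> (int_module R) D), monoid.mult = undefined, monoid.one = undefined,
      ring.zero = zero (hom_module \<Z> (int_module R) D), ring.add = add (hom_module \<Z> (int_module R) D),
      smult = (\<lambda>r \<phi>. \<lambda>s\<in>carrier R. \<phi> (s \<otimes>\<^bsub>R\<^esub> r))\<rparr>"

context
  fixes R :: "('a, 'r) ring_scheme" and D :: "(int, 'd) module"
  assumes R: "cring R" and D: "module \<Z> D"
begin

interpretation cring R by (rule R)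
interpretation D: module \<Z> D by (rule D)

lemma module_int_ring: "module \<Z> (int_module R)"
  by (rule module_int_module) (rule abelian_group_axioms)

lemma coinduced_module_carrier:
  "\<phi> \<in> carrier (coinduced_module R D) \<longleftrightarrow> \<phi> \<in> extensional (carrier R) \<and> (\<forall>s\<in>carrier R. \<phi> s \<in> carrier D) \<and>
    (\<forall>s\<in>carrier R. \<forall>t\<in>carrier R. \<phi> (s \<oplus>\<^bsub>R\<^esub> t) = \<phi> s \<oplus>\<^bsub>D\<^esub> \<phi> t)"
proof -
  have "\<phi> \<in> module_hom \<Z> (int_module R) D \<longleftrightarrow> (\<forall>s\<in>carrier R. \<phi> s \<in> carrier D) \<and>
    (\<forall>s\<in>carrier R. \<forall>t\<in>carrier R. \<phi> (s \<oplus>\<^bsub>R\<^esub> t) = \<phi> s \<oplus>\<^bsub>D\<^esub> \<phi> t)"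
    using additive_imp_int_module_hom[OF module_int_ring D, of \<phi>] module_homD[of \<phi> \<Z> "int_module R" D]
    by auto
  then show ?thesis by (auto simp: coinduced_module_def)
qed

lemma coinduced_module_sel:
  "\<phi> \<oplus>\<^bsub>coinduced_module R D\<^esub> \<psi> = (\<lambda>s\<in>carrier R. \<phi> s \<oplus>\<^bsub>D\<^esub> \<psi> s)"
  "r \<odot>\<^bsub>coinduced_module R D\<^esub> \<phi> = (\<lambda>s\<in>carrier R. \<phi> (s \<otimes>\<^bsub>R\<^esub> r))"
  by (simp_all add: coinduced_module_def)

lemma coinduced_module_eqI:
  assumes "\<phi> \<in> extensional (carrier R)" "\<psi> \<in> extensional (carrier R)" "\<And>s. s \<in> carrier R \<Longrightarrow> \<phi> s = \<psi> s"
  shows "\<phi> = \<psi>"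
  using assms by (rule extensionalityI)

lemma module_coinduced_module: "module R (coinduced_module R D)"
proof (rule moduleI)
  let ?E = "coinduced_module R D"
  interpret H: module \<Z> "hom_module \<Z> (int_module R) D" by (rule module_hom_module[OF module_int_ring D])
  show "abelian_group ?E"
    by (rule abelian_group_cong[OF H.M.abelian_group_axioms]) (simp_all add: coinduced_module_def)
  fix r s \<phi> assume r: "r \<in> carrier R" and s: "s \<in> carrier R" and "\<phi> \<in> carrier ?E"
  note \<phi> = this(3)[unfolded coinduced_module_carrier]
  show "(r \<oplus>\<^bsub>R\<^esub> s) \<odot>\<^bsub>?E\<^esub> \<phi> = r \<odot>\<^bsub>?E\<^esub> \<phi> \<oplus>\<^bsub>?E\<^esub> s \<odot>\<^bsub>?E\<^esub> \<phi>"
    unfolding coinduced_module_sel by (rule restrict_ext) (use r s \<phi> in \<open>simp add: r_distr\<close>)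
  show "(r \<otimes>\<^bsub>R\<^esub> s) \<odot>\<^bsub>?E\<^esub> \<phi> = r \<odot>\<^bsub>?E\<^esub> (s \<odot>\<^bsub>?E\<^esub> \<phi>)"
    unfolding coinduced_module_sel by (rule restrict_ext) (use r s \<phi> in \<open>simp add: m_assoc\<close>)
next
  let ?E = "coinduced_module R D"
  fix r \<phi> assume r: "r \<in> carrier R" and "\<phi> \<in> carrier ?E"
  note \<phi> = this(2)[unfolded coinduced_module_carrier]
  show "r \<odot>\<^bsub>?E\<^esub> \<phi> \<in> carrier ?E"
    unfolding coinduced_module_carrier coinduced_module_sel using r \<phi> by (simp add: l_distr)
  fix \<psi> assume "\<psi> \<in> carrier ?E"
  note \<psi> = this[unfolded coinduced_module_carrier]
  show "r \<odot>\<^bsub>?E\<^esub> (\<phi> \<oplus>\<^bsub>?E\<^esub> \<psi>) = r \<odot>\<^bsub>?E\<^esub> \<phi> \<oplus>\<^bsub>?E\<^esub> r \<odot>\<^bsub>?E\<^esub> \<psi>"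
    unfolding coinduced_module_sel by (rule restrict_ext) (use r \<phi> \<psi> in simp)
next
  let ?E = "coinduced_module R D"
  fix \<phi> assume "\<phi> \<in> carrier ?E"
  note \<phi> = this[unfolded coinduced_module_carrier]
  show "\<one>\<^bsub>R\<^esub> \<odot>\<^bsub>?E\<^esub> \<phi> = \<phi>"
    unfolding coinduced_module_sel by (rule coinduced_module_eqI) (use \<phi> in simp_all)
qed (rule R)

text \<open>Homomorphisms into the coinduced module correspond to additive maps into \<open>D\<close>, by evaluation
  at \<open>\<one>\<close>.\<close>

lemma coinduced_module_lift:
  fixes B :: "('a, 'b) module"
  assumes B: "module R B" and cl: "\<And>x. x \<in> carrier B \<Longrightarrow> g x \<in> carrier D"
    and add: "\<And>x y. x \<in> carrier B \<Longrightarrow> y \<in> carrier B \<Longrightarrow> g (x \<oplus>\<^bsub>B\<^esub> y) = g x \<oplus>\<^bsub>D\<^esub> g y"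
  shows "(\<lambda>x. \<lambda>s\<in>carrier R. g (s \<odot>\<^bsub>B\<^esub> x)) \<in> module_hom R B (coinduced_module R D)"
proof -
  interpret B: module R B by fact
  show ?thesis
  proof (rule module_homI)
    fix x assume x: "x \<in> carrier B"
    show "(\<lambda>s\<in>carrier R. g (s \<odot>\<^bsub>B\<^esub> x)) \<in> carrier (coinduced_module R D)"
      unfolding coinduced_module_carrier using x cl add by (simp add: B.smult_l_distr)
    show "(\<lambda>s\<in>carrier R. g (s \<odot>\<^bsub>B\<^esub> (x \<oplus>\<^bsub>B\<^esub> y))) =
        (\<lambda>s\<in>carrier R. g (s \<odot>\<^bsub>B\<^esub> x)) \<oplus>\<^bsub>coinduced_module R D\<^esub> (\<lambda>s\<in>carrier R. g (s \<odot>\<^bsub>B\<^esub> y))"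
      if "y \<in> carrier B" for y
      unfolding coinduced_module_sel by (rule restrict_ext) (use x that add in \<open>simp add: B.smult_r_distr\<close>)
    show "(\<lambda>s\<in>carrier R. g (s \<odot>\<^bsub>B\<^esub> (r \<odot>\<^bsub>B\<^esub> x))) =
        r \<odot>\<^bsub>coinduced_module R D\<^esub> (\<lambda>s\<in>carrier R. g (s \<odot>\<^bsub>B\<^esub> x))" if "r \<in> carrier R" for r
      unfolding coinduced_module_sel by (rule restrict_ext) (use x that in \<open>simp add: B.smult_assoc1\<close>)
  qed
qed

text \<open>The additive map \<open>i x \<mapsto> f x 1\<close> on the image of \<open>A\<close>
  extends to \<open>B\<close> because \<open>D\<close> is divisible. The homomorphism corresponding
  to the extension agrees with \<open>f\<close> on \<open>A\<close>, as
  \<open>f x s = f (s x) 1\<close>.\<close>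

lemma coinduced_module_extend:
  fixes A :: "('a, 'b) module" and B :: "('a, 'c) module"
  assumes div: "divisible_module D" and A: "module R A" and B: "module R B"
    and i: "i \<in> module_hom R A B" "inj_on i (carrier A)" and f: "f \<in> module_hom R A (coinduced_module R D)"
  obtains g where "g \<in> module_hom R B (coinduced_module R D)" "\<And>x. x \<in> carrier A \<Longrightarrow> g (i x) = f x"
proof -
  interpret A: module R A by fact
  interpret B: module R B by fact
  have fc: "f x \<in> extensional (carrier R)" "f x s \<in> carrier D" if "x \<in> carrier A" "s \<in> carrier R" for x s
    using module_hom_closed[OF f that(1)] that(2) unfolding coinduced_module_carrier by auto
  have fa: "f (x \<oplus>\<^bsub>A\<^esub> y) s = f x s \<oplus>\<^bsub>D\<^esub> f y s" if "x \<in> carrier A" "y \<in> carrier A" "s \<in> carrier R" for x y s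
    using module_hom_add[OF f that(1,2)] that(3) by (simp add: coinduced_module_sel)
  have fs: "f (r \<odot>\<^bsub>A\<^esub> x) s = f x (s \<otimes>\<^bsub>R\<^esub> r)" if "x \<in> carrier A" "r \<in> carrier R" "s \<in> carrier R" for x r s
    using module_hom_smult[OF f that(2,1)] that(3) by (simp add: coinduced_module_sel)
  let ?Z = "int_module B" and ?I = "i ` carrier A"
  have Z: "module \<Z> ?Z" by (rule module_int_module) (rule B.M.abelian_group_axioms)
  interpret Z: module \<Z> ?Z by (rule Z)
  have I: "submodule ?I R B" by (rule submodule_image[OF A B i(1) A.carrier_is_submodule])
  have add_pow: "n \<odot>\<^bsub>?Z\<^esub> x \<in> ?I" if x: "x \<in> ?I" for n x
    using submodule.axioms(1)[OF I] group.int_pow_closed[OF subgroup.subgroup_is_group[OF _ B.M.a_group], of ?I x n]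
      group.int_pow_consistent[OF B.M.a_group, of ?I x n] x
    by (simp add: add_pow_def)
  have IZ: "submodule ?I \<Z> ?Z"
    by (rule Z.submoduleI')
      (use submodule_subset[OF I] submodule_zero[OF I] submodule_add[OF I] add_pow in \<open>simp_all\<close>)
  let ?j = "inv_into (carrier A) i"
  have j: "?j (i x) = x" if "x \<in> carrier A" for x using inv_into_f_f[OF i(2) that] .
  let ?f = "\<lambda>b. f (?j b) \<one>\<^bsub>R\<^esub>"
  have "?f \<in> module_hom \<Z> (?Z\<lparr>carrier := ?I\<rparr>) D"
  proof (rule additive_imp_int_module_hom[OF Z.module_submodule[OF IZ] D])
    show "?f b \<in> carrier D" if "b \<in> carrier (?Z\<lparr>carrier := ?I\<rparr>)" for b
      using that j fc by auto
    show "?f (b \<oplus>\<^bsub>?Z\<lparr>carrier := ?I\<rparr>\<^esub> c) = ?f b \<oplus>\<^bsub>D\<^esub> ?f c"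
      if bc: "b \<in> carrier (?Z\<lparr>carrier := ?I\<rparr>)" "c \<in> carrier (?Z\<lparr>carrier := ?I\<rparr>)" for b c
    proof -
      obtain x y where xy: "x \<in> carrier A" "b = i x" "y \<in> carrier A" "c = i y" using bc by auto
      have "b \<oplus>\<^bsub>B\<^esub> c = i (x \<oplus>\<^bsub>A\<^esub> y)" using xy module_hom_add[OF i(1)] by simp
      then show ?thesis using xy j[of x] j[of y] j[of "x \<oplus>\<^bsub>A\<^esub> y"] fa by simp
    qed
  qed
  then obtain g where g: "g \<in> module_hom \<Z> ?Z D" "\<And>b. b \<in> ?I \<Longrightarrow> g b = ?f b"
    by (rule divisible_extension[OF Z D div IZ]) (rule that)
  let ?g = "\<lambda>x. \<lambda>s\<in>carrier R. g (s \<odot>\<^bsub>B\<^esub> x)"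
  have "?g \<in> module_hom R B (coinduced_module R D)"
    by (rule coinduced_module_lift[OF B]) (use module_hom_closed[OF g(1)] module_hom_add[OF g(1)] in simp_all)
  moreover have "?g (i x) = f x" if x: "x \<in> carrier A" for x
  proof (rule coinduced_module_eqI)
    show "f x \<in> extensional (carrier R)" using fc(1)[OF x one_closed] .
    fix s assume s: "s \<in> carrier R"
    have "s \<odot>\<^bsub>B\<^esub> i x = i (s \<odot>\<^bsub>A\<^esub> x)" using module_hom_smult[OF i(1) s x] by simp
    then have "g (s \<odot>\<^bsub>B\<^esub> i x) = f (s \<odot>\<^bsub>A\<^esub> x) \<one>\<^bsub>R\<^esub>"
      using g(2)[of "s \<odot>\<^bsub>B\<^esub> i x"] j[of "s \<odot>\<^bsub>A\<^esub> x"] s x by simp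
    then show "?g (i x) s = f x s" using fs[OF x s one_closed] s by simp
  qed simp
  ultimately show ?thesis by (rule that)
qed

end

section \<open>Divisible hulls\<close>

text \<open>An abelian group \<open>P\<close> is the quotient of the free group on its elements by the relations
  between them; dividing the finitely supported functions from \<open>P\<close> to \<open>\<rat>\<close> by the same relations
  gives a divisible group containing \<open>P\<close>.\<close>

definition rational_module :: "(int, 'm) module \<Rightarrow> (int, 'm \<Rightarrow> rat) module" where
  "rational_module P =
     \<lparr>carrier = {f. finite {m. f m \<noteq> 0} \<and> {m. f m \<noteq> 0} \<subseteq> carrier P},
      monoid.mult = undefined, monoid.one = undefined, ring.zero = (\<lambda>_. 0),
      ring.add = (\<lambda>f g m. f m + g m), smult = (\<lambda>n f m. of_int n * f m)\<rparr>"

text \<open>The value in \<open>P\<close> of a formal integer combination of elements of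
  \<open>P\<close>; the floor is there to convert integral rationals into integers.\<close>

definition int_combination :: "(int, 'm) module \<Rightarrow> ('m \<Rightarrow> rat) \<Rightarrow> 'm" where
  "int_combination P f = finsum P (\<lambda>m. \<lfloor>f m\<rfloor> \<odot>\<^bsub>P\<^esub> m) {m. f m \<noteq> 0}"

definition int_relations :: "(int, 'm) module \<Rightarrow> ('m \<Rightarrow> rat) set" where
  "int_relations P = {f \<in> carrier (rational_module P). (\<forall>m. f m \<in> \<int>) \<and> int_combination P f = \<zero>\<^bsub>P\<^esub>}"

definition divisible_hull :: "(int, 'm) module \<Rightarrow> (int, ('m \<Rightarrow> rat) set) module" where
  "divisible_hull P = quotient_module (rational_module P) (int_relations P)"

definition point :: "'m \<Rightarrow> 'm \<Rightarrow> rat" where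
  "point x = (\<lambda>m. if m = x then 1 else 0)"

definition hull_embedding :: "(int, 'm) module \<Rightarrow> 'm \<Rightarrow> ('m \<Rightarrow> rat) set" where
  "hull_embedding P x = int_relations P +>\<^bsub>rational_module P\<^esub> point x"

lemma rational_module_sel [simp]:
  "\<zero>\<^bsub>rational_module P\<^esub> = (\<lambda>_. 0)"
  "f \<oplus>\<^bsub>rational_module P\<^esub> g = (\<lambda>m. f m + g m)"
  "n \<odot>\<^bsub>rational_module P\<^esub> f = (\<lambda>m. of_int n * f m)"
  by (simp_all add: rational_module_def)

lemma rational_module_carrier:
  "f \<in> carrier (rational_module P) \<longleftrightarrow> finite {m. f m \<noteq> 0} \<and> {m. f m \<noteq> 0} \<subseteq> carrier P"
  by (simp add: rational_module_def)

lemma rational_module_closed: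
  assumes f: "f \<in> carrier (rational_module P)"
  shows "g \<in> carrier (rational_module P) \<Longrightarrow> (\<lambda>m. f m + g m) \<in> carrier (rational_module P)"
    and "g \<in> carrier (rational_module P) \<Longrightarrow> (\<lambda>m. f m - g m) \<in> carrier (rational_module P)"
    and "(\<lambda>m. c * f m) \<in> carrier (rational_module P)"
proof -
  have *: "h \<in> carrier (rational_module P)"
    if "g \<in> carrier (rational_module P)" "\<And>m. f m = 0 \<Longrightarrow> g m = 0 \<Longrightarrow> h m = 0" for g h
  proof -
    have "{m. h m \<noteq> 0} \<subseteq> {m. f m \<noteq> 0} \<union> {m. g m \<noteq> 0}" using that(2) by blast
    moreover have "finite ({m. f m \<noteq> 0} \<union> {m. g m \<noteq> 0})" using f that(1) by (simp add: rational_module_carrier)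
    ultimately show ?thesis
      using f that(1) finite_subset unfolding rational_module_carrier by blast
  qed
  show "g \<in> carrier (rational_module P) \<Longrightarrow> (\<lambda>m. f m + g m) \<in> carrier (rational_module P)"
    "g \<in> carrier (rational_module P) \<Longrightarrow> (\<lambda>m. f m - g m) \<in> carrier (rational_module P)"
    "(\<lambda>m. c * f m) \<in> carrier (rational_module P)"
    using *[of g] *[OF f] by auto
qed

lemma module_rational_module: "module \<Z> (rational_module P)"
proof (rule moduleI)
  show "abelian_group (rational_module P)"
  proof (rule abelian_groupI)
    fix f assume f: "f \<in> carrier (rational_module P)"
    have "(\<lambda>m. - 1 * f m) \<oplus>\<^bsub>rational_module P\<^esub> f = \<zero>\<^bsub>rational_module P\<^esub>" by simp
    then show "\<exists>g\<in>carrier (rational_module P). g \<oplus>\<^bsub>rational_module P\<^esub> f = \<zero>\<^bsub>rational_module P\<^esub>"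
      using rational_module_closed(3)[OF f, of "- 1"] by blast
    fix g assume "g \<in> carrier (rational_module P)"
    then show "f \<oplus>\<^bsub>rational_module P\<^esub> g \<in> carrier (rational_module P)"
      using rational_module_closed(1)[OF f] by simp
  qed (simp_all add: algebra_simps rational_module_carrier)
next
  fix n :: int and f assume "f \<in> carrier (rational_module P)"
  then show "n \<odot>\<^bsub>rational_module P\<^esub> f \<in> carrier (rational_module P)"
    using rational_module_closed(3)[of f P "of_int n"] by simp
qed (simp_all add: int_is_cring algebra_simps)

context
  fixes P :: "(int, 'm) module"
  assumes P: "module \<Z> P"
begin

interpretation P: module \<Z> P by (rule P)

interpretation V: module \<Z> "rational_module P" by (rule module_rational_module)

lemma int_smult_closed: "x \<in> carrier P \<Longrightarrow> n \<odot>\<^bsub>P\<^esub> x \<in> carrier P"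
  using P.smult_closed[of n x] by simp

text \<open>Sums over different supports become comparable by enlarging the index set, which only
  adds zero terms.\<close>

lemma int_combination_eq:
  assumes "finite S" "S \<subseteq> carrier P" "{m. f m \<noteq> 0} \<subseteq> S"
  shows "int_combination P f = finsum P (\<lambda>m. \<lfloor>f m\<rfloor> \<odot>\<^bsub>P\<^esub> m) S"
  unfolding int_combination_def
proof (rule P.M.add.finprod_mono_neutral_cong_left[OF assms(1,3)])
  show "\<lfloor>f m\<rfloor> \<odot>\<^bsub>P\<^esub> m = \<zero>\<^bsub>P\<^esub>" if "m \<in> S - {m. f m \<noteq> 0}" for m
    using that assms(2) P.smult_l_null[of m] by auto
qed (use assms(2) int_smult_closed in auto)

lemma int_combination_add:
  assumes f: "f \<in> carrier (rational_module P)" "\<And>m. f m \<in> \<int>"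
    and g: "g \<in> carrier (rational_module P)" "\<And>m. g m \<in> \<int>"
  shows "int_combination P (\<lambda>m. f m + g m) = int_combination P f \<oplus>\<^bsub>P\<^esub> int_combination P g"
proof -
  let ?S = "{m. f m \<noteq> 0} \<union> {m. g m \<noteq> 0}"
  have S: "finite ?S" "?S \<subseteq> carrier P" using f g by (auto simp: rational_module_carrier)
  have *: "\<lfloor>f m + g m\<rfloor> \<odot>\<^bsub>P\<^esub> m = \<lfloor>f m\<rfloor> \<odot>\<^bsub>P\<^esub> m \<oplus>\<^bsub>P\<^esub> \<lfloor>g m\<rfloor> \<odot>\<^bsub>P\<^esub> m" if "m \<in> ?S" for m
  proof -
    obtain a b where "f m = of_int a" "g m = of_int b" using f(2) g(2) by (metis Ints_cases)
    moreover have "m \<in> carrier P" using that S(2) by blast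
    ultimately show ?thesis using P.smult_l_distr[of a b m] by simp
  qed
  have cl: "(\<lambda>m. \<lfloor>h m\<rfloor> \<odot>\<^bsub>P\<^esub> m) \<in> ?S \<rightarrow> carrier P" for h :: "'m \<Rightarrow> rat"
    using S(2) int_smult_closed by auto
  have "int_combination P (\<lambda>m. f m + g m) = finsum P (\<lambda>m. \<lfloor>f m + g m\<rfloor> \<odot>\<^bsub>P\<^esub> m) ?S"
    by (rule int_combination_eq[OF S]) auto
  also have "\<dots> = finsum P (\<lambda>m. \<lfloor>f m\<rfloor> \<odot>\<^bsub>P\<^esub> m \<oplus>\<^bsub>P\<^esub> \<lfloor>g m\<rfloor> \<odot>\<^bsub>P\<^esub> m) ?S"
    by (rule P.M.finsum_cong') (use * S(2) int_smult_closed in \<open>auto\<close>)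
  also have "\<dots> = finsum P (\<lambda>m. \<lfloor>f m\<rfloor> \<odot>\<^bsub>P\<^esub> m) ?S \<oplus>\<^bsub>P\<^esub> finsum P (\<lambda>m. \<lfloor>g m\<rfloor> \<odot>\<^bsub>P\<^esub> m) ?S"
    by (rule P.M.finsum_addf[OF cl cl])
  finally show ?thesis
    using int_combination_eq[OF S, of f] int_combination_eq[OF S, of g] by auto
qed

lemma int_combination_closed:
  "f \<in> carrier (rational_module P) \<Longrightarrow> int_combination P f \<in> carrier P"
  unfolding int_combination_def
  by (rule P.M.finsum_closed) (auto simp: rational_module_carrier intro: int_smult_closed)

lemma point: "x \<in> carrier P \<Longrightarrow> point x \<in> carrier (rational_module P)" "point x m \<in> \<int>"
  by (auto simp: rational_module_carrier point_def)

lemma int_combination_point: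
  assumes x: "x \<in> carrier P"
  shows "int_combination P (point x) = x"
proof -
  have "int_combination P (point x) = finsum P (\<lambda>m. \<lfloor>point x m\<rfloor> \<odot>\<^bsub>P\<^esub> m) {x}"
    by (rule int_combination_eq) (use x in \<open>auto simp: point_def\<close>)
  also have "\<dots> = 1 \<odot>\<^bsub>P\<^esub> x"
    using P.M.finsum_insert[of "{}" x "\<lambda>m. \<lfloor>point x m\<rfloor> \<odot>\<^bsub>P\<^esub> m"] int_smult_closed[OF x]
    by (simp add: point_def)
  finally show ?thesis using P.smult_one[OF x] by simp
qed

lemma submodule_int_relations: "submodule (int_relations P) \<Z> (rational_module P)"
proof -
  let ?S = "{f \<in> carrier (rational_module P). \<forall>m. f m \<in> \<int>}"
  have S: "submodule ?S \<Z> (rational_module P)"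
  proof (rule V.submoduleI')
    show "f \<oplus>\<^bsub>rational_module P\<^esub> g \<in> ?S" if "f \<in> ?S" "g \<in> ?S" for f g
      using that rational_module_closed(1)[of f P g] by simp
    show "n \<odot>\<^bsub>rational_module P\<^esub> f \<in> ?S" if "f \<in> ?S" for n f
      using that rational_module_closed(3)[of f P "of_int n"] by simp
  qed (auto simp: rational_module_carrier)
  have hom: "int_combination P \<in> module_hom \<Z> (rational_module P\<lparr>carrier := ?S\<rparr>) P"
    by (rule additive_imp_int_module_hom[OF V.module_submodule[OF S] P])
      (simp_all add: int_combination_closed int_combination_add)
  have eq: "int_relations P = {f \<in> ?S. int_combination P f = \<zero>\<^bsub>P\<^esub>}" by (auto simp: int_relations_def)
  show ?thesis
    using submodule_a_kernel[OF V.module_submodule[OF S] P hom] V.submodule_restrict_iff[OF S]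
    by (simp add: eq)
qed

lemma rational_module_minus:
  assumes "f \<in> carrier (rational_module P)" "g \<in> carrier (rational_module P)"
  shows "f \<ominus>\<^bsub>rational_module P\<^esub> g = (\<lambda>m. f m - g m)"
  using V.add_minus_cancel'[OF assms(2) rational_module_closed(2)[OF assms]] by simp

lemma module_divisible_hull: "module \<Z> (divisible_hull P)"
  unfolding divisible_hull_def by (rule module_quotient_module[OF module_rational_module submodule_int_relations])

text \<open>Rational coefficients can be divided by \<open>n\<close>, and the quotient inherits
  this.\<close>

lemma divisible_divisible_hull: "divisible_module (divisible_hull P)"
  unfolding divisible_module_def
proof (intro allI impI ballI)
  let ?q = "\<lambda>f. int_relations P +>\<^bsub>rational_module P\<^esub> f"
  fix n :: int and x assume n: "n \<noteq> 0" and "x \<in> carrier (divisible_hull P)"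
  then obtain f where f: "f \<in> carrier (rational_module P)" "x = ?q f"
    by (auto simp: divisible_hull_def)
  let ?g = "\<lambda>m. (1 / of_int n) * f m"
  have g: "?g \<in> carrier (rational_module P)" by (rule rational_module_closed(3)[OF f(1)])
  have "n \<odot>\<^bsub>divisible_hull P\<^esub> ?q ?g = ?q (n \<odot>\<^bsub>rational_module P\<^esub> ?g)"
    unfolding divisible_hull_def
    by (rule coset_smult[OF module_rational_module submodule_int_relations _ g]) simp
  also have "n \<odot>\<^bsub>rational_module P\<^esub> ?g = f" using n by simp
  finally show "\<exists>y\<in>carrier (divisible_hull P). n \<odot>\<^bsub>divisible_hull P\<^esub> y = x"
    using f(2) g by (auto simp: divisible_hull_def)
qed

lemma hull_embedding_closed: "x \<in> carrier P \<Longrightarrow> hull_embedding P x \<in> carrier (divisible_hull P)"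
  using point(1) by (simp add: hull_embedding_def divisible_hull_def)

text \<open>The combination \<open>point x + point y - point (x + y)\<close> is integral with value
  zero in \<open>P\<close>, that is, a relation.\<close>

lemma hull_embedding_add:
  assumes x: "x \<in> carrier P" and y: "y \<in> carrier P"
  shows "hull_embedding P (x \<oplus>\<^bsub>P\<^esub> y) = hull_embedding P x \<oplus>\<^bsub>divisible_hull P\<^esub> hull_embedding P y"
proof -
  note V = module_rational_module submodule_int_relations
  have xy: "x \<oplus>\<^bsub>P\<^esub> y \<in> carrier P" using x y by simp
  let ?s = "\<lambda>m. point x m + point y m" and ?u = "\<lambda>m. (point x m + point y m) - point (x \<oplus>\<^bsub>P\<^esub> y) m"
  have s: "?s \<in> carrier (rational_module P)" "?s m \<in> \<int>" for m
    using rational_module_closed(1)[OF point(1)[OF x] point(1)[OF y]] point(2) by simp_all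
  have u: "?u \<in> carrier (rational_module P)" "?u m \<in> \<int>" for m
    using rational_module_closed(2)[OF s(1) point(1)[OF xy]] point(2) s(2) by simp_all
  have "int_combination P ?u \<oplus>\<^bsub>P\<^esub> int_combination P (point (x \<oplus>\<^bsub>P\<^esub> y)) = int_combination P ?s"
    using int_combination_add[OF u point(1)[OF xy] point(2)] by simp
  also have "\<dots> = x \<oplus>\<^bsub>P\<^esub> y"
    using int_combination_add[OF point(1)[OF x] point(2) point(1)[OF y] point(2)]
    by (simp add: int_combination_point x y)
  finally have "int_combination P ?u = \<zero>\<^bsub>P\<^esub>"
    using int_combination_closed[OF u(1)] xy by (simp add: int_combination_point)
  then have "?u \<in> int_relations P" using u by (simp add: int_relations_def)
  then have "?s \<ominus>\<^bsub>rational_module P\<^esub> point (x \<oplus>\<^bsub>P\<^esub> y) \<in> int_relations P"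
    using rational_module_minus[OF s(1) point(1)[OF xy]] by simp
  then have "int_relations P +>\<^bsub>rational_module P\<^esub> ?s = hull_embedding P (x \<oplus>\<^bsub>P\<^esub> y)"
    unfolding hull_embedding_def using coset_eq_iff[OF V s(1) point(1)[OF xy]] by blast
  then show ?thesis
    using coset_add[OF V point(1)[OF x] point(1)[OF y]]
    by (simp add: hull_embedding_def divisible_hull_def del: quotient_module_sel)
qed

text \<open>If \<open>point x - point y\<close> is a relation, then evaluating both points in
  \<open>P\<close> gives \<open>x = y\<close>: the hull imposes nothing on the elements of
  \<open>P\<close> that does not already hold there.\<close>

lemma inj_on_hull_embedding: "inj_on (hull_embedding P) (carrier P)"
proof (rule inj_onI)
  note V = module_rational_module submodule_int_relations
  fix x y assume x: "x \<in> carrier P" and y: "y \<in> carrier P" and "hull_embedding P x = hull_embedding P y"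
  then have "point x \<ominus>\<^bsub>rational_module P\<^esub> point y \<in> int_relations P"
    using coset_eq_iff[OF V point(1)[OF x] point(1)[OF y]] by (simp add: hull_embedding_def)
  then have u: "(\<lambda>m. point x m - point y m) \<in> int_relations P"
    using rational_module_minus[OF point(1)[OF x] point(1)[OF y]] by simp
  then have "int_combination P (point x) =
      int_combination P (\<lambda>m. point x m - point y m) \<oplus>\<^bsub>P\<^esub> int_combination P (point y)"
    using int_combination_add[of "\<lambda>m. point x m - point y m" "point y"] point(1)[OF y] point(2)
    by (simp add: int_relations_def)
  then show "x = y" using u x y by (simp add: int_relations_def int_combination_point)
qed

end

section \<open>Encodings into the universe\<close>

text \<open>Injective for \<open>a \<noteq> b\<close>: each letter of the first word is preceded by \<open>a\<close>, and its end is marked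
  by \<open>b\<close>.\<close>

fun pair_word :: "'c \<Rightarrow> 'c \<Rightarrow> 'c list \<Rightarrow> 'c list \<Rightarrow> 'c list" where
  "pair_word a b [] w = b # w"
| "pair_word a b (x # v) w = a # x # pair_word a b v w"

lemma pair_word_eq:
  assumes "a \<noteq> b"
  shows "pair_word a b v w = pair_word a b v' w' \<longleftrightarrow> v = v' \<and> w = w'"
proof (induction v arbitrary: v')
  case Nil
  then show ?case using assms by (cases v') auto
next
  case (Cons x v)
  then show ?case using assms by (cases v') auto
qed

text \<open>A bound on the cardinality by that of the type \<open>'c\<close>; the first argument
  only names this type.\<close>

definition encodable :: "'c itself \<Rightarrow> 'd set \<Rightarrow> bool" where
  "encodable _ S \<longleftrightarrow> (\<exists>h :: 'd \<Rightarrow> 'c. inj_on h S)"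

lemma encodable_inj:
  assumes "encodable TYPE('c) T" "inj_on f S" "f ` S \<subseteq> T"
  shows "encodable TYPE('c) S"
  using assms unfolding encodable_def by (meson comp_inj_on inj_on_subset)

lemma encodable_UNIV: "encodable TYPE('c) (UNIV :: 'c set)"
  unfolding encodable_def by (intro exI[of _ id]) simp

text \<open>A family of sets of words indexed by words is coded by the set of its pairs of index and
  member, each pair written as one word. This is the identity \<open>u^k = u\<close> for
  \<open>u = 2^k\<close>.\<close>

lemma encodable_families:
  "encodable TYPE(('a, 'b) universe) (UNIV :: (('a + 'b) list \<Rightarrow> ('a, 'b) universe) set)"
proof -
  let ?a = "Inl undefined :: 'a + 'b" and ?b = "Inr undefined :: 'a + 'b"
  let ?h = "\<lambda>F. {pair_word ?a ?b v w | v w. w \<in> F v}"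
  have mem: "w \<in> F v \<longleftrightarrow> pair_word ?a ?b v w \<in> ?h F" for F v w
    by (auto simp: pair_word_eq)
  have "inj ?h"
  proof (rule injI)
    fix F F' assume eq: "?h F = ?h F'"
    have "w \<in> F v \<longleftrightarrow> w \<in> F' v" for v w unfolding mem[of w F v] mem[of w F' v] eq ..
    then have "F v = F' v" for v by blast
    then show "F = F'" by (rule HOL.ext)
  qed
  then show ?thesis unfolding encodable_def by (rule exI[of _ ?h])
qed

text \<open>Indices are turned into words by \<open>\<iota>\<close> and values into sets of words,
  so that a function becomes a family of sets of words; extensionality fixes the function outside
  \<open>A\<close>.\<close>

lemma encodable_functions:
  fixes S :: "('i \<Rightarrow> 'd) set"
  assumes T: "encodable TYPE(('a, 'b) universe) T" and \<iota>: "inj (\<iota> :: 'i \<Rightarrow> ('a + 'b) list)"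
    and S: "\<And>f i. f \<in> S \<Longrightarrow> i \<in> A \<Longrightarrow> f i \<in> T" "S \<subseteq> extensional A"
  shows "encodable TYPE(('a, 'b) universe) S"
proof -
  obtain h :: "_ \<Rightarrow> ('a, 'b) universe" where h: "inj_on h T" using T by (auto simp: encodable_def)
  have "inj_on (\<lambda>f v. h (f (inv_into UNIV \<iota> v))) S"
  proof (rule inj_onI)
    fix f g assume f: "f \<in> S" and g: "g \<in> S" and "(\<lambda>v. h (f (inv_into UNIV \<iota> v))) = (\<lambda>v. h (g (inv_into UNIV \<iota> v)))"
    then have "h (f i) = h (g i)" for i by (metis inv_f_f[OF \<iota>])
    then have "f i = g i" if "i \<in> A" for i using h S(1)[OF f that] S(1)[OF g that] by (meson inj_onD)
    then show "f = g" using f g S(2) by (intro extensionalityI[of _ A]) auto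
  qed
  then show ?thesis by (rule encodable_inj[OF encodable_families]) simp
qed

lemma inj_nat_word: "inj (\<lambda>n. replicate n (Inl undefined :: 'a + 'b))"
  by (intro injI) (metis length_replicate)

lemma encodable_countable:
  "encodable TYPE(('a, 'b) universe) (UNIV :: 'n::countable set)"
proof -
  have "inj (\<lambda>x :: 'n. {replicate (to_nat x) (Inl undefined :: 'a + 'b)})"
    by (intro injI) (metis length_replicate singleton_inject to_nat_split)
  then show ?thesis unfolding encodable_def by blast
qed

text \<open>A pair is a family that takes one value at the empty word and the other one at all
  nonempty words.\<close>

lemma encodable_pairs:
  assumes S: "encodable TYPE(('a, 'b) universe) S" and T: "encodable TYPE(('a, 'b) universe) T"
  shows "encodable TYPE(('a, 'b) universe) (S \<times> T)"
proof -
  obtain h :: "_ \<Rightarrow> ('a, 'b) universe" where h: "inj_on h S" using S by (auto simp: encodable_def)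
  obtain k :: "_ \<Rightarrow> ('a, 'b) universe" where k: "inj_on k T" using T by (auto simp: encodable_def)
  have "inj_on (\<lambda>p (v :: ('a + 'b) list). if v = [] then h (fst p) else k (snd p)) (S \<times> T)"
  proof (rule inj_onI)
    fix p q assume *: "p \<in> S \<times> T" "q \<in> S \<times> T"
      and eq: "(\<lambda>v :: ('a + 'b) list. if v = [] then h (fst p) else k (snd p)) =
        (\<lambda>v. if v = [] then h (fst q) else k (snd q))"
    have "h (fst p) = h (fst q)" using fun_cong[OF eq, of "[]"] by simp
    moreover have "k (snd p) = k (snd q)" using fun_cong[OF eq, of "[Inl undefined]"] by simp
    ultimately have "fst p = fst q" "snd p = snd q"
      using inj_onD[OF h, of "fst p" "fst q"] inj_onD[OF k, of "snd p" "snd q"] * by (simp_all add: mem_Times_iff)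
    then show "p = q" by (rule prod_eqI)
  qed
  then show ?thesis by (rule encodable_inj[OF encodable_families]) simp
qed

lemma encodable_lists:
  assumes T: "encodable TYPE(('a, 'b) universe) T"
  shows "encodable TYPE(('a, 'b) universe) (lists T)"
proof -
  have fam: "encodable TYPE(('a, 'b) universe) {f :: nat \<Rightarrow> ('a, 'b) universe. True}"
    by (rule encodable_functions[OF encodable_UNIV inj_nat_word, where A = UNIV]) auto
  obtain h :: "_ \<Rightarrow> ('a, 'b) universe" where h: "inj_on h T" using T by (auto simp: encodable_def)
  \<comment> \<open>A list is coded by its length and the sequence of its encoded entries, padded
    with \<open>{}\<close>; the length tells padding from entries.\<close>
  have "inj_on (\<lambda>xs. (length xs, \<lambda>i. if i < length xs then h (xs ! i) else {})) (lists T)"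
  proof (rule inj_onI)
    fix xs ys assume xs: "xs \<in> lists T" and ys: "ys \<in> lists T"
      and "(length xs, \<lambda>i. if i < length xs then h (xs ! i) else {}) =
        (length ys, \<lambda>i. if i < length ys then h (ys ! i) else {})"
    then have len: "length xs = length ys"
      and eq: "(\<lambda>i. if i < length xs then h (xs ! i) else {}) = (\<lambda>i. if i < length ys then h (ys ! i) else {})"
      by auto
    have "xs ! i = ys ! i" if i: "i < length xs" for i
    proof -
      have "h (xs ! i) = h (ys ! i)" using fun_cong[OF eq, of i] i len by simp
      moreover have "xs ! i \<in> T" "ys ! i \<in> T" using xs ys i len by (auto simp: in_lists_conv_set)
      ultimately show ?thesis using h by (meson inj_onD)
    qed
    then show "xs = ys" using len by (rule nth_equalityI[rotated])
  qed
  then show ?thesis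
    by (rule encodable_inj[OF encodable_pairs[OF encodable_countable fam]]) auto
qed

text \<open>A finitely supported function is recovered from an enumeration of its support together
  with the values there, which is a list of pairs.\<close>

lemma encodable_finite_support:
  "encodable TYPE(('a, 'b) universe) {f :: ('a, 'b) universe \<Rightarrow> rat. finite {m. f m \<noteq> 0}}"
proof -
  define supp where "supp f = (SOME xs. set xs = {m. f m \<noteq> 0})" for f :: "('a, 'b) universe \<Rightarrow> rat"
  have supp: "set (supp f) = {m. f m \<noteq> 0}" if "finite {m. f m \<noteq> 0}" for f
    unfolding supp_def using finite_list[OF that] by (rule someI_ex)
  have "inj_on (\<lambda>f. map (\<lambda>m. (m, f m)) (supp f)) {f. finite {m. f m \<noteq> 0}}"
  proof (rule inj_onI)
    fix f g assume f: "f \<in> {f. finite {m. f m \<noteq> 0}}" and g: "g \<in> {f. finite {m. f m \<noteq> 0}}"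
      and maps: "map (\<lambda>m. (m, f m)) (supp f) = map (\<lambda>m. (m, g m)) (supp g)"
    have eq: "(\<lambda>m. (m, f m)) ` {m. f m \<noteq> 0} = (\<lambda>m. (m, g m)) ` {m. g m \<noteq> 0}"
      using arg_cong[OF maps, of set] supp[of f] supp[of g] f g by (simp only: set_map mem_Collect_eq)
    have "f m = g m" for m
    proof (cases "f m = 0")
      case True
      have "g m = 0"
      proof (rule ccontr)
        assume "g m \<noteq> 0"
        then have "(m, g m) \<in> (\<lambda>m. (m, f m)) ` {m. f m \<noteq> 0}" unfolding eq by blast
        then show False using True by auto
      qed
      then show ?thesis using True by simp
    next
      case False
      then have "(m, f m) \<in> (\<lambda>m. (m, g m)) ` {m. g m \<noteq> 0}" unfolding eq[symmetric] by blast
      then show ?thesis by auto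
    qed
    then show "f = g" by blast
  qed
  then show ?thesis
    by (rule encodable_inj[OF encodable_lists[OF encodable_pairs[OF encodable_UNIV encodable_countable]]]) auto
qed

text \<open>Choosing one representative in each coset embeds the quotient into the module.\<close>

lemma encodable_quotient_module:
  fixes M :: "('k, 'd) module"
  assumes M: "module R M" and N: "submodule N R M" and enc: "encodable TYPE('c) (carrier M)"
  shows "encodable TYPE('c) (carrier (quotient_module M N))"
proof -
  define rep where "rep C = (SOME x. x \<in> carrier M \<and> C = N +>\<^bsub>M\<^esub> x)" for C
  have rep: "rep C \<in> carrier M \<and> C = N +>\<^bsub>M\<^esub> rep C" if "C \<in> carrier (quotient_module M N)" for C
    unfolding rep_def by (rule someI_ex) (use that in auto)
  then have "inj_on rep (carrier (quotient_module M N))" by (intro inj_onI) metis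
  then show ?thesis by (rule encodable_inj[OF enc]) (use rep in blast)
qed

section \<open>Existence of injective resolutions\<close>

lemma copy_module_injective:
  fixes E :: "('a, 'c) module" and h :: "'c \<Rightarrow> 'u"
  assumes E: "module R E" and h: "inj_on h (carrier E)"
    and ext: "\<And>(A :: ('a, 'u) module) (B :: ('a, 'u) module) i f. module R A \<Longrightarrow> module R B \<Longrightarrow>
      i \<in> module_hom R A B \<Longrightarrow> inj_on i (carrier A) \<Longrightarrow> f \<in> module_hom R A E \<Longrightarrow>
      \<exists>g\<in>module_hom R B E. \<forall>x\<in>carrier A. g (i x) = f x"
  shows "injective_module R (copy_module h E)"
  unfolding injective_module_def
proof (intro conjI allI impI, goal_cases)
  case 1
  show ?case by (rule module_copy_module[OF E h])
next
  case (2 A B i f)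
  then have f: "f \<in> module_hom R A (copy_module h E)" by blast
  let ?f = "\<lambda>x. inv_into (carrier E) h (f x)"
  have "?f \<in> module_hom R A E" by (rule module_hom_compose[OF f copy_module_inv_hom[OF E h]])
  then obtain g where g: "g \<in> module_hom R B E" "\<forall>x\<in>carrier A. g (i x) = ?f x"
    using ext[of A B i ?f] 2 by blast
  show ?case
  proof (intro bexI[of _ "\<lambda>x. h (g x)"] ballI)
    show "(\<lambda>x. h (g x)) \<in> module_hom R B (copy_module h E)"
      by (rule module_hom_compose[OF g(1) copy_module_hom[OF E h]])
    fix x assume x: "x \<in> carrier A"
    have "f x \<in> h ` carrier E" using module_hom_closed[OF f x] by (simp add: copy_module_sel[OF E h])
    then show "h (g (i x)) = f x" using g(2) x by (simp add: f_inv_into_f)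
  qed
qed

lemma injective_embedding:
  fixes M :: "('a, ('a, 'b) universe) module"
  assumes R: "cring R" and M: "module R M"
  obtains E :: "('a, ('a, 'b) universe) module" and \<epsilon>
  where "injective_module R E" "\<epsilon> \<in> module_hom R M E" "inj_on \<epsilon> (carrier M)"
proof -
  interpret M: module R M by fact
  let ?P = "int_module M"
  let ?D = "divisible_hull ?P"
  let ?E = "coinduced_module R ?D"
  have P: "module \<Z> ?P" by (rule module_int_module) (rule M.M.abelian_group_axioms)
  have D: "module \<Z> ?D" by (rule module_divisible_hull[OF P])
  have E: "module R ?E" by (rule module_coinduced_module[OF R D])
  have "encodable TYPE(('a, 'b) universe) (carrier (rational_module ?P))"
    by (rule encodable_inj[OF encodable_finite_support, of id]) (auto simp: rational_module_carrier)
  then have "encodable TYPE(('a, 'b) universe) (carrier ?D)"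
    unfolding divisible_hull_def
    by (rule encodable_quotient_module[OF module_rational_module submodule_int_relations[OF P]])
  \<comment> \<open>The index set \<open>R\<close> is coded by one-letter words; this is where the
    universe has to absorb functions on the type of the ring elements.\<close>
  then have "encodable TYPE(('a, 'b) universe) (carrier ?E)"
    by (rule encodable_functions[where \<iota> = "\<lambda>a. [Inl a]" and A = "carrier R"])
      (auto simp: coinduced_module_carrier[OF R D] inj_def)
  then obtain h :: "_ \<Rightarrow> ('a, 'b) universe" where h: "inj_on h (carrier ?E)" by (auto simp: encodable_def)
  let ?\<epsilon> = "\<lambda>x. \<lambda>s\<in>carrier R. hull_embedding ?P (s \<odot>\<^bsub>M\<^esub> x)"
  have \<epsilon>: "?\<epsilon> \<in> module_hom R M ?E"
    using hull_embedding_closed[OF P] hull_embedding_add[OF P]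
    by (intro coinduced_module_lift[OF R D M]) simp_all
  have inj: "inj_on ?\<epsilon> (carrier M)"
  proof (rule inj_onI)
    fix x y assume x: "x \<in> carrier M" and y: "y \<in> carrier M" and eq: "?\<epsilon> x = ?\<epsilon> y"
    \<comment> \<open>Evaluation at one recovers the image of an element in the divisible
      hull.\<close>
    have "hull_embedding ?P x = hull_embedding ?P y" using fun_cong[OF eq, of "\<one>\<^bsub>R\<^esub>"] x y by simp
    then show "x = y" using inj_onD[OF inj_on_hull_embedding[OF P]] x y by simp
  qed
  show ?thesis
  proof (rule that)
    show "injective_module R (copy_module h ?E)"
    proof (rule copy_module_injective[OF E h])
      fix A B :: "('a, ('a, 'b) universe) module" and i f
      assume AB: "module R A" "module R B" "i \<in> module_hom R A B" "inj_on i (carrier A)" "f \<in> module_hom R A ?E"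
      obtain g where "g \<in> module_hom R B ?E" "\<And>x. x \<in> carrier A \<Longrightarrow> g (i x) = f x"
        by (rule coinduced_module_extend[OF R D divisible_divisible_hull[OF P] AB]) (rule that)
      then show "\<exists>g\<in>module_hom R B ?E. \<forall>x\<in>carrier A. g (i x) = f x" by (intro bexI[of _ g]) auto
    qed
    show "(\<lambda>x. h (?\<epsilon> x)) \<in> module_hom R M (copy_module h ?E)"
      by (rule module_hom_compose[OF \<epsilon> copy_module_hom[OF E h]])
    show "inj_on (\<lambda>x. h (?\<epsilon> x)) (carrier M)"
    proof (rule inj_onI)
      fix x y assume xy: "x \<in> carrier M" "y \<in> carrier M" and "h (?\<epsilon> x) = h (?\<epsilon> y)"
      then have "?\<epsilon> x = ?\<epsilon> y" using inj_onD[OF h] module_hom_closed[OF \<epsilon>] by blast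
      then show "x = y" by (rule inj_onD[OF inj _ xy])
    qed
  qed
qed

text \<open>One step of a resolution, with the cokernel named as a module of its own so that the
  step can be repeated on it.\<close>

definition embedding_with_cokernel where
  "embedding_with_cokernel R M E \<epsilon> C \<pi> \<longleftrightarrow> injective_module R E \<and> \<epsilon> \<in> module_hom R M E \<and>
    inj_on \<epsilon> (carrier M) \<and> module R C \<and> \<pi> \<in> module_hom R E C \<and> \<pi> ` carrier E = carrier C \<and>
    {x \<in> carrier E. \<pi> x = \<zero>\<^bsub>C\<^esub>} = \<epsilon> ` carrier M"

lemma embedding_with_cokernel_exists:
  fixes M :: "('a, ('a, 'b) universe) module"
  assumes R: "cring R" and M: "module R M"
  shows "\<exists>(E :: ('a, ('a, 'b) universe) module) \<epsilon> (C :: ('a, ('a, 'b) universe) module) \<pi>.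
    embedding_with_cokernel R M E \<epsilon> C \<pi>"
proof -
  obtain E :: "('a, ('a, 'b) universe) module" and \<epsilon>
    where E: "injective_module R E" and \<epsilon>: "\<epsilon> \<in> module_hom R M E" "inj_on \<epsilon> (carrier M)"
    by (rule injective_embedding[OF R M])
  have Em: "module R E" using E by (simp add: injective_module_def)
  have N: "submodule (\<epsilon> ` carrier M) R E"
    by (rule submodule_image[OF M Em \<epsilon>(1) module.carrier_is_submodule[OF M]])
  let ?Q = "quotient_module E (\<epsilon> ` carrier M)"
  note Q = module_quotient_module[OF Em N]
  have "encodable TYPE(('a, 'b) universe) (carrier E)"
    by (rule encodable_inj[OF encodable_UNIV, of id]) simp_all
  then have "encodable TYPE(('a, 'b) universe) (carrier ?Q)"
    by (rule encodable_quotient_module[OF Em N])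
  then obtain k :: "_ \<Rightarrow> ('a, 'b) universe" where k: "inj_on k (carrier ?Q)" by (auto simp: encodable_def)
  let ?q = "\<lambda>x. (\<epsilon> ` carrier M) +>\<^bsub>E\<^esub> x"
  let ?C = "copy_module k ?Q" and ?\<pi> = "\<lambda>x. k (?q x)"
  have qc: "?q x \<in> carrier ?Q" if "x \<in> carrier E" for x using that by simp
  have z: "\<zero>\<^bsub>?Q\<^esub> \<in> carrier ?Q" by (rule submodule_zero[OF module.carrier_is_submodule[OF Q]])
  have "?\<pi> x = \<zero>\<^bsub>?C\<^esub> \<longleftrightarrow> x \<in> \<epsilon> ` carrier M" if x: "x \<in> carrier E" for x
    using inj_on_eq_iff[OF k qc[OF x] z] coset_eq_zero_iff[OF Em N x]
    by (simp add: copy_module_sel[OF Q k])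
  then have "{x \<in> carrier E. ?\<pi> x = \<zero>\<^bsub>?C\<^esub>} = \<epsilon> ` carrier M" using submodule_subset[OF N] by blast
  moreover have "?\<pi> \<in> module_hom R E ?C"
    by (rule module_hom_compose[OF quotient_module_hom[OF Em N] copy_module_hom[OF Q k]])
  moreover have "?\<pi> ` carrier E = carrier ?C" by (simp add: copy_module_sel[OF Q k] image_image)
  ultimately have "embedding_with_cokernel R M E \<epsilon> ?C ?\<pi>"
    unfolding embedding_with_cokernel_def using E \<epsilon> module_copy_module[OF Q k] by blast
  then show ?thesis by blast
qed

theorem injective_resolution_exists:
  fixes R :: "('a, 'r) ring_scheme" and X :: "('a, 'b) module"
  assumes R: "cring R" and X: "module R X"
  shows "\<exists>(E :: nat \<Rightarrow> ('a, ('a, 'b) universe) module) d \<epsilon>. injective_resolution R X E d \<epsilon>"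
proof -
  \<comment> \<open>Singletons of one-letter words place \<open>X\<close> into the universe, so that
    the iteration starts in the type in which it stays.\<close>
  define j :: "'b \<Rightarrow> ('a, 'b) universe" where "j x = {[Inr x]}" for x
  have j: "inj_on j (carrier X)" by (intro inj_onI) (simp add: j_def)
  \<comment> \<open>The four choices are made for every module of the universe at once and bundled
    as a tuple, so that the resolution arises by iterating the cokernel \<open>C\<close>.\<close>
  have "\<forall>M \<in> {M :: ('a, ('a, 'b) universe) module. module R M}. \<exists>p.
      embedding_with_cokernel R M (fst p :: ('a, ('a, 'b) universe) module) (fst (snd p))
      (fst (snd (snd p)) :: ('a, ('a, 'b) universe) module) (snd (snd (snd p)))"
  proof
    fix M :: "('a, ('a, 'b) universe) module" assume "M \<in> {M. module R M}"
    then have "module R M" by simp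
    from embedding_with_cokernel_exists[OF R this]
    obtain E \<epsilon> C \<pi> where "embedding_with_cokernel R M (E :: ('a, ('a, 'b) universe) module) \<epsilon>
        (C :: ('a, ('a, 'b) universe) module) \<pi>"
      by (elim exE)
    then show "\<exists>p. embedding_with_cokernel R M (fst p :: ('a, ('a, 'b) universe) module) (fst (snd p))
      (fst (snd (snd p)) :: ('a, ('a, 'b) universe) module) (snd (snd (snd p)))"
      by (intro exI[of _ "(E, \<epsilon>, C, \<pi>)"]) simp
  qed
  from bchoice[OF this] obtain F where F: "\<And>M :: ('a, ('a, 'b) universe) module. module R M \<Longrightarrow>
      embedding_with_cokernel R M (fst (F M) :: ('a, ('a, 'b) universe) module) (fst (snd (F M)))
      (fst (snd (snd (F M))) :: ('a, ('a, 'b) universe) module) (snd (snd (snd (F M))))"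
    by auto
  define E where "E M = fst (F M)" for M
  define \<epsilon> where "\<epsilon> M = fst (snd (F M))" for M
  define C where "C M = fst (snd (snd (F M)))" for M
  define \<pi> where "\<pi> M = snd (snd (snd (F M)))" for M
  have step: "embedding_with_cokernel R M (E M) (\<epsilon> M) (C M) (\<pi> M)" if "module R M" for M
    using F[OF that] by (simp add: E_def \<epsilon>_def C_def \<pi>_def)
  define M where "M n = (C ^^ n) (copy_module j X)" for n
  have M: "module R (M n)" for n
  proof (induction n)
    case 0
    then show ?case by (simp add: M_def module_copy_module[OF X j])
  next
    case (Suc n)
    then show ?case using step[of "M n"] by (simp add: M_def embedding_with_cokernel_def)
  qed
  have M_Suc: "C (M n) = M (Suc n)" for n by (simp add: M_def)
  note st = step[OF M, unfolded embedding_with_cokernel_def M_Suc]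
  have inj: "injective_module R (E (M n))" and \<epsilon>: "\<epsilon> (M n) \<in> module_hom R (M n) (E (M n))"
    and \<epsilon>_inj: "inj_on (\<epsilon> (M n)) (carrier (M n))" and \<pi>: "\<pi> (M n) \<in> module_hom R (E (M n)) (M (Suc n))"
    and \<pi>_surj: "\<pi> (M n) ` carrier (E (M n)) = carrier (M (Suc n))"
    and \<pi>_ker: "{x \<in> carrier (E (M n)). \<pi> (M n) x = \<zero>\<^bsub>M (Suc n)\<^esub>} = \<epsilon> (M n) ` carrier (M n)" for n
    using st[of n] by auto
  have Em: "module R (E (M n))" for n using inj by (simp add: injective_module_def)
  \<comment> \<open>The short exact sequences \<open>M n -> E (M n) -> M (Suc n)\<close> are
    spliced. As \<open>\<epsilon>\<close> is injective, the kernel of \<open>d n\<close> is that of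
    \<open>\<pi>\<close>, which is the image of \<open>M n\<close>.\<close>
  define d where "d n x = \<epsilon> (M (Suc n)) (\<pi> (M n) x)" for n x
  have d: "d n \<in> module_hom R (E (M n)) (E (M (Suc n)))" for n
    unfolding d_def[abs_def] by (rule module_hom_compose[OF \<pi> \<epsilon>])
  have d_image: "d n ` carrier (E (M n)) = \<epsilon> (M (Suc n)) ` carrier (M (Suc n))" for n
    by (simp add: d_def[abs_def] image_image[symmetric] \<pi>_surj)
  have d_ker: "{x \<in> carrier (E (M n)). d n x = \<zero>\<^bsub>E (M (Suc n))\<^esub>} = \<epsilon> (M n) ` carrier (M n)" for n
  proof -
    have "d n x = \<zero>\<^bsub>E (M (Suc n))\<^esub> \<longleftrightarrow> \<pi> (M n) x = \<zero>\<^bsub>M (Suc n)\<^esub>" if x: "x \<in> carrier (E (M n))" for x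
      using inj_on_eq_iff[OF \<epsilon>_inj module_hom_closed[OF \<pi> x] submodule_zero[OF module.carrier_is_submodule[OF M]]]
        module_hom_zero[OF \<epsilon> M Em, of "Suc n"]
      by (simp add: d_def)
    then have "{x \<in> carrier (E (M n)). d n x = \<zero>\<^bsub>E (M (Suc n))\<^esub>} =
        {x \<in> carrier (E (M n)). \<pi> (M n) x = \<zero>\<^bsub>M (Suc n)\<^esub>}"
      by (intro Collect_cong conj_cong refl)
    then show ?thesis unfolding \<pi>_ker .
  qed
  let ?\<epsilon> = "\<lambda>x. \<epsilon> (M 0) (j x)"
  have M0: "M 0 = copy_module j X" by (simp add: M_def)
  have jh: "j \<in> module_hom R X (M 0)" unfolding M0 by (rule copy_module_hom[OF X j])
  have j_surj: "j ` carrier X = carrier (M 0)" unfolding M0 by (simp add: copy_module_sel[OF X j])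
  have "injective_resolution R X (\<lambda>n. E (M n)) d ?\<epsilon>"
    unfolding injective_resolution_def a_kernel_eq
  proof (intro conjI allI)
    show "injective_module R (E (M n))" "d n \<in> module_hom R (E (M n)) (E (M (Suc n)))" for n
      by (fact inj d)+
    show "?\<epsilon> \<in> module_hom R X (E (M 0))" by (rule module_hom_compose[OF jh \<epsilon>])
    show "inj_on ?\<epsilon> (carrier X)"
      using comp_inj_on[OF j, of "\<epsilon> (M 0)"] \<epsilon>_inj[of 0] j_surj by (simp add: comp_def)
    show "{x \<in> carrier (E (M 0)). d 0 x = \<zero>\<^bsub>E (M 1)\<^esub>} = ?\<epsilon> ` carrier X"
      using d_ker[of 0] j_surj by (simp add: image_image[symmetric])
    show "{x \<in> carrier (E (M (Suc n))). d (Suc n) x = \<zero>\<^bsub>E (M (Suc (Suc n)))\<^esub>} = d n ` carrier (E (M n))" for n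
      unfolding d_image d_ker ..
  qed
  then show ?thesis by (intro exI)
qed

theorem proposition2p6:
  fixes R :: "('a, 'r) ring_scheme" and X :: "('a, 'b) module"
    and \<aa> :: "'a set" and t :: nat
  assumes "cring R" and "noetherian_ring R"
    and "ideal \<aa> R"
    and "module R X"
    and "t > 0"
  shows "(\<forall>i<t. artinian_module R (local_cohomology R \<aa> i X)) \<longleftrightarrow>
         (\<forall>i<t. artinian_module R (Ext R i (quotient_module (regular_module R) \<aa>) X))"
proof -
  obtain E d where chosen: "chosen_resolution R X = (E, d)" by (cases "chosen_resolution R X")
  \<comment> \<open>\<open>chosen_resolution\<close> is a Hilbert choice, and existence turns it
    into an actual resolution. Both derived functors are computed from this same resolution, so the
    two cohomologies are compared on one complex.\<close>
  have "\<exists>p. case p of (E :: nat \<Rightarrow> ('a, ('a, 'b) universe) module, d) \<Rightarrow> \<exists>\<epsilon>. injective_resolution R X E d \<epsilon>"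
    using injective_resolution_exists[OF assms(1,4)] by auto
  from someI_ex[OF this] obtain \<epsilon> where res: "injective_resolution R X E d \<epsilon>"
    using chosen unfolding chosen_resolution_def by auto
  have E: "injective_module R (E n)" and d: "d n \<in> module_hom R (E n) (E (Suc n))" for n
    using res by (auto simp: injective_resolution_def)
  have dd: "d (Suc n) (d n x) = \<zero>\<^bsub>E (Suc (Suc n))\<^esub>" if "x \<in> carrier (E n)" for n x
  proof -
    have "{y \<in> carrier (E (Suc n)). d (Suc n) y = \<zero>\<^bsub>E (Suc (Suc n))\<^esub>} = d n ` carrier (E n)"
      using res by (simp add: injective_resolution_def a_kernel_eq)
    then show ?thesis using that by blast
  qed
  show ?thesis
    unfolding local_cohomology_def Ext_def right_derived_def chosen Let_def prod.case cyclic_module_def[symmetric]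
    by (rule artinian_cohomology_iff[where E = E and d = d, OF assms(1-3) E d dd])
qed

end
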